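(* Let $B$ be a bicyclic graph that is $L$-DS, and suppose $B$ is not isomorphic to $\Theta_{3,2,5}$. Then for every positive integer $m$, the product $B\times K_m$ is $L$-DS.
   Context: All graphs are finite, simple and undirected. A bicyclic graph is a connected graph $G$ with $|EG|=|VG|+1$. $\Theta_{3,2,5}$ denotes the graph on 6 vertices formed by a cycle $C_3$ and a cycle $C_5$ whose intersection is exactly one common edge (a path on 2 vertices). The Laplacian matrix of a graph $G$ is $L(G)=D(G)-A(G)$ ($A(G)$ adjacency matrix, $D(G)$ diagonal degree matrix); its multiset of eigenvalues is the Laplacian spectrum. Two graphs are $L$-cospectral if they have the same Laplacian spectrum; a graph is $L$-DS if every graph $L$-cospectral with it is isomorphic to it. For graphs $G_1,G_2$ on disjoint vertex sets, $G_1\times G_2$ is the disjoint union of $G_1$ and $G_2$ together with all edges between $VG_1$ and $VG_2$ (the join). $K_m$ is the complete graph on $m$ vertices. *)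

theory Defs
  imports
    "Graph_Theory.Pair_Digraph"
    "Graph_Theory.Digraph_Isomorphism"
    "Graph_Theory.Kuratowski"
    "Jordan_Normal_Form.Char_Poly"
    "HOL-Computational_Algebra.Fundamental_Theorem_Algebra"
begin

text \<open>
  A finite simple undirected graph is a \<^term>\<open>pair_graph\<close>: a finite vertex set with a finite,
  irreflexive and symmetric arc relation. An undirected edge is thus a pair of opposite arcs, and
  the degree of a vertex is its out-degree.
\<close>

definition edge_set :: "'a pair_pre_digraph \<Rightarrow> 'a set set" where
  "edge_set G = (\<lambda>(u, v). {u, v}) ` parcs G"

definition graph_iso :: "'a pair_pre_digraph \<Rightarrow> 'b pair_pre_digraph \<Rightarrow> bool" where
  "graph_iso G H \<longleftrightarrow> digraph_iso (with_proj G) (with_proj H)"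

definition bicyclic :: "'a pair_pre_digraph \<Rightarrow> bool" where
  "bicyclic G \<longleftrightarrow> pair_graph G \<and> Digraph_Component.connected (with_proj G) \<and>
     card (edge_set G) = card (pverts G) + 1"


subsection \<open>The Laplacian spectrum\<close>

text \<open>
  The matrices are written with respect to an enumeration \<open>vs\<close> of the vertices. The entries are
  complex so that the multiset of roots of the characteristic polynomial contains all eigenvalues
  with their multiplicities.
\<close>

definition adjacency_mat :: "'a pair_pre_digraph \<Rightarrow> 'a list \<Rightarrow> complex mat" where
  "adjacency_mat G vs =
     mat (length vs) (length vs) (\<lambda>(i, j). if (vs ! i, vs ! j) \<in> parcs G then 1 else 0)"

definition degree_mat :: "'a pair_pre_digraph \<Rightarrow> 'a list \<Rightarrow> complex mat" where
  "degree_mat G vs =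
     mat (length vs) (length vs)
       (\<lambda>(i, j). if i = j then of_nat (out_degree (with_proj G) (vs ! i)) else 0)"

definition laplacian_mat :: "'a pair_pre_digraph \<Rightarrow> 'a list \<Rightarrow> complex mat" where
  "laplacian_mat G vs = degree_mat G vs - adjacency_mat G vs"

definition vertex_enum :: "'a pair_pre_digraph \<Rightarrow> 'a list \<Rightarrow> bool" where
  "vertex_enum G vs \<longleftrightarrow> distinct vs \<and> set vs = pverts G"

text \<open>The choice of the enumeration is irrelevant, see \<open>laplacian_spectrum_eq\<close> below.\<close>

definition laplacian_spectrum :: "'a pair_pre_digraph \<Rightarrow> complex multiset" where
  "laplacian_spectrum G = proots (char_poly (laplacian_mat G (SOME vs. vertex_enum G vs)))"

definition L_cospectral :: "'a pair_pre_digraph \<Rightarrow> 'b pair_pre_digraph \<Rightarrow> bool" where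
  "L_cospectral G H \<longleftrightarrow> laplacian_spectrum G = laplacian_spectrum H"

text \<open>
  HOL cannot quantify over types inside a formula, so the competing graphs have natural numbers
  as vertices. As every finite graph is isomorphic to such a graph, this is no restriction:
  see \<open>L_DS_imp\<close> below.
\<close>

definition L_DS :: "'a pair_pre_digraph \<Rightarrow> bool" where
  "L_DS G \<longleftrightarrow> (\<forall>H :: nat pair_pre_digraph. pair_graph H \<longrightarrow> L_cospectral G H \<longrightarrow> graph_iso G H)"


subsection \<open>The join and the graph \<open>\<Theta>\<^sub>3\<^sub>,\<^sub>2\<^sub>,\<^sub>5\<close>\<close>

definition graph_join ::
  "'a pair_pre_digraph \<Rightarrow> 'b pair_pre_digraph \<Rightarrow> ('a + 'b) pair_pre_digraph" where
  "graph_join G H =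
     \<lparr>pverts = pverts G <+> pverts H,
      parcs = (\<lambda>(u, v). (Inl u, Inl v)) ` parcs G \<union> (\<lambda>(u, v). (Inr u, Inr v)) ` parcs H \<union>
              (Inl ` pverts G) \<times> (Inr ` pverts H) \<union> (Inr ` pverts H) \<times> (Inl ` pverts G)\<rparr>"

definition cycle_arcs :: "'a list \<Rightarrow> 'a rel" where
  "cycle_arcs vs = set (zip vs (rotate1 vs)) \<union> (set (zip vs (rotate1 vs)))\<inverse>"

definition Theta_3_2_5 :: "nat pair_pre_digraph" where
  "Theta_3_2_5 =
     \<lparr>pverts = {0, 1, 2, 3, 4, 5},
      parcs = cycle_arcs [0, 1, 2] \<union> cycle_arcs [0, 1, 3, 4, 5]\<rparr>"


subsection \<open>Adequacy of the definitions\<close>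

lemma graph_iso_iff:
  assumes "pair_graph G" "pair_graph H"
  shows "graph_iso G H \<longleftrightarrow>
    (\<exists>f. bij_betw f (pverts G) (pverts H) \<and>
         (\<forall>u \<in> pverts G. \<forall>v \<in> pverts G. (u, v) \<in> parcs G \<longleftrightarrow> (f u, f v) \<in> parcs H))"
proof
  interpret G: pair_graph G by fact
  interpret H: pair_graph H by fact
  {
    assume "graph_iso G H"
    then obtain h where h: "pre_digraph.digraph_isomorphism (with_proj G) h"
      and eq: "with_proj H = app_iso h (with_proj G)"
      by (auto simp: graph_iso_def digraph_iso_def)
    define f where "f = iso_verts h"
    have inj: "inj_on f (pverts G)"
      using h by (auto simp: pre_digraph.digraph_isomorphism_def f_def)
    have V: "pverts H = f ` pverts G"
      using arg_cong[OF eq, of verts] by (simp add: f_def)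
    have A: "parcs H = (\<lambda>(u, v). (f u, f v)) ` parcs G"
      using arg_cong[OF eq, of arcs_ends] G.arcs_ends_app_iso_eq[OF h] by (simp add: f_def)
    show "\<exists>f. bij_betw f (pverts G) (pverts H) \<and>
         (\<forall>u \<in> pverts G. \<forall>v \<in> pverts G. (u, v) \<in> parcs G \<longleftrightarrow> (f u, f v) \<in> parcs H)"
    proof (intro exI conjI ballI)
      show "bij_betw f (pverts G) (pverts H)" using inj V by (simp add: bij_betw_def)
      fix u v assume uv: "u \<in> pverts G" "v \<in> pverts G"
      show "(u, v) \<in> parcs G \<longleftrightarrow> (f u, f v) \<in> parcs H"
      proof
        assume "(f u, f v) \<in> parcs H"
        then obtain u' v' where "(u', v') \<in> parcs G" "f u = f u'" "f v = f v'" by (auto simp: A)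
        moreover from this have "u' \<in> pverts G" "v' \<in> pverts G"
          using G.wellformed' by blast+
        ultimately show "(u, v) \<in> parcs G" using uv inj by (metis inj_onD)
      qed (auto simp: A)
    qed
  }
  {
    assume "\<exists>f. bij_betw f (pverts G) (pverts H) \<and>
         (\<forall>u \<in> pverts G. \<forall>v \<in> pverts G. (u, v) \<in> parcs G \<longleftrightarrow> (f u, f v) \<in> parcs H)"
    then obtain f where f: "bij_betw f (pverts G) (pverts H)"
      and e: "\<And>u v. u \<in> pverts G \<Longrightarrow> v \<in> pverts G \<Longrightarrow> (u, v) \<in> parcs G \<longleftrightarrow> (f u, f v) \<in> parcs H"
      by blast
    define h where "h = \<lparr>iso_verts = f, iso_arcs = map_prod f f, iso_head = snd, iso_tail = fst\<rparr>"
    have inj: "inj_on f (pverts G)" and im: "f ` pverts G = pverts H"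
      using f by (auto simp: bij_betw_def)
    have sub: "parcs G \<subseteq> pverts G \<times> pverts G" using G.wellformed' by auto
    have "inj_on (map_prod f f) (parcs G)"
      by (rule inj_on_subset[OF map_prod_inj_on[OF inj inj] sub])
    then have "pre_digraph.digraph_isomorphism (with_proj G) h"
      using inj G.wf_digraph by (auto simp: pre_digraph.digraph_isomorphism_def h_def)
    moreover have "map_prod f f ` parcs G = parcs H"
    proof (intro equalityI subsetI)
      fix e assume "e \<in> parcs H"
      then obtain x y where xy: "e = (x, y)" "(x, y) \<in> parcs H" by (cases e) auto
      then have "x \<in> f ` pverts G" "y \<in> f ` pverts G" using H.wellformed' im by blast+
      then show "e \<in> map_prod f f ` parcs G" using xy e by (auto intro!: rev_image_eqI)
    qed (use e sub in auto)
    then have "with_proj H = app_iso h (with_proj G)"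
      using im by (simp add: app_iso_def h_def with_proj_def)
    ultimately show "graph_iso G H" by (auto simp: graph_iso_def digraph_iso_def)
  }
qed

lemma ex_vertex_enum: "pair_graph G \<Longrightarrow> \<exists>vs. vertex_enum G vs"
proof -
  assume "pair_graph G"
  then interpret pair_graph G .
  show ?thesis using finite_distinct_list[OF pair_finite_verts] by (auto simp: vertex_enum_def)
qed

lemma laplacian_mat_index:
  "i < length vs \<Longrightarrow> j < length vs \<Longrightarrow> laplacian_mat G vs $$ (i, j) =
     (if i = j then of_nat (out_degree (with_proj G) (vs ! i)) else 0) -
     (if (vs ! i, vs ! j) \<in> parcs G then 1 else 0)"
  by (simp add: laplacian_mat_def degree_mat_def adjacency_mat_def)

lemma laplacian_mat_dim[simp]:
  "dim_row (laplacian_mat G vs) = length vs" "dim_col (laplacian_mat G vs) = length vs"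
  "laplacian_mat G vs \<in> carrier_mat (length vs) (length vs)"
  by (auto simp: laplacian_mat_def degree_mat_def adjacency_mat_def)

lemma char_poly_laplacian_eq:
  assumes vs: "vertex_enum G vs" and ws: "vertex_enum G ws"
  shows "char_poly (laplacian_mat G vs) = char_poly (laplacian_mat G ws)"
proof -
  define n where "n = length vs"
  have d: "distinct vs" "distinct ws" "set vs = set ws"
    using assms by (auto simp: vertex_enum_def)
  have n: "length ws = n" using d by (metis distinct_card n_def)
  have "mset vs = mset ws" using d by (simp add: set_eq_iff_mset_eq_distinct)
  then obtain p where p: "p permutes {..<length ws}" "permute_list p ws = vs"
    by (rule mset_eq_permutation)
  have pn: "p permutes {0..<n}" using p n by (simp add: lessThan_atLeast0)
  have plt: "p i < n" if "i < n" for i using permutes_in_image[OF pn, of i] that by auto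
  have nth: "vs ! i = ws ! p i" if "i < n" for i
    using p n that by (metis permute_list_nth)
  define P :: "complex mat" where "P = mat n n (\<lambda>(i, j). if j = p i then 1 else 0)"
  define Q :: "complex mat" where "Q = mat n n (\<lambda>(i, j). if i = p j then 1 else 0)"
  have [simp]: "P \<in> carrier_mat n n" "Q \<in> carrier_mat n n" by (auto simp: P_def Q_def)
  have PQ: "P * Q = 1\<^sub>m n"
  proof (rule eq_matI)
    fix i j assume "i < dim_row (1\<^sub>m n :: complex mat)" "j < dim_col (1\<^sub>m n :: complex mat)"
    then have ij: "i < n" "j < n" by auto
    have "(P * Q) $$ (i, j) = (\<Sum>k\<in>{0..<n}. (if k = p i then 1 else 0) * (if k = p j then 1 else 0))"
      using ij by (simp add: P_def Q_def scalar_prod_def)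
    also have "\<dots> = (\<Sum>k\<in>{0..<n}. if k = p i then (if p i = p j then 1 else 0) else 0)"
      by (rule sum.cong) auto
    also have "\<dots> = (if p i = p j then 1 else 0)" using plt ij by (simp add: sum.delta)
    also have "\<dots> = 1\<^sub>m n $$ (i, j)" using ij permutes_inj[OF pn] by (auto dest: injD)
    finally show "(P * Q) $$ (i, j) = 1\<^sub>m n $$ (i, j)" .
  qed (auto simp: P_def Q_def)
  have QP: "Q * P = 1\<^sub>m n"
    by (rule mat_mult_left_right_inverse[OF _ _ PQ]) auto
  have carr: "laplacian_mat G vs \<in> carrier_mat n n" "laplacian_mat G ws \<in> carrier_mat n n"
    using n n_def by (metis laplacian_mat_dim(3))+
  have "laplacian_mat G vs = P * laplacian_mat G ws * Q"
  proof (rule eq_matI)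
    let ?L = "laplacian_mat G ws"
    fix i j assume "i < dim_row (P * ?L * Q)" "j < dim_col (P * ?L * Q)"
    then have ij: "i < n" "j < n" by (auto simp: P_def Q_def)
    have 1: "(P * ?L) $$ (i, k) = ?L $$ (p i, k)" if "k < n" for k
    proof -
      have "(P * ?L) $$ (i, k) = (\<Sum>l\<in>{0..<n}. (if l = p i then 1 else 0) * ?L $$ (l, k))"
        using ij that n by (simp add: P_def scalar_prod_def)
      also have "\<dots> = (\<Sum>l\<in>{0..<n}. if l = p i then ?L $$ (p i, k) else 0)"
        by (rule sum.cong) auto
      finally show ?thesis using plt ij by (simp add: sum.delta)
    qed
    have "(P * ?L * Q) $$ (i, j) =
        (\<Sum>k\<in>{0..<n}. (P * ?L) $$ (i, k) * (if k = p j then 1 else 0))"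
      using ij n by (simp add: P_def Q_def scalar_prod_def)
    also have "\<dots> = (\<Sum>k\<in>{0..<n}. if k = p j then ?L $$ (p i, p j) else 0)"
      by (rule sum.cong) (auto simp: 1)
    also have "\<dots> = ?L $$ (p i, p j)" using plt ij by (simp add: sum.delta)
    also have "\<dots> = laplacian_mat G vs $$ (i, j)"
      using ij n n_def plt nth permutes_inj[OF pn] by (auto simp: laplacian_mat_index dest: injD)
    finally show "laplacian_mat G vs $$ (i, j) = (P * ?L * Q) $$ (i, j)" by simp
  qed (auto simp: P_def Q_def n_def)
  then have "similar_mat_wit (laplacian_mat G vs) (laplacian_mat G ws) P Q"
    using carr PQ QP carrier_matD(1)[OF carr(1)] unfolding similar_mat_wit_def Let_def by simp
  then show ?thesis by (intro char_poly_similar) (auto simp: similar_mat_def)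
qed

lemma laplacian_spectrum_eq:
  assumes "vertex_enum G vs"
  shows "laplacian_spectrum G = proots (char_poly (laplacian_mat G vs))"
  unfolding laplacian_spectrum_def
  using char_poly_laplacian_eq[OF someI[of "vertex_enum G", OF assms] assms] by simp

lemma graph_iso_laplacian_spectrum:
  assumes "pair_graph G" "pair_graph H" "graph_iso G H"
  shows "laplacian_spectrum G = laplacian_spectrum H"
proof -
  interpret G: pair_graph G by fact
  interpret H: pair_graph H by fact
  obtain f where f: "bij_betw f (pverts G) (pverts H)"
    and e: "\<And>u v. u \<in> pverts G \<Longrightarrow> v \<in> pverts G \<Longrightarrow> (u, v) \<in> parcs G \<longleftrightarrow> (f u, f v) \<in> parcs H"
    using assms graph_iso_iff by blast
  have inj: "inj_on f (pverts G)" and im: "f ` pverts G = pverts H"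
    using f by (auto simp: bij_betw_def)
  obtain vs where vs: "vertex_enum G vs" using ex_vertex_enum assms by blast
  have ws: "vertex_enum H (map f vs)"
    using vs inj im by (auto simp: vertex_enum_def distinct_map)
  have deg: "out_degree (with_proj G) u = out_degree (with_proj H) (f u)" if "u \<in> pverts G" for u
  proof -
    have "out_arcs (with_proj H) (f u) = map_prod f f ` out_arcs (with_proj G) u"
    proof (intro equalityI subsetI)
      fix a assume "a \<in> out_arcs (with_proj H) (f u)"
      then obtain y where y: "a = (f u, y)" "(f u, y) \<in> parcs H"
        by (cases a) (auto simp: out_arcs_def)
      then obtain v where "v \<in> pverts G" "y = f v" using H.wellformed' im by blast
      then show "a \<in> map_prod f f ` out_arcs (with_proj G) u"
        using y e that by (auto simp: out_arcs_def intro!: rev_image_eqI)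
    next
      fix a assume "a \<in> map_prod f f ` out_arcs (with_proj G) u"
      then obtain v where v: "(u, v) \<in> parcs G" "a = (f u, f v)" by (auto simp: out_arcs_def)
      moreover from v have "v \<in> pverts G" using G.wellformed' by blast
      ultimately have "(f u, f v) \<in> parcs H" using e that by blast
      then show "a \<in> out_arcs (with_proj H) (f u)" using v by (simp add: out_arcs_def)
    qed
    moreover have "inj_on (map_prod f f) (out_arcs (with_proj G) u)"
      by (rule inj_on_subset[OF map_prod_inj_on[OF inj inj]])
        (use G.wellformed' in \<open>auto simp: out_arcs_def\<close>)
    ultimately show ?thesis by (simp add: out_degree_def card_image)
  qed
  have "laplacian_mat G vs = laplacian_mat H (map f vs)"
  proof (rule eq_matI)
    fix i j assume "i < dim_row (laplacian_mat H (map f vs))" "j < dim_col (laplacian_mat H (map f vs))"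
    then have ij: "i < length vs" "j < length vs" by auto
    then have *: "vs ! i \<in> pverts G" "vs ! j \<in> pverts G"
      using vs nth_mem[of i vs] nth_mem[of j vs] unfolding vertex_enum_def by blast+
    show "laplacian_mat G vs $$ (i, j) = laplacian_mat H (map f vs) $$ (i, j)"
      using ij e[OF *, symmetric] deg[OF *(2)] by (simp add: laplacian_mat_index)
  qed auto
  then show ?thesis using laplacian_spectrum_eq[OF vs] laplacian_spectrum_eq[OF ws] by simp
qed

lemma ex_graph_iso_nat:
  assumes "pair_graph G"
  shows "\<exists>H :: nat pair_pre_digraph. pair_graph H \<and> graph_iso G H"
proof -
  interpret G: pair_graph G by fact
  obtain f :: "'a \<Rightarrow> nat" where inj: "inj_on f (pverts G)"
    using finite_imp_inj_to_nat_seg[OF G.pair_finite_verts] by blast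
  define H where "H = \<lparr>pverts = f ` pverts G, parcs = map_prod f f ` parcs G\<rparr>"
  have H: "pair_graph H"
  proof unfold_locales
    show "symmetric (with_proj H)"
      using G.arcs_symmetric by (force simp: symmetric_def H_def intro: symI)
  next
    fix e assume "e \<in> parcs H"
    then obtain u v where uv: "(u, v) \<in> parcs G" "e = (f u, f v)" by (auto simp: H_def)
    then have "u \<noteq> v" "u \<in> pverts G" "v \<in> pverts G"
      using G.no_loops' G.wellformed' by blast+
    then show "fst e \<noteq> snd e" using uv inj by (auto dest: inj_onD)
  qed (use G.wellformed' in \<open>auto simp: H_def\<close>)
  have "graph_iso G H"
    unfolding graph_iso_iff[OF assms H]
  proof (intro exI[of _ f] conjI ballI)
    show "bij_betw f (pverts G) (pverts H)" using inj by (simp add: bij_betw_def H_def)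
    fix u v assume uv: "u \<in> pverts G" "v \<in> pverts G"
    show "(u, v) \<in> parcs G \<longleftrightarrow> (f u, f v) \<in> parcs H"
    proof
      assume "(f u, f v) \<in> parcs H"
      then obtain u' v' where "(u', v') \<in> parcs G" "f u = f u'" "f v = f v'" by (auto simp: H_def)
      moreover from this have "u' \<in> pverts G" "v' \<in> pverts G"
        using G.wellformed' by blast+
      ultimately show "(u, v) \<in> parcs G" using uv inj by (metis inj_onD)
    qed (auto simp: H_def)
  qed
  with H show ?thesis by blast
qed

lemma L_DS_imp:
  fixes G :: "'a pair_pre_digraph" and H :: "'b pair_pre_digraph"
  assumes G: "pair_graph G" "L_DS G" and H: "pair_graph H" "L_cospectral G H"
  shows "graph_iso G H"
proof -
  obtain N :: "nat pair_pre_digraph" where N: "pair_graph N" "graph_iso H N"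
    using ex_graph_iso_nat H(1) by blast
  have "L_cospectral G N"
    using graph_iso_laplacian_spectrum[OF H(1) N] H(2) by (simp add: L_cospectral_def)
  then have "graph_iso G N" using G N by (auto simp: L_DS_def)
  moreover have "graph_iso N H"
  proof -
    interpret H: pair_graph H by fact
    show ?thesis using N(2) digraph_iso_swap[OF H.wf_digraph] by (simp add: graph_iso_def)
  qed
  ultimately show ?thesis unfolding graph_iso_def by (rule digraph_iso_trans)
qed

lemma pair_graph_join:
  assumes "pair_graph G" "pair_graph H"
  shows "pair_graph (graph_join G H)"
proof -
  interpret G: pair_graph G by fact
  interpret H: pair_graph H by fact
  have wf: "u \<in> pverts (graph_join G H) \<and> v \<in> pverts (graph_join G H) \<and> u \<noteq> v \<and>
      (v, u) \<in> parcs (graph_join G H)" if "(u, v) \<in> parcs (graph_join G H)" for u v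
  proof -
    from that consider
        x y where "u = Inl x" "v = Inl y" "(x, y) \<in> parcs G"
      | x y where "u = Inr x" "v = Inr y" "(x, y) \<in> parcs H"
      | x y where "u = Inl x" "v = Inr y" "x \<in> pverts G" "y \<in> pverts H"
      | x y where "u = Inr x" "v = Inl y" "x \<in> pverts H" "y \<in> pverts G"
      unfolding graph_join_def by auto
    then show ?thesis
    proof cases
      case 1
      then have "x \<in> pverts G" "y \<in> pverts G" "x \<noteq> y" "(y, x) \<in> parcs G"
        using G.wellformed' G.no_loops' G.arcs_symmetric by blast+
      with 1 show ?thesis by (force simp: graph_join_def)
    next
      case 2
      then have "x \<in> pverts H" "y \<in> pverts H" "x \<noteq> y" "(y, x) \<in> parcs H"
        using H.wellformed' H.no_loops' H.arcs_symmetric by blast+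
      with 2 show ?thesis by (force simp: graph_join_def)
    qed (auto simp: graph_join_def)
  qed
  have fin: "finite (pverts (graph_join G H))" "finite (parcs (graph_join G H))"
    by (simp_all add: graph_join_def)
  show ?thesis
  proof unfold_locales
    show "symmetric (with_proj (graph_join G H))"
      using wf by (auto simp: symmetric_def intro!: symI)
  next
    fix a assume a: "a \<in> parcs (graph_join G H)"
    then have "(fst a, snd a) \<in> parcs (graph_join G H)" by simp
    from wf[OF this] show "fst a \<in> pverts (graph_join G H)" "snd a \<in> pverts (graph_join G H)"
      "fst a \<noteq> snd a" by blast+
  qed (fact fin)+
qed

lemma Theta_3_2_5_bicyclic: "bicyclic Theta_3_2_5"
proof -
  have A: "parcs Theta_3_2_5 =
      {(0,1), (1,2), (2,0), (1,0), (2,1), (0,2), (1,3), (3,4), (4,5), (5,0), (3,1), (4,3), (5,4), (0,5)}"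
    by (auto simp: Theta_3_2_5_def cycle_arcs_def)
  have V: "pverts Theta_3_2_5 = {0, 1, 2, 3, 4, 5}" by (simp add: Theta_3_2_5_def)
  have gr: "pair_graph Theta_3_2_5"
    by unfold_locales (auto simp: A V symmetric_def intro!: symI)
  interpret pair_graph Theta_3_2_5 by (rule gr)
  have E: "edge_set Theta_3_2_5 = {{0,1}, {1,2}, {0,2}, {1,3}, {3,4}, {4,5}, {0,5}}"
    by (auto simp: edge_set_def A insert_commute)
  have c: "card (edge_set Theta_3_2_5) = 7"
    unfolding E by (simp add: doubleton_eq_iff)
  have r: "0 \<rightarrow>\<^sup>*\<^bsub>with_proj Theta_3_2_5\<^esub> v" if "v \<in> pverts Theta_3_2_5" for v
  proof -
    have s: "u \<rightarrow>\<^sup>*\<^bsub>with_proj Theta_3_2_5\<^esub> w" if "(u, w) \<in> parcs Theta_3_2_5" for u w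
      using that by (intro reachable_adjI) simp
    have "0 \<rightarrow>\<^sup>*\<^bsub>with_proj Theta_3_2_5\<^esub> 1" "0 \<rightarrow>\<^sup>*\<^bsub>with_proj Theta_3_2_5\<^esub> 2"
      "0 \<rightarrow>\<^sup>*\<^bsub>with_proj Theta_3_2_5\<^esub> 5" "1 \<rightarrow>\<^sup>*\<^bsub>with_proj Theta_3_2_5\<^esub> 3"
      "3 \<rightarrow>\<^sup>*\<^bsub>with_proj Theta_3_2_5\<^esub> 4" "0 \<rightarrow>\<^sup>*\<^bsub>with_proj Theta_3_2_5\<^esub> 0"
      by (auto intro!: s simp: A V)
    then show ?thesis using that by (auto simp: V intro: reachable_trans)
  qed
  have r': "v \<rightarrow>\<^sup>*\<^bsub>with_proj Theta_3_2_5\<^esub> 0" if "v \<in> pverts Theta_3_2_5" for v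
    using r[OF that] by (rule symmetric_reachable[OF pair_sym_arcs])
  have "Digraph_Component.connected (with_proj Theta_3_2_5)"
    unfolding Digraph_Component.connected_def
  proof (rule strongly_connectedI)
    fix u v
    assume "u \<in> verts (with_proj (mk_symmetric (with_proj Theta_3_2_5)))"
      and "v \<in> verts (with_proj (mk_symmetric (with_proj Theta_3_2_5)))"
    then have "u \<rightarrow>\<^sup>*\<^bsub>with_proj Theta_3_2_5\<^esub> v" by (intro reachable_trans[OF r' r]) simp_all
    then show "u \<rightarrow>\<^sup>*\<^bsub>with_proj (mk_symmetric (with_proj Theta_3_2_5))\<^esub> v"
      by (rule reachable_mk_symmetricI)
  qed (simp add: V)
  then show ?thesis using gr c by (simp add: bicyclic_def V)
qed

end

theory Submission
  imports Defs "Jordan_Normal_Form.Schur_Decomposition"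
begin

text \<open>The Laplacian spectra of a graph and of its complement determine each other, and the complement of
  \<open>B \<times> K\<^sub>m\<close> is the complement of \<open>B\<close> together with \<open>m\<close> isolated vertices. By induction on \<open>m\<close> it is enough to
  show that the complement \<open>Q\<close> of a graph cospectral with \<open>B \<times> K\<^sub>m\<close> has an isolated vertex. Suppose not.
  The multiplicity of the eigenvalue 0 gives at least \<open>m + 1\<close> components, so that the number of edges and
  the sum of the squared degrees leave only \<open>m = 1\<close> and \<open>Q = Q' \<union> K\<^sub>2\<close>, where the complement \<open>F\<close> of \<open>Q'\<close>
  has three edges. Hence the spectrum of \<open>B\<close> consists of \<open>0\<close>, \<open>n - 2\<close> and the numbers \<open>1 + \<nu>\<close>, for \<open>\<nu>\<close> in
  the spectrum of \<open>F\<close> (with one eigenvalue 0 left out). Its first three power sums determine the first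
  three moments of the degrees of \<open>B\<close>. Since the largest eigenvalue exceeds the largest degree by more than
  one, and since \<open>n\<close> divides the product of the nonzero eigenvalues, only \<open>n \<le> 8\<close> is possible, and in the
  end only \<open>\<Theta>\<^sub>3\<^sub>,\<^sub>2\<^sub>,\<^sub>5\<close> remains.\<close>


subsection \<open>Unitary diagonalization of Hermitian matrices\<close>

text \<open>The exclusion of Theta is forced. The complement of \<open>Q\<close> is the join of
  \<open>F\<close> with two nonadjacent vertices. If \<open>F\<close> is a path on four vertices
  plus an isolated one, this join and the join of Theta with one vertex both have the eigenvalues 0,
  2, 4 - sqrt 2, 4, 5, 4 + sqrt 2, 7, although no vertex of the former is adjacent to all others. So
  every estimate has to stop short of this one case, where the one for the squared degrees is sharp.

  Components are counted only through the multiplicity of 0. The graph \<open>F\<close> is not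
  classified: it enters through the number \<open>k\<close> of pairs of adjacent edges and a
  correction \<open>e\<close>, which is 1 for a star, -1 for a triangle and 0 otherwise. The three
  eigenvalues of \<open>B\<close> that depend on \<open>F\<close> are then \<open>3 + y\<close> with
  \<open>y ^ 3 = k * y + 2 * e\<close>. Degree sequences are controlled by summing over the vertices
  a polynomial of degree at most three that has one sign, or vanishes, at the admissible degrees;
  the known moments evaluate the sum up to the number of triangles.\<close>

definition adjm :: "complex mat \<Rightarrow> complex mat" where
  "adjm A = mat (dim_col A) (dim_row A) (\<lambda>(i, j). cnj (A $$ (j, i)))"

lemma adjm_carrier [simp]: "A \<in> carrier_mat n m \<Longrightarrow> adjm A \<in> carrier_mat m n"
  by (auto simp: adjm_def)

lemma adjm_dim [simp]: "dim_row (adjm A) = dim_col A" "dim_col (adjm A) = dim_row A"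
  by (auto simp: adjm_def)

lemma adjm_adjm [simp]: "adjm (adjm A) = A"
  by (rule eq_matI) (auto simp: adjm_def)

lemma adjm_mult:
  assumes "A \<in> carrier_mat n m" "B \<in> carrier_mat m k"
  shows "adjm (A * B) = adjm B * adjm A"
  using assms by (intro eq_matI) (auto simp: adjm_def scalar_prod_def mult.commute)

text \<open>Gram-Schmidt leaves the first vector of a list unchanged, so completing \<open>v\<close>
  to a basis, orthogonalizing and normalizing puts a multiple of \<open>v\<close> into the first
  column. This is the deflation step of the spectral theorem.\<close>

lemma ex_unitary_first_col:
  assumes v: "v \<in> carrier_vec n" "v \<noteq> 0\<^sub>v n"
  obtains U c where "U \<in> carrier_mat n n" "adjm U * U = 1\<^sub>m n" "c \<noteq> 0" "col U 0 = c \<cdot>\<^sub>v v" "0 < n"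
proof -
  interpret cof_vec_space n "TYPE(complex)" .
  have n: "n > 0" using v by (cases n) auto
  define ws where "ws = gram_schmidt n (basis_completion v)"
  note bc = basis_completion[OF v]
  have orth: "corthogonal ws" and len: "length ws = n" and car: "set ws \<subseteq> carrier_vec n"
    using gram_schmidt_result[OF bc(2) bc(4) bc(5) ws_def] bc(6) by auto
  have hd: "ws ! 0 = v"
  proof -
    obtain r where r: "basis_completion v = v # r"
      using bc(6,7) n by (cases "basis_completion v") auto
    have "hd ws = v" unfolding ws_def r using v by (intro gram_schmidt_hd)
    then show ?thesis using len n by (metis hd_conv_nth length_0_conv less_nat_zero_code)
  qed
  \<comment> \<open>The squared norms are kept real, so that their square roots are real and fixed
    by conjugation.\<close>
  define q where "q j = (\<Sum>k<n. (cmod (ws ! j $ k))\<^sup>2)" for j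
  have ip: "ws ! j \<bullet>c ws ! i = (\<Sum>k<n. cnj (ws ! i $ k) * ws ! j $ k)" if "i < n" "j < n" for i j
  proof -
    have "dim_vec (ws ! i) = n" using car len that by (metis carrier_vecD nth_mem subsetD)
    then show ?thesis by (simp add: scalar_prod_def lessThan_atLeast0 mult.commute)
  qed
  have qq: "ws ! j \<bullet>c ws ! j = of_real (q j)" if "j < n" for j
    unfolding ip[OF that that] q_def of_real_sum
    by (rule sum.cong) (auto simp: complex_norm_square[symmetric] mult.commute)
  have qpos: "q j > 0" if "j < n" for j
  proof -
    have "ws ! j \<bullet>c ws ! j \<noteq> 0" using corthogonalD[OF orth, of j j] that len by simp
    then have "q j \<noteq> 0" using qq[OF that] by auto
    moreover have "q j \<ge> 0" unfolding q_def by (intro sum_nonneg) auto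
    ultimately show ?thesis by simp
  qed
  define U where "U = mat n n (\<lambda>(i, j). ws ! j $ i / of_real (sqrt (q j)))"
  have U: "U \<in> carrier_mat n n" by (simp add: U_def)
  have UU: "adjm U * U = 1\<^sub>m n"
  proof (rule eq_matI)
    fix i j assume "i < dim_row (1\<^sub>m n :: complex mat)" "j < dim_col (1\<^sub>m n :: complex mat)"
    then have ij: "i < n" "j < n" by auto
    have "(adjm U * U) $$ (i, j) =
        (\<Sum>k<n. cnj (ws ! i $ k) * ws ! j $ k / (of_real (sqrt (q i)) * of_real (sqrt (q j))))"
      using ij by (simp add: adjm_def U_def scalar_prod_def lessThan_atLeast0)
    also have "\<dots> = (ws ! j \<bullet>c ws ! i) / (of_real (sqrt (q i)) * of_real (sqrt (q j)))"
      unfolding ip[OF ij] by (simp add: sum_divide_distrib)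
    also have "\<dots> = (if i = j then 1 else 0)"
    proof (cases "i = j")
      case True
      have "complex_of_real (sqrt (q i)) * of_real (sqrt (q i)) = of_real (q i)"
        using qpos[OF ij(1)] by (simp flip: of_real_mult)
      then show ?thesis using True qq[OF ij(1)] qpos[OF ij(1)] by simp
    next
      case False
      then show ?thesis using corthogonalD[OF orth, of j i] ij len by auto
    qed
    finally show "(adjm U * U) $$ (i, j) = 1\<^sub>m n $$ (i, j)" using ij by simp
  qed (use U in auto)
  have "col U 0 = (1 / of_real (sqrt (q 0))) \<cdot>\<^sub>v v"
    using v n hd by (intro eq_vecI) (auto simp: U_def)
  moreover have "1 / complex_of_real (sqrt (q 0)) \<noteq> 0" using qpos[OF n] by simp
  ultimately show thesis using that U UU n by blast
qed

text \<open>Induction by deflation. If the first column of \<open>U\<close> is an eigenvector, the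
  first column of \<open>adjm U * A * U\<close> is a multiple of the first unit vector; Hermitian
  symmetry clears the first row as well, and a smaller Hermitian block is left for the induction
  hypothesis.\<close>

lemma hermitian_unitary_diag:
  assumes "A \<in> carrier_mat n n" "adjm A = A"
  shows "\<exists>U d. U \<in> carrier_mat n n \<and> adjm U * U = 1\<^sub>m n \<and>
    adjm U * A * U = mat_diag n (\<lambda>i. complex_of_real (d i))"
  using assms
proof (induction n arbitrary: A)
  case 0
  then show ?case
    by (intro exI[of _ "1\<^sub>m 0"] exI[of _ "\<lambda>_. 0"]) (auto intro!: eq_matI simp: mat_diag_def)
next
  case (Suc n)
  note A = Suc.prems
  obtain as where as: "char_poly A = (\<Prod>a\<leftarrow>as. [:- a, 1:])" "length as = Suc n"
    using char_poly_factorized[OF A(1)] by blast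
  then obtain e where "poly (char_poly A) e = 0"
    by (cases as) (auto simp: poly_prod_list)
  then have "eigenvalue A e" using eigenvalue_root_char_poly[OF A(1)] by simp
  then obtain v where v: "v \<in> carrier_vec (Suc n)" "v \<noteq> 0\<^sub>v (Suc n)" "A *\<^sub>v v = e \<cdot>\<^sub>v v"
    using A(1) by (auto simp: eigenvalue_def eigenvector_def)
  obtain U c where U: "U \<in> carrier_mat (Suc n) (Suc n)" "adjm U * U = 1\<^sub>m (Suc n)" "c \<noteq> 0"
      "col U 0 = c \<cdot>\<^sub>v v"
    using ex_unitary_first_col[OF v(1,2)] by metis
  define B where "B = adjm U * A * U"
  have aU: "adjm U \<in> carrier_mat (Suc n) (Suc n)" using U by simp
  have B: "B \<in> carrier_mat (Suc n) (Suc n)" unfolding B_def using mult_carrier_mat[OF mult_carrier_mat[OF aU A(1)] U(1)] .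
  have assoc: "adjm U * A * U = adjm U * (A * U)" using aU A(1) U(1) by (rule assoc_mult_mat)
  have AU: "A * U \<in> carrier_mat (Suc n) (Suc n)" using A(1) U(1) by (rule mult_carrier_mat)
  have hB: "adjm B = B"
  proof -
    have "adjm B = adjm U * adjm (adjm U * A)"
      unfolding B_def by (rule adjm_mult[OF mult_carrier_mat[OF aU A(1)] U(1)])
    also have "adjm (adjm U * A) = A * U"
      using adjm_mult[OF aU A(1)] A(2) by simp
    finally show ?thesis by (simp only: B_def assoc)
  qed
  have B0: "B $$ (i, 0) = (if i = 0 then e else 0)" if i: "i < Suc n" for i
  proof -
    have "col (A * U) 0 = A *\<^sub>v col U 0" by (rule col_mult2[OF A(1) U(1)]) simp
    also have "\<dots> = e \<cdot>\<^sub>v col U 0"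
      unfolding U(4) using v A(1) by (simp add: mult_mat_vec smult_smult_assoc mult.commute)
    finally have c0: "col (A * U) 0 = e \<cdot>\<^sub>v col U 0" .
    have "B $$ (i, 0) = (adjm U * (A * U)) $$ (i, 0)" by (simp only: B_def assoc)
    also have "\<dots> = row (adjm U) i \<bullet> (e \<cdot>\<^sub>v col U 0)"
      using aU AU U(1) i c0 by (subst index_mult_mat) (simp_all add: carrier_matD)
    also have "\<dots> = e * (row (adjm U) i \<bullet> col U 0)"
      using aU U(1) i by (intro scalar_prod_smult_distrib[where n = "Suc n"]) (auto simp del: U(4) intro!: carrier_vecI)
    also have "row (adjm U) i \<bullet> col U 0 = (adjm U * U) $$ (i, 0)"
      using aU U(1) i by (subst index_mult_mat) auto
    also have "\<dots> = (if i = 0 then 1 else 0)" using U i by simp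
    finally show ?thesis by simp
  qed
  have Bh: "B $$ (i, j) = cnj (B $$ (j, i))" if "i < Suc n" "j < Suc n" for i j
    using arg_cong[OF hB, of "\<lambda>M. M $$ (i, j)"] that B by (simp add: adjm_def)
  \<comment> \<open>A diagonal entry of a Hermitian matrix equals its own conjugate; this makes
    every entry of \<open>d\<close> real.\<close>
  have ereal: "e = of_real (Re e)"
    using Bh[of 0 0] B0[of 0] by (simp add: complex_eq_iff)
  define C where "C = mat n n (\<lambda>(i, j). B $$ (Suc i, Suc j))"
  have C: "C \<in> carrier_mat n n" by (simp add: C_def)
  have hC: "adjm C = C"
    by (rule eq_matI) (auto simp: adjm_def C_def Bh[symmetric])
  obtain V d where V: "V \<in> carrier_mat n n" "adjm V * V = 1\<^sub>m n"
      "adjm V * C * V = mat_diag n (\<lambda>i. complex_of_real (d i))"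
    using Suc.IH[OF C hC] by blast
  have aV: "adjm V \<in> carrier_mat n n" using V by simp
  have Bblock: "B = four_block_mat (e \<cdot>\<^sub>m 1\<^sub>m 1) (0\<^sub>m 1 n) (0\<^sub>m n 1) C"
  proof (rule eq_matI)
    fix i j assume "i < dim_row (four_block_mat (e \<cdot>\<^sub>m 1\<^sub>m 1) (0\<^sub>m 1 n) (0\<^sub>m n 1) C)"
      "j < dim_col (four_block_mat (e \<cdot>\<^sub>m 1\<^sub>m 1) (0\<^sub>m 1 n) (0\<^sub>m n 1) C)"
    then have ij: "i < Suc n" "j < Suc n" using C by auto
    then show "B $$ (i, j) = four_block_mat (e \<cdot>\<^sub>m 1\<^sub>m 1) (0\<^sub>m 1 n) (0\<^sub>m n 1) C $$ (i, j)"
      using B0[of i] B0[of j] Bh[of i j] C by (auto simp: C_def)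
  qed (use B C in auto)
  define W where "W = four_block_mat (1\<^sub>m 1) (0\<^sub>m 1 n) (0\<^sub>m n 1) V"
  have W: "W \<in> carrier_mat (Suc n) (Suc n)" using V by (auto simp: W_def)
  have aW: "adjm W = four_block_mat (1\<^sub>m 1) (0\<^sub>m 1 n) (0\<^sub>m n 1) (adjm V)"
    using V by (intro eq_matI) (auto simp: adjm_def W_def)
  have aWc: "adjm W \<in> carrier_mat (Suc n) (Suc n)" using W by simp
  have one_four: "four_block_mat (1\<^sub>m (Suc 0)) (0\<^sub>m (Suc 0) n) (0\<^sub>m n (Suc 0)) (1\<^sub>m n) = (1\<^sub>m (Suc n) :: complex mat)"
    using four_block_one_mat[of 1 n, where ?'a = complex] by simp
  have WW: "adjm W * W = 1\<^sub>m (Suc n)"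
    unfolding aW unfolding W_def using V aV
    by (subst mult_four_block_mat[of _ 1 1 _ n _ n]) (auto simp: one_four)
  have "adjm W * B * W = four_block_mat (e \<cdot>\<^sub>m 1\<^sub>m 1) (0\<^sub>m 1 n) (0\<^sub>m n 1) (adjm V * C * V)"
  proof -
    have "adjm W * B = four_block_mat (e \<cdot>\<^sub>m 1\<^sub>m 1) (0\<^sub>m 1 n) (0\<^sub>m n 1) (adjm V * C)"
      unfolding aW Bblock using V aV C
      by (subst mult_four_block_mat[of _ 1 1 _ n _ n]) auto
    then have "adjm W * B * W = four_block_mat (e \<cdot>\<^sub>m 1\<^sub>m 1) (0\<^sub>m 1 n) (0\<^sub>m n 1) (adjm V * C) * W"
      by (rule arg_cong)
    also have "\<dots> = four_block_mat (e \<cdot>\<^sub>m 1\<^sub>m 1) (0\<^sub>m 1 n) (0\<^sub>m n 1) (adjm V * C * V)"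
      unfolding W_def using V(1) aV C
      by (subst mult_four_block_mat[of _ 1 1 _ n _ n]) auto
    finally show ?thesis .
  qed
  also have "\<dots> = mat_diag (Suc n) (\<lambda>i. complex_of_real (case i of 0 \<Rightarrow> Re e | Suc i \<Rightarrow> d i))"
    unfolding V(3) using ereal
    by (intro eq_matI) (auto simp: mat_diag_def split: nat.split)
  finally have D: "adjm W * B * W = \<dots>" .
  have UW: "adjm (U * W) = adjm W * adjm U" using U(1) W by (rule adjm_mult)
  have "adjm (U * W) * (U * W) = adjm W * (adjm U * U) * W"
    unfolding UW using U(1) W aU aWc
    by (simp add: assoc_mult_mat[of _ "Suc n" "Suc n" _ "Suc n" _ "Suc n"] mult_carrier_mat[of _ "Suc n" "Suc n" _ "Suc n"])
  then have 1: "adjm (U * W) * (U * W) = 1\<^sub>m (Suc n)"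
    unfolding U(2) right_mult_one_mat[OF aWc] WW .
  have "adjm (U * W) * A * (U * W) = adjm W * B * W"
    unfolding UW B_def using U(1) W aU aWc A(1)
    by (simp add: assoc_mult_mat[of _ "Suc n" "Suc n" _ "Suc n" _ "Suc n"] mult_carrier_mat[of _ "Suc n" "Suc n" _ "Suc n"])
  then have "adjm (U * W) * A * (U * W) =
      mat_diag (Suc n) (\<lambda>i. complex_of_real (case i of 0 \<Rightarrow> Re e | Suc i \<Rightarrow> d i))"
    unfolding D .
  with 1 mult_carrier_mat[OF U(1) W] show ?case by blast
qed

text \<open>The equations \<open>adjm U * U = 1\<^sub>m n\<close> and
  \<open>U * adjm U = 1\<^sub>m n\<close> are both recorded, as orthonormality and as completeness:
  traces use the first, values at single indices the second.\<close>

theorem hermitian_eigenbasis: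
  assumes A: "A \<in> carrier_mat n n" "\<And>i j. i < n \<Longrightarrow> j < n \<Longrightarrow> A $$ (i, j) = cnj (A $$ (j, i))"
  obtains u :: "nat \<Rightarrow> nat \<Rightarrow> complex" and d :: "nat \<Rightarrow> real" where
    "char_poly A = (\<Prod>k\<leftarrow>[0..<n]. [:- complex_of_real (d k), 1:])"
    "\<And>k l. k < n \<Longrightarrow> l < n \<Longrightarrow> (\<Sum>i<n. cnj (u k i) * u l i) = (if k = l then 1 else 0)"
    "\<And>i j. i < n \<Longrightarrow> j < n \<Longrightarrow> (\<Sum>k<n. u k i * cnj (u k j)) = (if i = j then 1 else 0)"
    "\<And>i j. i < n \<Longrightarrow> j < n \<Longrightarrow> A $$ (i, j) = (\<Sum>k<n. of_real (d k) * u k i * cnj (u k j))"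
proof -
  have "adjm A = A" using A(1) A(2)[symmetric] by (intro eq_matI) (auto simp: adjm_def)
  then obtain U d where U: "U \<in> carrier_mat n n" "adjm U * U = 1\<^sub>m n"
      and D: "adjm U * A * U = mat_diag n (\<lambda>i. complex_of_real (d i))"
    using hermitian_unitary_diag[OF A(1)] by metis
  have aU: "adjm U \<in> carrier_mat n n" using U by simp
  have UU: "U * adjm U = 1\<^sub>m n" by (rule mat_mult_left_right_inverse[OF aU U(1,2)])
  define M where "M = mat_diag n (\<lambda>i. complex_of_real (d i))"
  have M: "M \<in> carrier_mat n n" by (simp add: M_def)
  have "A = 1\<^sub>m n * A * 1\<^sub>m n" using A by simp
  also have "\<dots> = U * (adjm U * A * U) * adjm U"
    unfolding UU[symmetric] using U(1) aU A(1)
    by (simp add: assoc_mult_mat[of _ n n _ n _ n] mult_carrier_mat[of _ n n _ n])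
  finally have AM: "A = U * M * adjm U" unfolding D M_def .
  have "similar_mat_wit A M U (adjm U)"
    by (rule similar_mat_witI[OF UU U(2) AM A(1) M U(1) aU])
  then have "char_poly A = char_poly M" by (intro char_poly_similar) (auto simp: similar_mat_def)
  also have "\<dots> = (\<Prod>a\<leftarrow>diag_mat M. [:- a, 1:])"
    by (rule char_poly_upper_triangular[OF M]) (auto simp: M_def mat_diag_def)
  also have "diag_mat M = map (\<lambda>k. complex_of_real (d k)) [0..<n]"
    by (auto simp: diag_mat_def M_def mat_diag_def)
  finally have 1: "char_poly A = (\<Prod>k\<leftarrow>[0..<n]. [:- complex_of_real (d k), 1:])"
    by (simp add: comp_def)
  have 2: "(\<Sum>i<n. cnj (U $$ (i, k)) * U $$ (i, l)) = (if k = l then 1 else 0)"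
    if "k < n" "l < n" for k l
    using arg_cong[OF U(2), of "\<lambda>M. M $$ (k, l)"] that U(1)
    by (simp add: adjm_def scalar_prod_def lessThan_atLeast0)
  have 3: "(\<Sum>k<n. U $$ (i, k) * cnj (U $$ (j, k))) = (if i = j then 1 else 0)"
    if "i < n" "j < n" for i j
    using arg_cong[OF UU, of "\<lambda>M. M $$ (i, j)"] that U(1)
    by (simp add: adjm_def scalar_prod_def lessThan_atLeast0)
  have 4: "A $$ (i, j) = (\<Sum>k<n. of_real (d k) * U $$ (i, k) * cnj (U $$ (j, k)))"
    if ij: "i < n" "j < n" for i j
  proof -
    have "(U * M) $$ (i, k) = U $$ (i, k) * of_real (d k)" if "k < n" for k
      unfolding M_def using U ij that by (simp add: mat_diag_mult_right)
    then show ?thesis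
      using ij U(1) M unfolding AM
      by (subst index_mult_mat) (simp_all add: scalar_prod_def adjm_def lessThan_atLeast0 mult_ac del: assoc_mult_mat)
  qed
  show thesis by (rule that[of d "\<lambda>k i. U $$ (i, k)", OF 1 2 3 4])
qed

subsection \<open>The Laplacian spectrum\<close>

text \<open>Eigenvectors become functions on the vertex set, so that matrix products turn into sums
  over vertices, and arguments about traces and quadratic forms can forget the enumeration.\<close>

locale orthonormal_basis =
  fixes V :: "'a set" and n :: nat and u :: "nat \<Rightarrow> 'a \<Rightarrow> complex"
  assumes fin: "finite V"
    and orth: "\<And>k l. k < n \<Longrightarrow> l < n \<Longrightarrow> (\<Sum>v\<in>V. cnj (u k v) * u l v) = (if k = l then 1 else 0)"
    and complete: "\<And>v w. v \<in> V \<Longrightarrow> w \<in> V \<Longrightarrow> (\<Sum>k<n. u k v * cnj (u k w)) = (if v = w then 1 else 0)"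
begin

text \<open>The matrix with eigenvectors \<open>u k\<close> and eigenvalues \<open>a k\<close>;
  varying \<open>a\<close> for fixed \<open>u\<close> gives the functional calculus of the
  Laplacian.\<close>

definition kernel_of :: "(nat \<Rightarrow> real) \<Rightarrow> 'a \<Rightarrow> 'a \<Rightarrow> complex" where
  "kernel_of a v w = (\<Sum>k<n. of_real (a k) * u k v * cnj (u k w))"

text \<open>Orthonormality kills the mixed terms, so multiplying matrices multiplies eigenvalues.
  Together with the trace formula this turns power sums of eigenvalues into traces of
  powers.\<close>

lemma kernel_of_mult:
  "(\<Sum>x\<in>V. kernel_of a v x * kernel_of b x w) = kernel_of (\<lambda>k. a k * b k) v w"
proof -
  have "(\<Sum>x\<in>V. kernel_of a v x * kernel_of b x w) =
      (\<Sum>x\<in>V. \<Sum>k<n. \<Sum>l<n. of_real (a k) * u k v * of_real (b l) * cnj (u l w) * (cnj (u k x) * u l x))"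
    unfolding kernel_of_def sum_product by (intro sum.cong refl) (simp add: mult_ac)
  also have "\<dots> = (\<Sum>k<n. \<Sum>l<n. of_real (a k) * u k v * of_real (b l) * cnj (u l w) *
      (\<Sum>x\<in>V. cnj (u k x) * u l x))"
    by (subst sum.swap, intro sum.cong refl, subst sum.swap) (simp add: sum_distrib_left)
  also have "\<dots> = (\<Sum>k<n. \<Sum>l<n. if k = l then of_real (a k * b k) * u k v * cnj (u k w) else 0)"
    by (intro sum.cong refl) (auto simp: orth)
  also have "\<dots> = kernel_of (\<lambda>k. a k * b k) v w"
    by (simp add: kernel_of_def sum.delta)
  finally show ?thesis .
qed

lemma kernel_of_trace: "(\<Sum>v\<in>V. kernel_of a v v) = of_real (\<Sum>k<n. a k)"
proof -
  have "(\<Sum>v\<in>V. kernel_of a v v) = (\<Sum>k<n. of_real (a k) * (\<Sum>v\<in>V. cnj (u k v) * u k v))"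
    unfolding kernel_of_def by (subst sum.swap) (simp add: sum_distrib_left mult_ac)
  also have "\<dots> = (\<Sum>k<n. of_real (a k))" by (intro sum.cong refl) (simp add: orth)
  finally show ?thesis by simp
qed

lemma kernel_of_one: "v \<in> V \<Longrightarrow> w \<in> V \<Longrightarrow> kernel_of (\<lambda>_. 1) v w = (if v = w then 1 else 0)"
  by (simp add: kernel_of_def complete)

text \<open>The squared moduli on the right are the weights of \<open>f\<close> in the eigenbasis.
  Being nonnegative, they let a bound on the eigenvalues pass to the quadratic form.\<close>

lemma kernel_of_quadratic:
  "(\<Sum>v\<in>V. \<Sum>w\<in>V. of_real (f v) * kernel_of a v w * of_real (f w)) =
    of_real (\<Sum>k<n. a k * (cmod (\<Sum>v\<in>V. of_real (f v) * u k v))\<^sup>2)"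
proof -
  have "(\<Sum>v\<in>V. \<Sum>w\<in>V. of_real (f v) * kernel_of a v w * of_real (f w)) =
      (\<Sum>v\<in>V. \<Sum>w\<in>V. \<Sum>k<n. of_real (a k) * (of_real (f v) * u k v) * (of_real (f w) * cnj (u k w)))"
    unfolding kernel_of_def by (simp add: sum_distrib_left sum_distrib_right mult_ac)
  also have "\<dots> = (\<Sum>v\<in>V. \<Sum>k<n. \<Sum>w\<in>V. of_real (a k) * (of_real (f v) * u k v) * (of_real (f w) * cnj (u k w)))"
    by (intro sum.cong refl) (rule sum.swap)
  also have "\<dots> = (\<Sum>k<n. \<Sum>v\<in>V. \<Sum>w\<in>V. of_real (a k) * (of_real (f v) * u k v) * (of_real (f w) * cnj (u k w)))"
    by (rule sum.swap)
  also have "\<dots> = (\<Sum>k<n. of_real (a k) * ((\<Sum>v\<in>V. of_real (f v) * u k v) * cnj (\<Sum>v\<in>V. of_real (f v) * u k v)))"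
    unfolding cnj_sum complex_cnj_mult sum_product unfolding sum_distrib_left
    by (intro sum.cong refl) (simp add: mult_ac)
  also have "\<dots> = of_real (\<Sum>k<n. a k * (cmod (\<Sum>v\<in>V. of_real (f v) * u k v))\<^sup>2)"
    by (simp only: complex_norm_square[symmetric] of_real_sum of_real_mult)
  finally show ?thesis .
qed

lemma kernel_of_apply: "l < n \<Longrightarrow> (\<Sum>w\<in>V. kernel_of a v w * u l w) = of_real (a l) * u l v"
proof -
  assume l: "l < n"
  have "(\<Sum>w\<in>V. kernel_of a v w * u l w) = (\<Sum>k<n. of_real (a k) * u k v * (\<Sum>w\<in>V. cnj (u k w) * u l w))"
    unfolding kernel_of_def sum_distrib_left sum_distrib_right by (subst sum.swap) (simp add: mult_ac)
  also have "\<dots> = (\<Sum>k<n. if k = l then of_real (a k) * u k v else 0)"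
    by (intro sum.cong refl) (auto simp: orth l)
  finally show ?thesis using l by (simp add: sum.delta)
qed

end

lemma proots_prod_list_linear:
  fixes xs :: "'a :: idom list"
  shows "proots (\<Prod>x\<leftarrow>xs. [:- x, 1:]) = mset xs"
proof (induction xs)
  case (Cons x xs)
  have "(\<Prod>x\<leftarrow>xs. [:- x, 1:]) \<noteq> (0 :: 'a poly)"
    by (auto simp: prod_list_zero_iff)
  then have "proots ([:- x, 1:] * (\<Prod>x\<leftarrow>xs. [:- x, 1:])) = {#x#} + mset xs"
    using Cons by (subst proots_mult) auto
  then show ?case by (simp only: list.map prod_list.Cons mset.simps) simp
qed simp

section \<open>Degrees, entries of the Laplacian and the real spectrum\<close>

definition deg :: "'a pair_pre_digraph \<Rightarrow> 'a \<Rightarrow> nat" where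
  "deg G v = card {w. (v, w) \<in> parcs G}"

definition lap :: "'a pair_pre_digraph \<Rightarrow> 'a \<Rightarrow> 'a \<Rightarrow> real" where
  "lap G v w = (if v = w then real (deg G v) else 0) - (if (v, w) \<in> parcs G then 1 else 0)"

text \<open>Taking real parts loses nothing for graphs, because the Laplacian is Hermitian;
  \<open>laplacian_spectrum_eq_spec\<close> recovers the complex multiset.\<close>

definition spec :: "'a pair_pre_digraph \<Rightarrow> real multiset" where
  "spec G = image_mset Re (laplacian_spectrum G)"

lemma out_degree_eq_deg: "out_degree (with_proj G) v = deg G v"
proof -
  have "out_arcs (with_proj G) v = Pair v ` {w. (v, w) \<in> parcs G}" by (auto simp: out_arcs_def)
  then show ?thesis by (simp add: out_degree_def deg_def card_image inj_on_def)
qed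

lemma pair_graph_symD: "pair_graph G \<Longrightarrow> (v, w) \<in> parcs G \<Longrightarrow> (w, v) \<in> parcs G"
proof -
  assume "pair_graph G" and a: "(v, w) \<in> parcs G"
  then interpret pair_graph G by simp
  show ?thesis using arcs_symmetric a by blast
qed

lemma pair_graph_irrefl: "pair_graph G \<Longrightarrow> (v, v) \<notin> parcs G"
proof
  assume "pair_graph G" and a: "(v, v) \<in> parcs G"
  then interpret pair_graph G by simp
  show False using no_loops' a by blast
qed

lemma pair_graph_wf: 
  assumes "pair_graph G" "(v, w) \<in> parcs G"
  shows "v \<in> pverts G" "w \<in> pverts G" "v \<noteq> w"
proof -
  interpret pair_graph G using assms by simp
  show "v \<in> pverts G" "w \<in> pverts G" "v \<noteq> w" using wellformed' no_loops' assms by blast+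
qed

lemma pair_graph_fin:
  assumes "pair_graph G"
  shows "finite (pverts G)" "finite (parcs G)"
proof -
  interpret pair_graph G using assms by simp
  show "finite (pverts G)" "finite (parcs G)" using pair_finite_verts pair_finite_arcs by simp_all
qed

lemma lap_sym: "pair_graph G \<Longrightarrow> lap G v w = lap G w v"
  using pair_graph_symD[of G] by (auto simp: lap_def)

lemma laplacian_mat_index_lap:
  assumes "distinct vs" "i < length vs" "j < length vs"
  shows "laplacian_mat G vs $$ (i, j) = of_real (lap G (vs ! i) (vs ! j))"
  using assms by (simp add: laplacian_mat_index lap_def out_degree_eq_deg nth_eq_iff_index_eq)

lemma laplacian_eigenbasis:
  assumes G: "pair_graph G"
  obtains u lam where
    "orthonormal_basis (pverts G) (card (pverts G)) u"
    "laplacian_spectrum G = image_mset of_real (mset (map lam [0..<card (pverts G)]))"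
    "spec G = mset (map lam [0..<card (pverts G)])"
    "\<And>v w. v \<in> pverts G \<Longrightarrow> w \<in> pverts G \<Longrightarrow>
       of_real (lap G v w) = orthonormal_basis.kernel_of (card (pverts G)) u lam v w"
proof -
  obtain vs where vs: "vertex_enum G vs" using ex_vertex_enum G by blast
  define n where "n = card (pverts G)"
  have dist: "distinct vs" and len: "length vs = n" and set: "set vs = pverts G"
    using vs by (auto simp: vertex_enum_def n_def distinct_card[symmetric])
  let ?A = "laplacian_mat G vs"
  have A: "?A \<in> carrier_mat n n" using len by (metis laplacian_mat_dim(3))
  have herm: "?A $$ (i, j) = cnj (?A $$ (j, i))" if "i < n" "j < n" for i j
    using that len dist by (simp add: laplacian_mat_index_lap lap_sym[OF G])
  obtain w d where cp: "char_poly ?A = (\<Prod>k\<leftarrow>[0..<n]. [:- complex_of_real (d k), 1:])"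
    and o: "\<And>k l. k < n \<Longrightarrow> l < n \<Longrightarrow> (\<Sum>i<n. cnj (w k i) * w l i) = (if k = l then 1 else 0)"
    and c: "\<And>i j. i < n \<Longrightarrow> j < n \<Longrightarrow> (\<Sum>k<n. w k i * cnj (w k j)) = (if i = j then 1 else 0)"
    and e: "\<And>i j. i < n \<Longrightarrow> j < n \<Longrightarrow> ?A $$ (i, j) = (\<Sum>k<n. of_real (d k) * w k i * cnj (w k j))"
    by (rule hermitian_eigenbasis[OF A], erule (1) herm, rule that)
  have bij: "bij_betw (nth vs) {..<n} (pverts G)"
    using bij_betw_nth[OF dist] len set by blast
  \<comment> \<open>The inverse of the enumeration carries the eigenvectors from indices to
    vertices.\<close>
  define ix where "ix = inv_into {..<n} (nth vs)"
  have bij': "bij_betw ix (pverts G) {..<n}"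
    unfolding ix_def by (rule bij_betw_inv_into[OF bij])
  have ix: "ix v < n" "vs ! ix v = v" if "v \<in> pverts G" for v
    using that bij bij' by (auto simp: ix_def bij_betw_def f_inv_into_f)
  have ixinj: "ix v = ix x \<longleftrightarrow> v = x" if "v \<in> pverts G" "x \<in> pverts G" for v x
    using ix that by metis
  define u where "u k v = w k (ix v)" for k v
  have ob: "orthonormal_basis (pverts G) n u"
  proof
    show "finite (pverts G)" using pair_graph_fin G by blast
    fix k l assume "k < n" "l < n"
    then show "(\<Sum>v\<in>pverts G. cnj (u k v) * u l v) = (if k = l then 1 else 0)"
      using o[of k l] sum.reindex_bij_betw[OF bij', of "\<lambda>i. cnj (w k i) * w l i"] by (simp add: u_def)
  next
    fix v x assume "v \<in> pverts G" "x \<in> pverts G"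
    then show "(\<Sum>k<n. u k v * cnj (u k x)) = (if v = x then 1 else 0)"
      using c[of "ix v" "ix x"] ix ixinj by (simp add: u_def)
  qed
  have s: "laplacian_spectrum G = image_mset of_real (mset (map d [0..<n]))"
    unfolding laplacian_spectrum_eq[OF vs] cp
    using proots_prod_list_linear[of "map (\<lambda>k. complex_of_real (d k)) [0..<n]"]
    by (simp add: comp_def image_mset.compositionality)
  have r: "spec G = mset (map d [0..<n])"
    unfolding spec_def s by (simp add: image_mset.compositionality comp_def)
  have k: "of_real (lap G v x) = orthonormal_basis.kernel_of n u d v x"
    if vx: "v \<in> pverts G" "x \<in> pverts G" for v x
  proof -
    have "of_real (lap G v x) = ?A $$ (ix v, ix x)"
      using ix[OF vx(1)] ix[OF vx(2)] dist len by (simp add: laplacian_mat_index_lap)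
    also have "\<dots> = (\<Sum>k<n. of_real (d k) * w k (ix v) * cnj (w k (ix x)))"
      using ix[OF vx(1)] ix[OF vx(2)] by (simp add: e)
    finally show ?thesis unfolding orthonormal_basis.kernel_of_def[OF ob] u_def .
  qed
  show thesis by (rule that[OF ob[unfolded n_def] s[unfolded n_def] r[unfolded n_def] k[unfolded n_def]])
qed

locale laplacian_basis = orthonormal_basis "pverts G" "card (pverts G)" u
  for G :: "'a pair_pre_digraph" and u +
  fixes lam :: "nat \<Rightarrow> real"
  assumes spectrum_eq: "laplacian_spectrum G = image_mset of_real (mset (map lam [0..<card (pverts G)]))"
    and spec_eq: "spec G = mset (map lam [0..<card (pverts G)])"
    and lap_eq: "\<And>v w. v \<in> pverts G \<Longrightarrow> w \<in> pverts G \<Longrightarrow> of_real (lap G v w) = kernel_of lam v w"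

lemma ex_laplacian_basis: "pair_graph G \<Longrightarrow> \<exists>u lam. laplacian_basis G u lam"
  by (rule laplacian_eigenbasis)
    (auto simp: laplacian_basis_def laplacian_basis_axioms_def orthonormal_basis.kernel_of_def)

lemma laplacian_spectrum_eq_spec:
  assumes G: "pair_graph G"
  shows "laplacian_spectrum G = image_mset of_real (spec G)" "size (spec G) = card (pverts G)"
proof -
  obtain u lam where "laplacian_basis G u lam" using ex_laplacian_basis[OF G] by blast
  then interpret laplacian_basis G u lam .
  show "laplacian_spectrum G = image_mset of_real (spec G)" unfolding spectrum_eq spec_eq ..
  show "size (spec G) = card (pverts G)" unfolding spec_eq by simp
qed

lemma L_cospectral_iff_spec:
  assumes "pair_graph G" "pair_graph H"
  shows "L_cospectral G H \<longleftrightarrow> spec G = spec H"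
proof
  assume "L_cospectral G H" then show "spec G = spec H" by (simp add: L_cospectral_def spec_def)
next
  assume "spec G = spec H" then show "L_cospectral G H"
    by (simp add: L_cospectral_def laplacian_spectrum_eq_spec(1)[OF assms(1)] laplacian_spectrum_eq_spec(1)[OF assms(2)])
qed

lemma sum_mset_spec_pow_aux: "(\<Sum>x\<in>#mset (map lam [0..<n]). f x) = (\<Sum>k<n. f (lam k))"
  by (induction n) (auto simp: add.commute)

text \<open>Each power sum is the trace of a power of the Laplacian, computed once from the
  eigenvalues and once from the entries.\<close>

lemma spec_power_sums:
  assumes G: "pair_graph G"
  shows "(\<Sum>x\<in>#spec G. x) = (\<Sum>v\<in>pverts G. lap G v v)" (is ?A)
    and "(\<Sum>x\<in>#spec G. x ^ 2) = (\<Sum>v\<in>pverts G. \<Sum>w\<in>pverts G. lap G v w * lap G w v)" (is ?B)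
    and "(\<Sum>x\<in>#spec G. x ^ 3) = (\<Sum>v\<in>pverts G. \<Sum>w\<in>pverts G. \<Sum>x\<in>pverts G. lap G v w * lap G w x * lap G x v)" (is ?C)
proof -
  obtain u lam where "laplacian_basis G u lam" using ex_laplacian_basis[OF G] by blast
  then interpret laplacian_basis G u lam .
  note s = spec_eq and k = lap_eq
  have "complex_of_real (\<Sum>v\<in>pverts G. lap G v v) = (\<Sum>v\<in>pverts G. kernel_of lam v v)"
    by (simp add: k)
  then have "complex_of_real (\<Sum>v\<in>pverts G. lap G v v) = of_real (\<Sum>k<card (pverts G). lam k)"
    by (simp only: kernel_of_trace)
  then show ?A unfolding s sum_mset_spec_pow_aux by (simp only: of_real_eq_iff)
  have "complex_of_real (\<Sum>v\<in>pverts G. \<Sum>w\<in>pverts G. lap G v w * lap G w v) =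
      (\<Sum>v\<in>pverts G. \<Sum>w\<in>pverts G. kernel_of lam v w * kernel_of lam w v)"
    by (simp add: k)
  then have "complex_of_real (\<Sum>v\<in>pverts G. \<Sum>w\<in>pverts G. lap G v w * lap G w v) = of_real (\<Sum>k<card (pverts G). lam k * lam k)"
    by (simp only: kernel_of_mult kernel_of_trace)
  then show ?B unfolding s sum_mset_spec_pow_aux by (simp only: of_real_eq_iff power2_eq_square)
  have "complex_of_real (\<Sum>v\<in>pverts G. \<Sum>w\<in>pverts G. \<Sum>x\<in>pverts G. lap G v w * lap G w x * lap G x v) =
      (\<Sum>v\<in>pverts G. \<Sum>w\<in>pverts G. kernel_of lam v w * (\<Sum>x\<in>pverts G. kernel_of lam w x * kernel_of lam x v))"
    by (simp add: k sum_distrib_left mult_ac)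
  then have "complex_of_real (\<Sum>v\<in>pverts G. \<Sum>w\<in>pverts G. \<Sum>x\<in>pverts G. lap G v w * lap G w x * lap G x v) =
      of_real (\<Sum>k<card (pverts G). lam k * (lam k * lam k))"
    by (simp only: kernel_of_mult kernel_of_trace)
  then show ?C unfolding s sum_mset_spec_pow_aux by (simp only: of_real_eq_iff power3_eq_cube mult.assoc)
qed

subsection \<open>Degrees, quadratic form and kernel of the Laplacian\<close>

definition nbr :: "'a pair_pre_digraph \<Rightarrow> 'a \<Rightarrow> 'a set" where
  "nbr G v = {w. (v, w) \<in> parcs G}"

lemma deg_nbr: "deg G v = card (nbr G v)" by (simp add: deg_def nbr_def)

text \<open>Ordered triples, that is, the trace of the cube of the adjacency matrix: every triangle
  is counted six times.\<close>

definition tri :: "'a pair_pre_digraph \<Rightarrow> nat" where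
  "tri G = card {(v, w, x). (v, w) \<in> parcs G \<and> (w, x) \<in> parcs G \<and> (x, v) \<in> parcs G}"

context
  fixes G :: "'a pair_pre_digraph"
  assumes G: "pair_graph G"
begin

lemma nbr_subset: "nbr G v \<subseteq> pverts G"
  using pair_graph_wf[OF G] by (auto simp: nbr_def)

lemma finite_nbr: "finite (nbr G v)"
  using finite_subset[OF nbr_subset] pair_graph_fin[OF G] by blast

lemma sum_arcs: "(\<Sum>(v, w)\<in>parcs G. f v w) = (\<Sum>v\<in>pverts G. \<Sum>w\<in>nbr G v. f v w)"
proof -
  have "parcs G = Sigma (pverts G) (nbr G)"
    using pair_graph_wf[OF G] by (auto simp: nbr_def)
  then show ?thesis
    using pair_graph_fin[OF G] finite_nbr by (simp add: sum.Sigma)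
qed

lemma sum_arcs_swap: "(\<Sum>v\<in>pverts G. \<Sum>w\<in>nbr G v. f v w) = (\<Sum>v\<in>pverts G. \<Sum>w\<in>nbr G v. f w v)"
proof -
  have "(\<Sum>(v, w)\<in>parcs G. f v w) = (\<Sum>(v, w)\<in>parcs G. f w v)"
    by (rule sum.reindex_bij_witness[of _ "\<lambda>(v, w). (w, v)" "\<lambda>(v, w). (w, v)"])
      (auto intro: pair_graph_symD[OF G])
  then show ?thesis by (simp add: sum_arcs)
qed

lemma sum_deg_eq_card: "(\<Sum>v\<in>pverts G. deg G v) = card (parcs G)"
  using sum_arcs[of "\<lambda>_ _. 1::nat"] by (simp add: deg_nbr case_prod_unfold)

lemma lap_apply:
  fixes h :: "'a \<Rightarrow> real"
  assumes "v \<in> pverts G"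
  shows "(\<Sum>w\<in>pverts G. lap G v w * h w) = deg G v * h v - (\<Sum>w\<in>nbr G v. h w)"
proof -
  have "(\<Sum>w\<in>pverts G. lap G v w * h w) =
      (\<Sum>w\<in>pverts G. (if w = v then deg G v * h v else 0) - (if w \<in> nbr G v then h w else 0))"
    by (intro sum.cong) (auto simp: lap_def nbr_def algebra_simps)
  also have "\<dots> = deg G v * h v - (\<Sum>w\<in>pverts G. if w \<in> nbr G v then h w else 0)"
    using assms pair_graph_fin[OF G] by (simp add: sum_subtractf sum.delta)
  also have "(\<Sum>w\<in>pverts G. if w \<in> nbr G v then h w else 0) = (\<Sum>w\<in>nbr G v. h w)"
    using nbr_subset pair_graph_fin[OF G] by (simp add: sum.inter_restrict[symmetric] Int_absorb1)
  finally show ?thesis .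
qed

lemma spec_sum: "(\<Sum>x\<in>#spec G. x) = (\<Sum>v\<in>pverts G. real (deg G v))"
  unfolding spec_power_sums(1)[OF G] using pair_graph_irrefl[OF G] by (simp add: lap_def)

lemma lap_sq_diag:
  assumes v: "v \<in> pverts G"
  shows "(\<Sum>w\<in>pverts G. lap G v w * lap G w v) = real (deg G v) ^ 2 + deg G v"
proof -
  have "(\<Sum>w\<in>nbr G v. lap G w v) = (\<Sum>w\<in>nbr G v. - 1)"
    using pair_graph_wf[OF G] pair_graph_symD[OF G] by (intro sum.cong) (auto simp: lap_def nbr_def)
  then show ?thesis
    unfolding lap_apply[OF v] using pair_graph_irrefl[OF G] by (simp add: deg_nbr lap_def power2_eq_square)
qed

lemma spec_sum_sq:
  "(\<Sum>x\<in>#spec G. x ^ 2) = (\<Sum>v\<in>pverts G. real (deg G v) ^ 2) + (\<Sum>v\<in>pverts G. real (deg G v))"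
  unfolding spec_power_sums(2)[OF G] by (simp add: lap_sq_diag sum.distrib)

lemma tri_eq: "(\<Sum>v\<in>pverts G. \<Sum>w\<in>nbr G v. card (nbr G w \<inter> nbr G v)) = tri G"
proof -
  have "tri G = card (Sigma (pverts G) (\<lambda>v. Sigma (nbr G v) (\<lambda>w. nbr G w \<inter> nbr G v)))"
    unfolding tri_def
    by (rule arg_cong[of _ _ card])
      (use pair_graph_wf[OF G] pair_graph_symD[OF G] in \<open>auto simp: nbr_def\<close>)
  then show ?thesis
    using pair_graph_fin[OF G] finite_nbr by (simp add: card_SigmaI)
qed

text \<open>This is the trace of (D - A)^3. The terms linear in A vanish because there are no loops,
  each of the three terms quadratic in A gives the sum of the squared degrees, and the trace of A^3
  is \<open>tri G\<close>.\<close>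

lemma spec_sum_cube:
  "(\<Sum>x\<in>#spec G. x ^ 3) = (\<Sum>v\<in>pverts G. real (deg G v) ^ 3) + 3 * (\<Sum>v\<in>pverts G. real (deg G v) ^ 2) - tri G"
proof -
  \<comment> \<open>Entries of the squared Laplacian; only those on the diagonal and between
    neighbours occur in the trace of the cube.\<close>
  define M where "M w v = (\<Sum>x\<in>pverts G. lap G w x * lap G x v)" for w v
  have "(\<Sum>x\<in>#spec G. x ^ 3) = (\<Sum>v\<in>pverts G. \<Sum>w\<in>pverts G. lap G v w * M w v)"
    unfolding spec_power_sums(3)[OF G] M_def by (simp add: sum_distrib_left mult_ac)
  also have "\<dots> = (\<Sum>v\<in>pverts G. real (deg G v) * M v v - (\<Sum>w\<in>nbr G v. M w v))"
    by (simp add: lap_apply)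
  also have "\<dots> = (\<Sum>v\<in>pverts G. real (deg G v) ^ 3 + real (deg G v) ^ 2 +
      (\<Sum>w\<in>nbr G v. real (deg G w) + real (deg G v) - card (nbr G w \<inter> nbr G v)))"
  proof (intro sum.cong refl)
    fix v assume v: "v \<in> pverts G"
    have "M w v = card (nbr G w \<inter> nbr G v) - real (deg G w) - real (deg G v)" if w: "w \<in> nbr G v" for w
    proof -
      have wV: "w \<in> pverts G" using w nbr_subset by blast
      have "(\<Sum>x\<in>nbr G w. lap G x v) =
          (\<Sum>x\<in>nbr G w. (if x = v then real (deg G v) else 0) - (if x \<in> nbr G v then 1 else 0))"
        using pair_graph_symD[OF G] by (intro sum.cong) (auto simp: lap_def nbr_def)
      also have "\<dots> = real (deg G v) - card (nbr G w \<inter> nbr G v)"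
        using w finite_nbr[of w] pair_graph_symD[OF G]
        by (simp add: sum_subtractf sum.delta sum.If_cases) (auto simp: nbr_def)
      finally have "(\<Sum>x\<in>nbr G w. lap G x v) = \<dots>" .
      moreover have "lap G w v = - 1"
        using w pair_graph_wf[OF G] pair_graph_symD[OF G] by (auto simp: lap_def nbr_def)
      ultimately show ?thesis unfolding M_def lap_apply[OF wV] by simp
    qed
    then have "(\<Sum>w\<in>nbr G v. M w v) =
        - (\<Sum>w\<in>nbr G v. real (deg G w) + real (deg G v) - card (nbr G w \<inter> nbr G v))"
      unfolding sum_negf[symmetric] by (intro sum.cong) auto
    then show "real (deg G v) * M v v - (\<Sum>w\<in>nbr G v. M w v) = real (deg G v) ^ 3 + real (deg G v) ^ 2 +
      (\<Sum>w\<in>nbr G v. real (deg G w) + real (deg G v) - card (nbr G w \<inter> nbr G v))"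
      unfolding M_def lap_sq_diag[OF v] by (simp add: power2_eq_square power3_eq_cube algebra_simps)
  qed
  also have "\<dots> = (\<Sum>v\<in>pverts G. real (deg G v) ^ 3) + (\<Sum>v\<in>pverts G. real (deg G v) ^ 2) +
      ((\<Sum>v\<in>pverts G. \<Sum>w\<in>nbr G v. real (deg G w)) + (\<Sum>v\<in>pverts G. \<Sum>w\<in>nbr G v. real (deg G v)) -
       real (\<Sum>v\<in>pverts G. \<Sum>w\<in>nbr G v. card (nbr G w \<inter> nbr G v)))"
    by (simp add: sum.distrib sum_subtractf)
  also have "(\<Sum>v\<in>pverts G. \<Sum>w\<in>nbr G v. real (deg G w)) = (\<Sum>v\<in>pverts G. \<Sum>w\<in>nbr G v. real (deg G v))"
    by (rule sum_arcs_swap)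
  also have "\<dots> = (\<Sum>v\<in>pverts G. real (deg G v) ^ 2)"
    by (simp add: deg_nbr power2_eq_square)
  finally show ?thesis unfolding tri_eq by simp
qed

text \<open>The sum over arcs meets every edge in both directions, hence the division by 2.\<close>

lemma lap_quadratic:
  "(\<Sum>v\<in>pverts G. \<Sum>w\<in>pverts G. f v * lap G v w * f w) = (\<Sum>(v, w)\<in>parcs G. (f v - f w)\<^sup>2) / 2"
proof -
  have "(\<Sum>v\<in>pverts G. \<Sum>w\<in>pverts G. f v * lap G v w * f w) =
      (\<Sum>v\<in>pverts G. f v * (deg G v * f v - (\<Sum>w\<in>nbr G v. f w)))"
    by (intro sum.cong refl) (simp add: lap_apply mult.assoc flip: sum_distrib_left)
  also have "\<dots> = (\<Sum>v\<in>pverts G. \<Sum>w\<in>nbr G v. (f v)\<^sup>2 - f v * f w)" (is "_ = ?S")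
    by (simp add: sum_subtractf sum_distrib_left deg_nbr algebra_simps power2_eq_square)
  finally have 1: "(\<Sum>v\<in>pverts G. \<Sum>w\<in>pverts G. f v * lap G v w * f w) = ?S" .
  have "2 * ?S = (\<Sum>v\<in>pverts G. \<Sum>w\<in>nbr G v. (f v)\<^sup>2 - f v * f w) +
      (\<Sum>v\<in>pverts G. \<Sum>w\<in>nbr G v. (f w)\<^sup>2 - f w * f v)"
    using sum_arcs_swap[of "\<lambda>v w. (f v)\<^sup>2 - f v * f w"] by simp
  also have "\<dots> = (\<Sum>v\<in>pverts G. \<Sum>w\<in>nbr G v. (f v - f w)\<^sup>2)"
    unfolding sum.distrib[symmetric] by (intro sum.cong refl) (simp add: power2_eq_square algebra_simps)
  finally show ?thesis using 1 by (simp add: sum_arcs)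
qed

text \<open>Used in contrapositive form: every test function \<open>f\<close> gives a lower bound
  for the largest eigenvalue.\<close>

lemma rayleigh_bound:
  assumes "\<And>x. x \<in># spec G \<Longrightarrow> x \<le> r"
  shows "(\<Sum>(v, w)\<in>parcs G. (f v - f w)\<^sup>2) \<le> 2 * r * (\<Sum>v\<in>pverts G. (f v)\<^sup>2)"
proof -
  obtain u lam where "laplacian_basis G u lam" using ex_laplacian_basis[OF G] by blast
  then interpret laplacian_basis G u lam .
  note s = spec_eq and k = lap_eq
  define q where "q k = (cmod (\<Sum>v\<in>pverts G. of_real (f v) * u k v))\<^sup>2" for k
  have "complex_of_real (\<Sum>v\<in>pverts G. \<Sum>w\<in>pverts G. f v * lap G v w * f w) =
      (\<Sum>v\<in>pverts G. \<Sum>w\<in>pverts G. of_real (f v) * kernel_of lam v w * of_real (f w))"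
    by (simp add: k)
  then have 1: "(\<Sum>v\<in>pverts G. \<Sum>w\<in>pverts G. f v * lap G v w * f w) = (\<Sum>k<card (pverts G). lam k * q k)"
    unfolding kernel_of_quadratic of_real_eq_iff q_def .
  have "complex_of_real (\<Sum>v\<in>pverts G. (f v)\<^sup>2) =
      (\<Sum>v\<in>pverts G. \<Sum>w\<in>pverts G. if w = v then of_real (f v * f v) else 0)"
    using fin by (simp add: sum.delta power2_eq_square)
  also have "\<dots> = (\<Sum>v\<in>pverts G. \<Sum>w\<in>pverts G. of_real (f v) * kernel_of (\<lambda>_. 1) v w * of_real (f w))"
    by (intro sum.cong refl) (simp add: kernel_of_one)
  finally have 2: "(\<Sum>v\<in>pverts G. (f v)\<^sup>2) = (\<Sum>k<card (pverts G). q k)"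
    unfolding kernel_of_quadratic of_real_eq_iff q_def by simp
  have "(\<Sum>k<card (pverts G). lam k * q k) \<le> (\<Sum>k<card (pverts G). r * q k)"
  proof (rule sum_mono)
    fix k assume "k \<in> {..<card (pverts G)}"
    then have "lam k \<le> r" using assms by (auto simp: s)
    then show "lam k * q k \<le> r * q k" by (intro mult_right_mono) (auto simp: q_def)
  qed
  then show ?thesis
    using 1 2 lap_quadratic[of f] by (simp flip: sum_distrib_left)
qed

text \<open>A kernel vector makes the quadratic form a vanishing sum of squares. The form is
  expanded for real functions only, hence the separate treatment of real and imaginary
  parts.\<close>

lemma lap_kernel_const_on_arcs:
  fixes g :: "'a \<Rightarrow> complex"
  assumes "\<And>v. v \<in> pverts G \<Longrightarrow> (\<Sum>w\<in>pverts G. of_real (lap G v w) * g w) = 0"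
    and "(v, w) \<in> parcs G"
  shows "g v = g w"
proof -
  have *: "f v = f w" if f: "\<And>v. v \<in> pverts G \<Longrightarrow> (\<Sum>w\<in>pverts G. lap G v w * f w) = 0" for f
  proof -
    have "(\<Sum>v\<in>pverts G. \<Sum>w\<in>pverts G. f v * lap G v w * f w) =
        (\<Sum>v\<in>pverts G. f v * (\<Sum>w\<in>pverts G. lap G v w * f w))"
      by (simp add: sum_distrib_left mult_ac)
    also have "\<dots> = 0" by (simp add: f)
    finally have "(\<Sum>e\<in>parcs G. (f (fst e) - f (snd e))\<^sup>2) = 0"
      unfolding lap_quadratic by (simp add: case_prod_unfold)
    then have "\<forall>e\<in>parcs G. (f (fst e) - f (snd e))\<^sup>2 = 0"
      using pair_graph_fin[OF G] by (subst (asm) sum_nonneg_eq_0_iff) auto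
    then show ?thesis using assms(2) by force
  qed
  have "Re (g v) = Re (g w)"
    by (rule *[of "\<lambda>v. Re (g v)"]) (use assms(1)[THEN arg_cong[of _ _ Re]] in simp)
  moreover have "Im (g v) = Im (g w)"
    by (rule *[of "\<lambda>v. Im (g v)"]) (use assms(1)[THEN arg_cong[of _ _ Im]] in simp)
  ultimately show ?thesis by (simp add: complex_eq_iff)
qed

end

text \<open>Connectedness as the absence of proper nonempty sets closed under arcs. Level sets and
  closed neighbourhoods can be tested directly, and its failure yields a vertex set to split
  off.\<close>

definition conn :: "'a pair_pre_digraph \<Rightarrow> bool" where
  "conn G \<longleftrightarrow> (\<forall>S. S \<subseteq> pverts G \<longrightarrow> S \<noteq> {} \<longrightarrow> (\<forall>(v, w)\<in>parcs G. v \<in> S \<longrightarrow> w \<in> S) \<longrightarrow> S = pverts G)"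

lemma conn_const:
  assumes G: "pair_graph G" and "conn G" "\<And>v w. (v, w) \<in> parcs G \<Longrightarrow> g v = g w"
    and "v \<in> pverts G" "w \<in> pverts G"
  shows "g v = g w"
proof -
  let ?S = "{x \<in> pverts G. g x = g v}"
  have "\<forall>(x, y)\<in>parcs G. x \<in> ?S \<longrightarrow> y \<in> ?S"
    using assms(3) pair_graph_wf[OF G] by fastforce
  moreover have "?S \<noteq> {}" "?S \<subseteq> pverts G" using assms(4) by auto
  ultimately have "?S = pverts G"
    using assms(2) unfolding conn_def by blast
  then show ?thesis using assms(5) by force
qed

lemma count_mset_map_upt: "count (mset (map f [0..<n])) c = card {k. k < n \<and> f k = c}"
proof (induction n)
  case (Suc n)
  have "{k. k < Suc n \<and> f k = c} = {k. k < n \<and> f k = c} \<union> (if f n = c then {n} else {})"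
    by (auto simp: less_Suc_eq)
  then show ?case using Suc by simp
qed simp

text \<open>Kernel vectors of a connected graph are constant. Two orthonormal ones would be nonzero
  constants with vanishing inner product.\<close>

lemma conn_count_zero:
  assumes G: "pair_graph G" and "conn G"
  shows "count (spec G) 0 \<le> 1"
proof (rule ccontr)
  assume *: "\<not> ?thesis"
  obtain u lam where "laplacian_basis G u lam" using ex_laplacian_basis[OF G] by blast
  then interpret laplacian_basis G u lam .
  note s = spec_eq and k = lap_eq
  have "card {k. k < card (pverts G) \<and> lam k = 0} > 1"
    using * unfolding s count_mset_map_upt by simp
  then obtain i j where ij: "i < card (pverts G)" "lam i = 0" "j < card (pverts G)" "lam j = 0" "i \<noteq> j"
    using card_le_Suc0_iff_eq[of "{k. k < card (pverts G) \<and> lam k = 0}"] by auto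
  have const: "u i v = u i w"
    if i: "i < card (pverts G)" "lam i = 0" and vw: "v \<in> pverts G" "w \<in> pverts G" for i v w
  proof (rule conn_const[OF G assms(2) _ vw])
    fix x y assume xy: "(x, y) \<in> parcs G"
    show "u i x = u i y"
      by (rule lap_kernel_const_on_arcs[OF G _ xy]) (use i in \<open>simp add: k kernel_of_apply\<close>)
  qed
  obtain v where v: "v \<in> pverts G" using ij(1) by (metis card.empty equals0I not_less_zero)
  have *: "(\<Sum>w\<in>pverts G. cnj (u i w) * u j w) = of_nat (card (pverts G)) * (cnj (u i v) * u j v)"
    if "i < card (pverts G)" "lam i = 0" "j < card (pverts G)" "lam j = 0" for i j
  proof -
    have "(\<Sum>w\<in>pverts G. cnj (u i w) * u j w) = (\<Sum>w\<in>pverts G. cnj (u i v) * u j v)"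
      by (intro sum.cong refl) (metis const that v)
    then show ?thesis by simp
  qed
  show False
    using orth[of i j] orth[of i i] orth[of j j] ij *[of i j] *[of i i] *[of j j] by auto
qed

text \<open>Otherwise every eigenvector would be orthogonal to the constant function, which lies in
  the kernel, against completeness.\<close>

lemma zero_in_spec:
  assumes G: "pair_graph G" and "pverts G \<noteq> {}"
  shows "0 \<in># spec G"
proof (rule ccontr)
  assume *: "\<not> ?thesis"
  obtain u lam where "laplacian_basis G u lam" using ex_laplacian_basis[OF G] by blast
  then interpret laplacian_basis G u lam .
  note s = spec_eq and k = lap_eq
  obtain v where v: "v \<in> pverts G" using assms by blast
  have L1: "(\<Sum>w\<in>pverts G. lap G x w) = 0" if "x \<in> pverts G" for x
    using lap_apply[OF G that, of "\<lambda>_. 1"] by (simp add: deg_nbr)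
  have z: "(\<Sum>x\<in>pverts G. u i x) = 0" if i: "i < card (pverts G)" for i
  proof -
    have "(\<Sum>x\<in>pverts G. \<Sum>w\<in>pverts G. of_real (lap G x w) * u i w) = of_real (lam i) * (\<Sum>x\<in>pverts G. u i x)"
      by (simp add: k kernel_of_apply i sum_distrib_left)
    moreover have "(\<Sum>x\<in>pverts G. \<Sum>w\<in>pverts G. of_real (lap G x w) * u i w) =
        (\<Sum>w\<in>pverts G. of_real (\<Sum>x\<in>pverts G. lap G w x) * u i w)"
      by (subst sum.swap) (simp add: sum_distrib_right lap_sym[OF G])
    moreover have "\<dots> = 0" by (simp add: L1 del: of_real_sum)
    moreover have "lam i \<noteq> 0" using * i by (force simp: s)
    ultimately show ?thesis by simp
  qed
  \<comment> \<open>The completeness relation for the fixed vertex \<open>v\<close>, summed over all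
    \<open>w\<close>.\<close>
  have "1 = (\<Sum>w\<in>pverts G. \<Sum>k<card (pverts G). u k w * cnj (u k v))"
    using v fin by (simp add: complete sum.delta)
  also have "\<dots> = (\<Sum>k<card (pverts G). (\<Sum>w\<in>pverts G. u k w) * cnj (u k v))"
    by (subst sum.swap) (simp add: sum_distrib_right)
  also have "\<dots> = 0" by (simp add: z)
  finally show False by simp
qed

section \<open>Rank of the Laplacian and number of edges\<close>

lemma ex_nontrivial_solution:
  fixes a :: "nat \<Rightarrow> nat \<Rightarrow> 'a :: field"
  assumes "m < n"
  obtains c where "\<And>i. i < m \<Longrightarrow> (\<Sum>j<n. a i j * c j) = 0" "\<exists>j<n. c j \<noteq> 0"
proof -
  \<comment> \<open>The system is padded with zero rows to a square matrix; row \<open>m\<close> is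
    one of them, so expansion along it gives determinant 0.\<close>
  define M where "M = mat n n (\<lambda>(i, j). if i < m then a i j else 0)"
  have M: "M \<in> carrier_mat n n" by (simp add: M_def)
  have "det M = (\<Sum>j<n. M $$ (m, j) * cofactor M m j)"
    by (rule laplace_expansion_row[OF M]) (use assms in simp)
  also have "\<dots> = 0" using assms by (simp add: M_def)
  finally obtain v where v: "v \<in> carrier_vec n" "v \<noteq> 0\<^sub>v n" "M *\<^sub>v v = 0\<^sub>v n"
    using det_0_iff_vec_prod_zero[OF M] by auto
  show thesis
  proof (rule that[of "\<lambda>j. v $ j"])
    fix i assume "i < m"
    then show "(\<Sum>j<n. a i j * v $ j) = 0"
      using arg_cong[OF v(3), of "\<lambda>w. w $ i"] assms v(1)
      by (simp add: M_def scalar_prod_def lessThan_atLeast0)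
  next
    show "\<exists>j<n. v $ j \<noteq> 0" using v(1,2) by (metis carrier_vecD eq_vecI index_zero_vec)
  qed
qed

text \<open>The rank is at most the number of edges, \<open>D\<close> containing an orientation of
  each. With more eigenvectors of nonzero eigenvalue than pairs in \<open>D\<close>, a nontrivial
  combination \<open>g\<close> of them would agree at both ends of every edge; it would lie in the
  kernel, and orthonormality would make all its coefficients 0.\<close>

lemma card_nonzero_spec_le:
  assumes G: "pair_graph G" and D: "finite D" "\<And>v w. (v, w) \<in> parcs G \<Longrightarrow> (v, w) \<in> D \<or> (w, v) \<in> D"
  shows "size (filter_mset (\<lambda>x. x \<noteq> 0) (spec G)) \<le> card D"
proof (rule ccontr)
  assume *: "\<not> ?thesis"
  obtain u lam where "laplacian_basis G u lam" using ex_laplacian_basis[OF G] by blast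
  then interpret laplacian_basis G u lam .
  note s = spec_eq and k = lap_eq
  define js where "js = filter (\<lambda>k. lam k \<noteq> 0) [0..<card (pverts G)]"
  have js: "distinct js" "set js = {k. k < card (pverts G) \<and> lam k \<noteq> 0}" by (auto simp: js_def)
  have "size (filter_mset (\<lambda>x. x \<noteq> 0) (spec G)) = length js"
    by (simp only: s js_def mset_filter[symmetric] filter_map size_mset length_map comp_def)
  then have len: "card D < length js" using * by simp
  obtain ds where ds: "distinct ds" "set ds = D" using finite_distinct_list[OF D(1)] by blast
  then have lds: "length ds = card D" by (simp add: distinct_card[symmetric])
  obtain c where c: "\<And>i. i < card D \<Longrightarrow>
      (\<Sum>j<length js. (u (js ! j) (fst (ds ! i)) - u (js ! j) (snd (ds ! i))) * c j) = 0"
    and nz: "\<exists>j<length js. c j \<noteq> 0"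
    by (rule ex_nontrivial_solution[OF len]) (rule that)
  define g where "g v = (\<Sum>j<length js. u (js ! j) v * c j)" for v
  have gD: "g v = g w" if vw: "(v, w) \<in> D" for v w
  proof -
    obtain i where i: "i < card D" "ds ! i = (v, w)" using vw ds lds by (metis in_set_conv_nth)
    have "(\<Sum>j<length js. (u (js ! j) v - u (js ! j) w) * c j) = 0" using c[OF i(1)] i(2) by simp
    then show ?thesis by (simp add: g_def left_diff_distrib sum_subtractf)
  qed
  have gE: "g v = g w" if "(v, w) \<in> parcs G" for v w
    using D(2)[OF that] gD by metis
  have jlt: "js ! j < card (pverts G)" "lam (js ! j) \<noteq> 0" if "j < length js" for j
    using nth_mem[OF that] js(2) by auto
  have Lg: "(\<Sum>j<length js. of_real (lam (js ! j)) * u (js ! j) v * c j) = 0" if v: "v \<in> pverts G" for v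
  proof -
    have "(\<Sum>w\<in>pverts G. of_real (lap G v w) * g w) = (\<Sum>w\<in>pverts G. of_real (lap G v w) * g v)"
      using gE by (intro sum.cong refl) (auto simp: lap_def)
    also have "\<dots> = of_real (\<Sum>w\<in>pverts G. lap G v w) * g v" by (simp add: sum_distrib_right)
    also have "\<dots> = 0" using lap_apply[OF G v, of "\<lambda>_. 1"] by (simp add: deg_nbr del: of_real_sum)
    finally have "0 = (\<Sum>w\<in>pverts G. kernel_of lam v w * g w)" using v by (simp add: k)
    also have "\<dots> = (\<Sum>j<length js. (\<Sum>w\<in>pverts G. kernel_of lam v w * u (js ! j) w) * c j)"
      unfolding g_def sum_distrib_left sum_distrib_right by (subst sum.swap) (simp add: mult_ac)
    also have "\<dots> = (\<Sum>j<length js. of_real (lam (js ! j)) * u (js ! j) v * c j)"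
      by (intro sum.cong refl) (simp add: kernel_of_apply jlt)
    finally show ?thesis by simp
  qed
  have "c l = 0" if l: "l < length js" for l
  proof -
    have "0 = (\<Sum>v\<in>pverts G. cnj (u (js ! l) v) * (\<Sum>j<length js. of_real (lam (js ! j)) * u (js ! j) v * c j))"
      by (simp add: Lg)
    also have "\<dots> = (\<Sum>j<length js. of_real (lam (js ! j)) * c j * (\<Sum>v\<in>pverts G. cnj (u (js ! l) v) * u (js ! j) v))"
      unfolding sum_distrib_left by (subst sum.swap) (simp add: mult_ac)
    also have "\<dots> = (\<Sum>j<length js. if j = l then of_real (lam (js ! j)) * c j else 0)"
      by (intro sum.cong refl) (use l js(1) jlt in \<open>auto simp: orth nth_eq_iff_index_eq\<close>)
    also have "\<dots> = of_real (lam (js ! l)) * c l" using l by (simp add: sum.delta)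
    finally show ?thesis using jlt(2)[OF l] by simp
  qed
  then show False using nz by blast
qed

subsection \<open>Connected graphs, complements and disjoint unions\<close>

lemma det_in_Ints:
  fixes A :: "'a :: comm_ring_1 mat"
  assumes A: "A \<in> carrier_mat n n" "\<And>i j. i < n \<Longrightarrow> j < n \<Longrightarrow> A $$ (i, j) \<in> \<int>"
  shows "det A \<in> \<int>"
  unfolding det_def'[OF A(1)]
proof (intro Ints_sum Ints_mult Ints_prod)
  fix p assume "p \<in> {p. p permutes {0..<n}}"
  then have p: "p permutes {0..<n}" by simp
  show "signof p \<in> (\<int> :: 'a set)" by (simp add: sign_def)
  fix i assume "i \<in> {0..<n}"
  then show "A $$ (i, p i) \<in> \<int>" using A(2)[of i "p i"] permutes_in_image[OF p, of i] by simp
qed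

lemma poly_char_poly_0:
  assumes A: "A \<in> carrier_mat n n"
  shows "poly (char_poly A) (0 :: 'a :: field) = (- 1) ^ n * det A"
proof -
  have "- char_matrix A 0 = (- 1) \<cdot>\<^sub>m A" using A by (intro eq_matI) (auto simp: char_matrix_def)
  then show ?thesis using det_smult[of "-1 :: 'a" A] A by (simp add: char_poly_matrix[OF A])
qed

text \<open>For a characteristic polynomial with root 0 this isolates the product of the other
  eigenvalues, which the derivative also expresses through principal minors.\<close>

lemma pderiv_prod_linear_0:
  fixes R :: "'a :: idom multiset"
  shows "poly (pderiv (\<Prod>x\<in>#add_mset 0 R. [:- x, 1:])) 0 = (- 1) ^ size R * prod_mset R"
proof -
  have "poly (\<Prod>x\<in>#R. [:- x, 1:]) 0 = (- 1) ^ size R * prod_mset R"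
    by (induction R) (auto simp: algebra_simps)
  then show ?thesis by (simp add: pderiv_mult pderiv_pCons)
qed

lemma prod_list_map_eq_prod_mset: "prod_list (map f xs) = prod_mset (image_mset f (mset xs))"
  by (induction xs) auto

lemma char_poly_eq_prod_spectrum:
  assumes "vertex_enum G vs"
  shows "char_poly (laplacian_mat G vs) = (\<Prod>x\<in>#laplacian_spectrum G. [:- x, 1:])"
proof -
  obtain as where as: "char_poly (laplacian_mat G vs) = (\<Prod>a\<leftarrow>as. [:- a, 1:])"
    using char_poly_factorized[OF laplacian_mat_dim(3)] by blast
  then have "laplacian_spectrum G = mset as"
    by (simp add: laplacian_spectrum_eq[OF assms] proots_prod_list_linear)
  then show ?thesis by (simp only: as prod_list_map_eq_prod_mset)
qed

text \<open>The adjugate of the Laplacian matrix of a connected graph is a constant integer matrix,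
  since its rows and columns lie in the kernel; its trace is the product of the nonzero
  eigenvalues. (Its constant entry is the number of spanning trees.)\<close>

lemma conn_prod_spec_dvd:
  assumes G: "pair_graph G" and conn: "conn G" and ne: "pverts G \<noteq> {}"
  shows "\<exists>c :: int. prod_mset (spec G - {#0#}) = real (card (pverts G)) * of_int c"
proof -
  obtain vs where vs: "vertex_enum G vs" using ex_vertex_enum G by blast
  define n where "n = card (pverts G)"
  have dist: "distinct vs" and len: "length vs = n" and set: "set vs = pverts G"
    using vs by (auto simp: vertex_enum_def n_def distinct_card[symmetric])
  have n: "n > 0" using ne pair_graph_fin[OF G] by (simp add: n_def card_gt_0_iff)
  define A where "A = laplacian_mat G vs"
  have A: "A \<in> carrier_mat n n" unfolding A_def using len by (metis laplacian_mat_dim(3))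
  have Aij: "A $$ (i, j) = of_real (lap G (vs ! i) (vs ! j))" if "i < n" "j < n" for i j
    unfolding A_def using that dist len by (simp add: laplacian_mat_index_lap)
  have reix: "(\<Sum>i<n. f (vs ! i)) = (\<Sum>v\<in>pverts G. f v)" for f :: "'a \<Rightarrow> complex"
    using sum.reindex_bij_betw[OF bij_betw_nth[OF dist refl refl], of f] len set by simp
  have zero: "0 \<in># spec G" by (rule zero_in_spec[OF G ne])
  define R where "R = spec G - {#0#}"
  have sR: "spec G = add_mset 0 R" using zero by (simp add: R_def)
  have szR: "size R = n - 1" using laplacian_spectrum_eq_spec(2)[OF G] by (simp add: sR n_def)
  have cp: "char_poly A = (\<Prod>x\<in>#add_mset 0 (image_mset complex_of_real R). [:- x, 1:])"
    unfolding A_def char_poly_eq_prod_spectrum[OF vs] laplacian_spectrum_eq_spec(1)[OF G] sR by simp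
  have "poly (char_poly A) 0 = 0" unfolding cp by simp
  then have detA: "det A = 0" using poly_char_poly_0[OF A] by simp
  have "poly (pderiv (char_poly A)) 0 = (- 1) ^ (n - 1) * prod_mset (image_mset complex_of_real R)"
    unfolding cp pderiv_prod_linear_0 by (simp add: szR)
  \<comment> \<open>The same number by Jacobi's formula: the derivative of a characteristic
    polynomial is the sum of the characteristic polynomials of the principal submatrices.\<close>
  moreover have "poly (pderiv (char_poly A)) 0 = (\<Sum>i<n. (- 1) ^ (n - 1) * det (mat_delete A i i))"
    unfolding pderiv_char_poly[OF A] poly_sum
    by (intro sum.cong refl poly_char_poly_0 mat_delete_carrier[OF A])
  ultimately have "(- 1) ^ (n - 1) * prod_mset (image_mset complex_of_real R) =
      (- 1) ^ (n - 1) * (\<Sum>i<n. det (mat_delete A i i))"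
    unfolding sum_distrib_left by simp
  then have P: "prod_mset (image_mset complex_of_real R) = (\<Sum>i<n. det (mat_delete A i i))" by simp
  define B where "B = adj_mat A"
  have B: "B \<in> carrier_mat n n" and AB: "A * B = 0\<^sub>m n n" and BA: "B * A = 0\<^sub>m n n"
    using adj_mat[OF A] detA by (auto simp: B_def)
  have Bii: "B $$ (i, i) = det (mat_delete A i i)" if "i < n" for i
    using that A by (simp add: B_def adj_mat_def cofactor_def)
  have ker: "h i = h j" if h: "\<And>i. i < n \<Longrightarrow> (\<Sum>k<n. A $$ (i, k) * h k) = 0" and ij: "i < n" "j < n" for h i j
  proof -
    have bij: "bij_betw (nth vs) {..<n} (pverts G)" using bij_betw_nth[OF dist] len set by blast
    define g where "g v = h (inv_into {..<n} (nth vs) v)" for v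
    have gn: "g (vs ! k) = h k" if "k < n" for k
      using that bij by (simp add: g_def bij_betw_def inv_into_f_f)
    have "(\<Sum>w\<in>pverts G. of_real (lap G v w) * g w) = 0" if "v \<in> pverts G" for v
    proof -
      obtain i where i: "i < n" "v = vs ! i" using \<open>v \<in> pverts G\<close> set len by (metis in_set_conv_nth)
      have "(\<Sum>w\<in>pverts G. of_real (lap G v w) * g w) = (\<Sum>k<n. of_real (lap G v (vs ! k)) * g (vs ! k))"
        by (rule reix[symmetric])
      also have "\<dots> = (\<Sum>k<n. A $$ (i, k) * h k)" using i by (intro sum.cong refl) (simp add: gn Aij)
      finally show ?thesis using h i by simp
    qed
    then have "g v = g w" if "(v, w) \<in> parcs G" for v w
      using lap_kernel_const_on_arcs[OF G _ that] by blast
    then have "g (vs ! i) = g (vs ! j)"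
      using conn_const[OF G conn] ij set len by (metis nth_mem)
    then show ?thesis using gn ij by simp
  qed
  have col: "B $$ (i, k) = B $$ (j, k)" if "i < n" "j < n" "k < n" for i j k
  proof (rule ker[of "\<lambda>i. B $$ (i, k)"])
    fix i assume "i < n"
    then show "(\<Sum>l<n. A $$ (i, l) * B $$ (l, k)) = 0"
      using arg_cong[OF AB, of "\<lambda>M. M $$ (i, k)"] A B that by (simp add: scalar_prod_def lessThan_atLeast0)
  qed (use that in auto)
  have row: "B $$ (k, i) = B $$ (k, j)" if "i < n" "j < n" "k < n" for i j k
  proof (rule ker[of "\<lambda>i. B $$ (k, i)"])
    fix i assume i: "i < n"
    have "(\<Sum>l<n. A $$ (i, l) * B $$ (k, l)) = (\<Sum>l<n. B $$ (k, l) * A $$ (l, i))"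
      using i by (intro sum.cong refl) (simp add: Aij lap_sym[OF G])
    then show "(\<Sum>l<n. A $$ (i, l) * B $$ (k, l)) = 0"
      using arg_cong[OF BA, of "\<lambda>M. M $$ (k, i)"] A B that i by (simp add: scalar_prod_def lessThan_atLeast0)
  qed (use that in auto)
  have "det (mat_delete A 0 0) \<in> \<int>"
    by (rule det_in_Ints[OF mat_delete_carrier[OF A]]) (use A in \<open>auto simp: mat_delete_def Aij lap_def\<close>)
  then obtain c where c: "det (mat_delete A 0 0) = of_int c" by (auto elim: Ints_cases)
  have "(\<Sum>i<n. det (mat_delete A i i)) = (\<Sum>i<n. of_int c)"
  proof (intro sum.cong refl)
    fix i assume "i \<in> {..<n}"
    then have "B $$ (i, i) = B $$ (0, 0)" using col[of i 0 i] row[of i 0 0] n by simp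
    then show "det (mat_delete A i i) = of_int c" using Bii c n \<open>i \<in> {..<n}\<close> by simp
  qed
  moreover have "complex_of_real (prod_mset R) = prod_mset (image_mset complex_of_real R)"
    by (induction R) auto
  ultimately have "complex_of_real (prod_mset R) = of_real (real n * of_int c)"
    unfolding P by simp
  then show ?thesis unfolding of_real_eq_iff R_def n_def by (rule exI[of _ c])
qed

section \<open>Complements\<close>

definition complement :: "'a pair_pre_digraph \<Rightarrow> 'a pair_pre_digraph" where
  "complement G = \<lparr>pverts = pverts G,
     parcs = {(v, w). v \<in> pverts G \<and> w \<in> pverts G \<and> v \<noteq> w \<and> (v, w) \<notin> parcs G}\<rparr>"

lemma pverts_complement [simp]: "pverts (complement G) = pverts G" by (simp add: complement_def)

lemma pair_graphI:
  assumes "finite (pverts G)" "\<And>v w. (v, w) \<in> parcs G \<Longrightarrow> v \<in> pverts G \<and> v \<noteq> w \<and> (w, v) \<in> parcs G"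
  shows "pair_graph G"
proof
  have sub: "parcs G \<subseteq> pverts G \<times> pverts G" using assms(2) by auto
  show "finite (pverts G)" by fact
  show "finite (parcs G)" by (rule finite_subset[OF sub]) (use assms in auto)
  show "symmetric (with_proj G)" using assms(2) by (auto simp: symmetric_def intro!: symI)
  fix e assume "e \<in> parcs G"
  then have "(fst e, snd e) \<in> parcs G" by simp
  then show "fst e \<in> pverts G" "snd e \<in> pverts G" "fst e \<noteq> snd e" using assms(2) by blast+
qed

lemma pair_graph_complement: "pair_graph G \<Longrightarrow> pair_graph (complement G)"
  by (rule pair_graphI) (auto simp: complement_def pair_graph_fin dest: pair_graph_symD)

lemma complement_complement: "pair_graph G \<Longrightarrow> complement (complement G) = G"
  by (rule pair_pre_digraph.equality) (auto simp: complement_def dest: pair_graph_wf)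

lemma nbr_complement: "v \<in> pverts G \<Longrightarrow> nbr (complement G) v = pverts G - {v} - nbr G v"
  by (auto simp: nbr_def complement_def)

lemma deg_complement:
  assumes G: "pair_graph G" and v: "v \<in> pverts G"
  shows "deg (complement G) v = card (pverts G) - 1 - deg G v" "deg G v \<le> card (pverts G) - 1"
proof -
  have sub: "nbr G v \<subseteq> pverts G - {v}" using nbr_subset[OF G] pair_graph_irrefl[OF G] by (auto simp: nbr_def)
  have fin: "finite (pverts G - {v})" using pair_graph_fin[OF G] by simp
  show "deg G v \<le> card (pverts G) - 1"
    using card_mono[OF fin sub] v by (simp add: deg_nbr)
  show "deg (complement G) v = card (pverts G) - 1 - deg G v"
    unfolding deg_nbr nbr_complement[OF v] using card_Diff_subset[OF finite_subset[OF sub fin] sub] v by simp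
qed

lemma lap_complement:
  assumes G: "pair_graph G" and v: "v \<in> pverts G" "w \<in> pverts G"
  shows "lap (complement G) v w = (if v = w then real (card (pverts G)) else 0) - 1 - lap G v w"
proof -
  have "card (pverts G) > 0" using v pair_graph_fin[OF G] card_gt_0_iff by blast
  then show ?thesis
    using deg_complement[OF G v(1)] v pair_graph_irrefl[OF G]
    by (auto simp: lap_def complement_def)
qed


lemma multiset_two_values:
  assumes "\<forall>x\<in>#M. x = a \<or> x = b" "a \<noteq> b"
  shows "M = replicate_mset (count M a) a + replicate_mset (count M b) b"
  using assms by (intro multiset_eqI) (auto simp: not_in_iff[symmetric])

text \<open>For an eigenvector, the eigenvalue times each coordinate is the sum of all coordinates.
  Summing shows that the eigenvalue is \<open>n\<close> or that this sum, and with it the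
  eigenvalue, is 0. The trace \<open>n\<close> then leaves exactly one eigenvalue
  \<open>n\<close>.\<close>

lemma ones_mat_spectrum:
  assumes n: "n > 0"
  shows "char_poly (mat n n (\<lambda>_. 1 :: complex)) = (\<Prod>x\<in>#add_mset (of_nat n) (replicate_mset (n - 1) 0). [:- x, 1:])"
proof -
  define J where "J = mat n n (\<lambda>_. 1 :: complex)"
  have J: "J \<in> carrier_mat n n" by (simp add: J_def)
  obtain d w where cp: "char_poly J = (\<Prod>k\<leftarrow>[0..<n]. [:- complex_of_real (d k), 1:])"
    and o: "\<And>k l. k < n \<Longrightarrow> l < n \<Longrightarrow> (\<Sum>i<n. cnj (w k i) * w l i) = (if k = l then 1 else 0)"
    and c: "\<And>i j. i < n \<Longrightarrow> j < n \<Longrightarrow> (\<Sum>k<n. w k i * cnj (w k j)) = (if i = j then 1 else 0)"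
    and e: "\<And>i j. i < n \<Longrightarrow> j < n \<Longrightarrow> J $$ (i, j) = (\<Sum>k<n. of_real (d k) * w k i * cnj (w k j))"
    by (rule hermitian_eigenbasis[OF J], simp add: J_def, rule that)
  interpret orthonormal_basis "{..<n}" n w
    by unfold_locales (simp_all add: o c)
  have one: "kernel_of d i j = 1" if "i < n" "j < n" for i j
    using e[OF that] that by (simp add: J_def kernel_of_def)
  have d: "d l = 0 \<or> d l = real n" if l: "l < n" for l
  proof (rule ccontr)
    assume nd: "\<not> ?thesis"
    have s: "of_real (d l) * w l v = (\<Sum>x<n. w l x)" if "v < n" for v
      using kernel_of_apply[OF l, of d v] that by (simp add: one)
    then have "of_real (d l) * (\<Sum>v<n. w l v) = (\<Sum>v<n. \<Sum>x<n. w l x)"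
      by (simp add: sum_distrib_left)
    then have "complex_of_real (d l - real n) * (\<Sum>v<n. w l v) = 0"
      by (simp add: algebra_simps)
    then have "(\<Sum>v<n. w l v) = 0" using nd unfolding mult_eq_0_iff of_real_eq_0_iff by auto
    then have "w l v = 0" if "v < n" for v using s[OF that] nd by simp
    then show False using o[OF l l] by simp
  qed
  define M where "M = mset (map d [0..<n])"
  have "complex_of_real (\<Sum>k<n. d k) = of_nat n"
    unfolding kernel_of_trace[symmetric] by (simp add: one)
  then have "complex_of_real (\<Sum>k<n. d k) = of_real (real n)" by (simp only: of_real_of_nat_eq)
  then have "(\<Sum>k<n. d k) = real n" unfolding of_real_eq_iff .
  then have sum: "sum_mset M = real n" using sum_mset_spec_pow_aux[of "\<lambda>x. x" d n] by (simp add: M_def)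
  have M: "M = replicate_mset (count M 0) 0 + replicate_mset (count M (real n)) (real n)"
    by (rule multiset_two_values) (use d n in \<open>auto simp: M_def\<close>)
  have "real n = real (count M (real n)) * real n"
    using arg_cong[OF M, of sum_mset] sum by simp
  then have cn: "count M (real n) = 1" using n by simp
  moreover have "size M = n" by (simp add: M_def)
  ultimately have "count M 0 = n - 1" using arg_cong[OF M, of size] by simp
  then have "M = add_mset (real n) (replicate_mset (n - 1) 0)" using M cn by simp
  moreover have "char_poly J = (\<Prod>x\<in>#image_mset complex_of_real M. [:- x, 1:])"
    unfolding cp M_def prod_list_map_eq_prod_mset mset_map image_mset.compositionality
    by (simp add: comp_def)
  ultimately show ?thesis by (simp add: J_def)
qed

lemma prod_linear_inject:
  fixes M N :: "'a :: idom multiset"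
  assumes "(\<Prod>x\<in>#M. [:- x, 1:]) = (\<Prod>x\<in>#N. [:- x, 1:])"
  shows "M = N"
proof -
  have "proots (\<Prod>x\<in>#M. [:- x, 1:]) = M" for M :: "'a multiset"
  proof -
    obtain xs where "M = mset xs" using ex_mset by metis
    then show ?thesis using proots_prod_list_linear[of xs] by (simp only: prod_list_map_eq_prod_mset)
  qed
  from this[of M] this[of N] show ?thesis unfolding assms by simp
qed

lemma poly_prod_mset_linear: 
  fixes M :: "'a :: idom multiset"
  shows "poly (\<Prod>x\<in>#M. [:- x, 1:]) y = (\<Prod>x\<in>#M. y - x)"
  by (induction M) (auto simp: algebra_simps)

text \<open>Instead of a common eigenbasis, one matrix identity: with J the all-ones matrix, L J = 0
  and L' = n - J - L for the complement give (y - L)(y - J) = -y ((n - y) - L'). Determinants turn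
  this into an identity of polynomials, whose roots are compared.\<close>

lemma spec_complement:
  assumes G: "pair_graph G" and ne: "pverts G \<noteq> {}"
  shows "spec (complement G) = add_mset 0 (image_mset (\<lambda>x. real (card (pverts G)) - x) (spec G - {#0#}))"
proof -
  obtain vs where vs: "vertex_enum G vs" using ex_vertex_enum G by blast
  define n where "n = card (pverts G)"
  have dist: "distinct vs" and len: "length vs = n" and set: "set vs = pverts G"
    using vs by (auto simp: vertex_enum_def n_def distinct_card[symmetric])
  have n: "n > 0" using ne pair_graph_fin[OF G] by (simp add: n_def card_gt_0_iff)
  have vsC: "vertex_enum (complement G) vs" using vs by (simp add: vertex_enum_def)
  define A where "A = laplacian_mat G vs"
  define C where "C = laplacian_mat (complement G) vs"
  define J where "J = mat n n (\<lambda>_. 1 :: complex)"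
  have A: "A \<in> carrier_mat n n" and C: "C \<in> carrier_mat n n"
    unfolding A_def C_def using len by (metis laplacian_mat_dim(3))+
  have J: "J \<in> carrier_mat n n" by (simp add: J_def)
  have Aij: "A $$ (i, j) = of_real (lap G (vs ! i) (vs ! j))" if "i < n" "j < n" for i j
    unfolding A_def using that dist len by (simp add: laplacian_mat_index_lap)
  have Cij: "C $$ (i, j) = (if i = j then of_nat n else 0) - 1 - A $$ (i, j)" if "i < n" "j < n" for i j
    unfolding C_def using that dist len set
    using nth_mem[of i vs] nth_mem[of j vs]
    by (simp add: laplacian_mat_index_lap Aij lap_complement[OF G] nth_eq_iff_index_eq n_def)
  have rowsum: "(\<Sum>k<n. A $$ (i, k)) = 0" if i: "i < n" for i
  proof -
    have "(\<Sum>k<n. A $$ (i, k)) = (\<Sum>k<n. complex_of_real (lap G (vs ! i) (vs ! k)))"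
      by (intro sum.cong refl) (simp add: Aij i)
    also have "\<dots> = of_real (\<Sum>w\<in>pverts G. lap G (vs ! i) w)"
      using sum.reindex_bij_betw[OF bij_betw_nth[OF dist refl refl], of "\<lambda>w. complex_of_real (lap G (vs ! i) w)"]
        len set by simp
    also have "(\<Sum>w\<in>pverts G. lap G (vs ! i) w) = 0"
      using lap_apply[OF G, of "vs ! i" "\<lambda>_. 1"] nth_mem[of i vs] i len set by (simp add: deg_nbr)
    finally show ?thesis by simp
  qed
  have key: "poly (char_poly A) y * poly (char_poly J) y = y ^ n * (- 1) ^ n * poly (char_poly C) (of_nat n - y)" for y
  proof -
    define P where "P = - char_matrix A y"
    define Q where "Q = - char_matrix J y"
    define R where "R = - char_matrix C (of_nat n - y)"
    have P: "P \<in> carrier_mat n n" and Q: "Q \<in> carrier_mat n n" and R: "R \<in> carrier_mat n n"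
      using A J C by (auto simp: P_def Q_def R_def)
    have Pij: "P $$ (i, j) = (if i = j then y else 0) - A $$ (i, j)" if "i < n" "j < n" for i j
      using that A by (simp add: P_def char_matrix_def)
    have Qij: "Q $$ (i, j) = (if i = j then y else 0) - 1" if "i < n" "j < n" for i j
      using that J by (simp add: Q_def char_matrix_def J_def)
    have Rij: "R $$ (i, j) = (if i = j then of_nat n - y else 0) - C $$ (i, j)" if "i < n" "j < n" for i j
      using that C by (simp add: R_def char_matrix_def)
    have PQ: "P * Q = (- y) \<cdot>\<^sub>m R"
    proof (rule eq_matI)
      fix i j assume "i < dim_row ((- y) \<cdot>\<^sub>m R)" "j < dim_col ((- y) \<cdot>\<^sub>m R)"
      then have ij: "i < n" "j < n" using R by auto
      have "(P * Q) $$ (i, j) = (\<Sum>k<n. P $$ (i, k) * Q $$ (k, j))"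
        using ij P Q by (simp add: scalar_prod_def lessThan_atLeast0)
      also have "\<dots> = (\<Sum>k<n. (if k = j then y * P $$ (i, j) else 0) - P $$ (i, k))"
        by (intro sum.cong refl) (auto simp: Qij ij algebra_simps)
      also have "\<dots> = y * P $$ (i, j) - (\<Sum>k<n. P $$ (i, k))"
        using ij by (simp add: sum_subtractf sum.delta)
      also have "(\<Sum>k<n. P $$ (i, k)) = (\<Sum>k<n. (if k = i then y else 0) - A $$ (i, k))"
        by (intro sum.cong refl) (auto simp: Pij ij)
      also have "\<dots> = y" using ij by (simp add: sum_subtractf sum.delta rowsum)
      finally have pq: "(P * Q) $$ (i, j) = y * P $$ (i, j) - y" .
      show "(P * Q) $$ (i, j) = ((- y) \<cdot>\<^sub>m R) $$ (i, j)"
        using ij R unfolding pq by (cases "i = j") (simp_all add: Rij Pij Cij algebra_simps)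
    qed (use P Q R in auto)
    have "det P * det Q = det (P * Q)" using det_mult[OF P Q] by simp
    also have "\<dots> = (- y) ^ n * det R" unfolding PQ using R by simp
    finally show ?thesis
      unfolding char_poly_matrix[OF A] char_poly_matrix[OF C] char_poly_matrix[OF J] P_def Q_def R_def
      by (simp add: power_minus[of y])
  qed
  define cR where "cR = spec G - {#0#}"
  have sR: "spec G = add_mset 0 cR" using zero_in_spec[OF G ne] by (simp add: cR_def)
  let ?c = "complex_of_real"
  let ?S = "image_mset ?c (spec G)" and ?T = "image_mset ?c (spec (complement G))"
  have cpA: "char_poly A = (\<Prod>x\<in>#?S. [:- x, 1:])"
    unfolding A_def char_poly_eq_prod_spectrum[OF vs] laplacian_spectrum_eq_spec(1)[OF G] ..
  have cpC: "char_poly C = (\<Prod>x\<in>#?T. [:- x, 1:])"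
    unfolding C_def char_poly_eq_prod_spectrum[OF vsC]
      laplacian_spectrum_eq_spec(1)[OF pair_graph_complement[OF G]] ..
  have szT: "size ?T = n"
    using laplacian_spectrum_eq_spec(2)[OF pair_graph_complement[OF G]] by (simp add: n_def)
  have neg: "(- 1) ^ size T * (\<Prod>x\<in>#T. of_nat n - y - x) = (\<Prod>x\<in>#image_mset (\<lambda>x. of_nat n - x) T. y - x)"
    for T :: "complex multiset" and y
    by (induction T) (auto simp: algebra_simps)
  have "(\<Prod>x\<in>#?S + add_mset (of_nat n) (replicate_mset (n - 1) 0). [:- x, 1:]) =
      (\<Prod>x\<in>#replicate_mset n 0 + image_mset (\<lambda>x. of_nat n - x) ?T. [:- x, 1:])"
    (is "?p = ?q")
  proof (rule poly_eq_poly_eq_iff[THEN iffD1], rule ext)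
    fix y
    have "poly ?p y = poly (char_poly A) y * poly (char_poly J) y"
      unfolding J_def ones_mat_spectrum[OF n] cpA by (simp add: algebra_simps)
    also have "\<dots> = y ^ n * ((- 1) ^ size ?T * (\<Prod>x\<in>#?T. of_nat n - y - x))"
      unfolding key cpC szT poly_prod_mset_linear by simp
    also have "\<dots> = poly ?q y"
      unfolding neg poly_prod_mset_linear by simp
    finally show "poly ?p y = poly ?q y" .
  qed
  then have "?S + add_mset (of_nat n) (replicate_mset (n - 1) 0) =
      replicate_mset n 0 + image_mset (\<lambda>x. of_nat n - x) ?T"
    by (rule prod_linear_inject)
  then have "image_mset Re (?S + add_mset (of_nat n) (replicate_mset (n - 1) 0)) =
      image_mset Re (replicate_mset n 0 + image_mset (\<lambda>x. of_nat n - x) ?T)"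
    by (rule arg_cong)
  then have "spec G + add_mset (real n) (replicate_mset (n - 1) 0) =
      replicate_mset n 0 + image_mset (\<lambda>x. real n - x) (spec (complement G))"
    by (simp add: image_mset.compositionality comp_def)
  moreover have "replicate_mset n (0::real) = add_mset 0 (replicate_mset (n - 1) 0)"
    using n by (cases n) auto
  ultimately have "add_mset (real n) cR = image_mset (\<lambda>x. real n - x) (spec (complement G))"
    by (simp add: sR)
  \<comment> \<open>Subtraction from \<open>n\<close> is an involution, so applying it once more
    solves for the spectrum of the complement.\<close>
  then have "image_mset (\<lambda>x. real n - x) (add_mset (real n) cR) =
      image_mset (\<lambda>x. real n - x) (image_mset (\<lambda>x. real n - x) (spec (complement G)))"
    by (rule arg_cong)
  then show ?thesis by (simp add: image_mset.compositionality comp_def cR_def n_def)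
qed

section \<open>Disjoint unions\<close>

definition induced :: "'a pair_pre_digraph \<Rightarrow> 'a set \<Rightarrow> 'a pair_pre_digraph" where
  "induced G W = \<lparr>pverts = W, parcs = parcs G \<inter> W \<times> W\<rparr>"

lemma pverts_induced [simp]: "pverts (induced G W) = W" by (simp add: induced_def)

lemma pair_graph_induced: "pair_graph G \<Longrightarrow> W \<subseteq> pverts G \<Longrightarrow> pair_graph (induced G W)"
  by (rule pair_graphI) (auto simp: induced_def intro: finite_subset[OF _ pair_graph_fin(1)]
    dest: pair_graph_symD pair_graph_wf)

text \<open>These sets are the unions of connected components, the empty and the full union
  included.\<close>

definition separated :: "'a pair_pre_digraph \<Rightarrow> 'a set \<Rightarrow> bool" where
  "separated G W \<longleftrightarrow> W \<subseteq> pverts G \<and> (\<forall>(v, w)\<in>parcs G. v \<in> W \<longleftrightarrow> w \<in> W)"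

lemma separated_Diff: "pair_graph G \<Longrightarrow> separated G W \<Longrightarrow> separated G (pverts G - W)"
  by (auto simp: separated_def dest: pair_graph_wf)

lemma nbr_induced:
  "pair_graph G \<Longrightarrow> separated G W \<Longrightarrow> v \<in> W \<Longrightarrow> nbr (induced G W) v = nbr G v"
  by (auto simp: nbr_def induced_def separated_def)

lemma deg_induced:
  "pair_graph G \<Longrightarrow> separated G W \<Longrightarrow> v \<in> W \<Longrightarrow> deg (induced G W) v = deg G v"
  by (simp add: deg_nbr nbr_induced)

lemma lap_induced:
  "pair_graph G \<Longrightarrow> separated G W \<Longrightarrow> v \<in> W \<Longrightarrow> w \<in> W \<Longrightarrow> lap (induced G W) v w = lap G v w"
  by (simp add: lap_def deg_induced) (simp add: induced_def)

text \<open>Listing \<open>W\<close> before the other vertices makes the Laplacian block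
  diagonal.\<close>

lemma spec_separated:
  assumes G: "pair_graph G" and W: "separated G W"
  shows "spec G = spec (induced G W) + spec (induced G (pverts G - W))"
proof -
  let ?U = "pverts G - W"
  have WV: "W \<subseteq> pverts G" using W by (simp add: separated_def)
  have U: "separated G ?U" by (rule separated_Diff[OF G W])
  have GW: "pair_graph (induced G W)" and GU: "pair_graph (induced G ?U)"
    using pair_graph_induced[OF G] WV by auto
  obtain as where as: "vertex_enum (induced G W) as" using ex_vertex_enum GW by blast
  obtain bs where bs: "vertex_enum (induced G ?U) bs" using ex_vertex_enum GU by blast
  have abs: "distinct as" "set as = W" "distinct bs" "set bs = ?U"
    using as bs by (auto simp: vertex_enum_def)
  have vs: "vertex_enum G (as @ bs)" using abs WV by (auto simp: vertex_enum_def)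
  define A where "A = laplacian_mat (induced G W) as"
  define B where "B = laplacian_mat (induced G ?U) bs"
  have A: "A \<in> carrier_mat (length as) (length as)" and B: "B \<in> carrier_mat (length bs) (length bs)"
    by (auto simp: A_def B_def)
  have "laplacian_mat G (as @ bs) =
      four_block_mat A (0\<^sub>m (length as) (length bs)) (0\<^sub>m (length bs) (length as)) B" (is "_ = ?F")
  proof (rule eq_matI)
    fix i j assume "i < dim_row ?F" "j < dim_col ?F"
    then have ij: "i < length as + length bs" "j < length as + length bs" using A B by auto
    have dab: "distinct (as @ bs)" using abs by auto
    have L: "laplacian_mat G (as @ bs) $$ (i, j) = of_real (lap G ((as @ bs) ! i) ((as @ bs) ! j))"
      using ij dab by (intro laplacian_mat_index_lap) auto
    have na: "as ! k \<in> W" if "k < length as" for k using nth_mem[OF that] abs by simp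
    have nb: "bs ! k \<in> ?U" if "k < length bs" for k using nth_mem[OF that] abs by simp
    have z: "lap G v w = 0" "lap G w v = 0" if "v \<in> W" "w \<in> ?U" for v w
      using that W by (auto simp: lap_def separated_def)
    have iW: "(as @ bs) ! k = as ! k" "as ! k \<in> W" if "k < length as" for k
      using that na by (simp_all add: nth_append)
    have iU: "(as @ bs) ! k = bs ! (k - length as)" "bs ! (k - length as) \<in> ?U" "k - length as < length bs"
      if "\<not> k < length as" "k < length as + length bs" for k
      using that nb[of "k - length as"] by (simp_all add: nth_append)
    have F: "?F $$ (i, j) = (if i < length as then if j < length as then A $$ (i, j) else 0
        else if j < length as then 0 else B $$ (i - length as, j - length as))"
      using ij A B by auto
    have AA: "A $$ (i, j) = of_real (lap G (as ! i) (as ! j))" if "i < length as" "j < length as"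
      unfolding A_def using that abs(1) by (simp add: laplacian_mat_index_lap lap_induced[OF G W] iW)
    have BB: "B $$ (i - length as, j - length as) = of_real (lap G (bs ! (i - length as)) (bs ! (j - length as)))"
      if "\<not> i < length as" "\<not> j < length as"
      unfolding B_def using that ij abs(3) iU[of i] iU[of j]
      by (simp add: laplacian_mat_index_lap lap_induced[OF G U])
    show "laplacian_mat G (as @ bs) $$ (i, j) = ?F $$ (i, j)"
      unfolding L F using ij iW[of i] iW[of j] iU[of i] iU[of j]
      by (cases "i < length as"; cases "j < length as") (simp_all add: AA BB z)
  qed (use A B in auto)
  then have "char_poly (laplacian_mat G (as @ bs)) = char_poly A * char_poly B"
    using char_poly_factorized[OF A] char_poly_factorized[OF B]
    by (intro char_poly_0_block[OF _ _ _ A _ B]) (blast, blast, blast, rule zero_carrier_mat)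
  then have "(\<Prod>x\<in>#laplacian_spectrum G. [:- x, 1:]) =
      (\<Prod>x\<in>#laplacian_spectrum (induced G W) + laplacian_spectrum (induced G ?U). [:- x, 1:])"
    unfolding A_def B_def char_poly_eq_prod_spectrum[OF vs] char_poly_eq_prod_spectrum[OF as]
      char_poly_eq_prod_spectrum[OF bs] by simp
  then have "laplacian_spectrum G = laplacian_spectrum (induced G W) + laplacian_spectrum (induced G ?U)"
    by (rule prod_linear_inject)
  then show ?thesis by (simp add: spec_def)
qed

subsection \<open>Bounds from the spectrum\<close>

lemma not_conn_separated:
  assumes G: "pair_graph G" and "\<not> conn G"
  obtains W where "separated G W" "W \<noteq> {}" "W \<noteq> pverts G" "W \<subseteq> pverts G"
proof -
  obtain W where W: "W \<subseteq> pverts G" "W \<noteq> {}" "\<forall>(v, w)\<in>parcs G. v \<in> W \<longrightarrow> w \<in> W" "W \<noteq> pverts G"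
    using assms(2) unfolding conn_def by blast
  have "separated G W"
    using W(1,3) pair_graph_symD[OF G] unfolding separated_def by blast
  then show thesis using that W by blast
qed

text \<open>More than \<open>k\<close> zero eigenvalues split the graph into more than
  \<open>k\<close> pieces with at least two vertices each. By convexity the sums are largest for
  \<open>k\<close> copies of K2 and one complete graph on the other \<open>N\<close> vertices, and
  the bounds are the values for that graph.\<close>

lemma no_isolated_bounds:
  fixes G :: "'a pair_pre_digraph"
  assumes "pair_graph G" "\<And>v. v \<in> pverts G \<Longrightarrow> deg G v \<ge> 1" "pverts G \<noteq> {}" "k < count (spec G) 0"
  defines "N \<equiv> int (card (pverts G)) - 2 * int k"
  shows "N \<ge> 2 \<and> (\<Sum>v\<in>pverts G. int (deg G v)) \<le> N * (N - 1) + 2 * k \<and>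
    (\<Sum>v\<in>pverts G. int (deg G v) ^ 2) \<le> N * (N - 1) ^ 2 + 2 * k"
  using assms(1-4) unfolding N_def
proof (induction "card (pverts G)" arbitrary: G k rule: less_induct)
  case less
  note G = less.prems(1)
  have fin: "finite (pverts G)" using pair_graph_fin[OF G] by simp
  let ?n = "card (pverts G)"
  show ?case
  proof (cases k)
    case 0
    obtain v where v: "v \<in> pverts G" using less.prems by blast
    have "nbr G v \<noteq> {}" using less.prems(2)[OF v] by (auto simp: deg_nbr)
    then obtain w where w: "w \<in> nbr G v" by blast
    have "v \<noteq> w" using w pair_graph_irrefl[OF G] by (auto simp: nbr_def)
    moreover have "card {v, w} \<le> ?n"
      using v w nbr_subset[OF G, of v] by (intro card_mono[OF fin]) auto
    ultimately have n2: "?n \<ge> 2" by simp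
    have d: "int (deg G v) \<le> int ?n - 1" if "v \<in> pverts G" for v
      using deg_complement(2)[OF G that] n2 by linarith
    have "(\<Sum>v\<in>pverts G. int (deg G v)) \<le> (\<Sum>v\<in>pverts G. int ?n - 1)"
      by (rule sum_mono) (rule d)
    moreover have "(\<Sum>v\<in>pverts G. int (deg G v) ^ 2) \<le> (\<Sum>v\<in>pverts G. (int ?n - 1) ^ 2)"
      by (rule sum_mono) (use d in \<open>auto intro!: power_mono\<close>)
    ultimately show ?thesis using n2 0 by simp
  next
    case (Suc k')
    have "\<not> conn G" using conn_count_zero[OF G] less.prems(4) Suc by auto
    then obtain W where W: "separated G W" "W \<noteq> {}" "W \<noteq> pverts G" "W \<subseteq> pverts G"
      using not_conn_separated[OF G] by metis
    let ?U = "pverts G - W"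
    have U: "separated G ?U" "?U \<noteq> {}" using separated_Diff[OF G W(1)] W by auto
    have pg: "pair_graph (induced G W)" "pair_graph (induced G ?U)"
      using pair_graph_induced[OF G] W(4) by auto
    have finW: "finite W" using W(4) fin finite_subset by blast
    have card: "card W + card ?U = ?n" using W(4) fin by (simp add: card_Diff_subset finW card_mono)
    have lt: "card W < ?n" "card ?U < ?n"
      using card card_gt_0_iff[of W] card_gt_0_iff[of ?U] W(2) U(2) finW fin by auto
    have c1: "count (spec (induced G W)) 0 \<ge> 1" "count (spec (induced G ?U)) 0 \<ge> 1"
      using zero_in_spec[OF pg(1)] zero_in_spec[OF pg(2)] W U by (auto simp: Suc_le_eq)
    have c2: "count (spec (induced G W)) 0 + count (spec (induced G ?U)) 0 = count (spec G) 0"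
      using spec_separated[OF G W(1)] by simp
    define cW where "cW = count (spec (induced G W)) 0"
    define cU where "cU = count (spec (induced G ?U)) 0"
    note c = c1[folded cW_def cU_def] c2[folded cW_def cU_def]
    \<comment> \<open>More than \<open>k' + 1\<close> zeros are distributed over the two sides. The
      shares \<open>k1\<close> and \<open>k2\<close> must stay below the respective multiplicities;
      that they add up to \<open>k'\<close> only pays for the cut itself.\<close>
    define k1 where "k1 = min (cW - 1) k'"
    define k2 where "k2 = k' - k1"
    have k12: "k1 + k2 = k'" "k1 < cW" "k2 < cU"
      using c less.prems(4) Suc unfolding k1_def k2_def by linarith+
    have dW: "(\<Sum>v\<in>W. g (deg (induced G W) v)) = (\<Sum>v\<in>W. g (deg G v))" for g :: "nat \<Rightarrow> int"
      by (intro sum.cong refl) (simp add: deg_induced[OF G W(1)])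
    have dU: "(\<Sum>v\<in>?U. g (deg (induced G ?U) v)) = (\<Sum>v\<in>?U. g (deg G v))" for g :: "nat \<Rightarrow> int"
      by (intro sum.cong refl) (simp add: deg_induced[OF G U(1)])
    define a where "a = int (card W) - 2 * int k1"
    define b where "b = int (card ?U) - 2 * int k2"
    have 1: "a \<ge> 2 \<and> (\<Sum>v\<in>W. int (deg G v)) \<le> a * (a - 1) + 2 * k1 \<and>
      (\<Sum>v\<in>W. int (deg G v) ^ 2) \<le> a * (a - 1) ^ 2 + 2 * k1"
      using less.hyps[of "induced G W" k1] lt(1) pg(1) k12(2) W(2,4) less.prems(2)
        dW[of int] dW[of "\<lambda>d. int d ^ 2"]
      by (auto simp: a_def deg_induced[OF G W(1)] cW_def subset_iff)
    have 2: "b \<ge> 2 \<and> (\<Sum>v\<in>?U. int (deg G v)) \<le> b * (b - 1) + 2 * k2 \<and>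
      (\<Sum>v\<in>?U. int (deg G v) ^ 2) \<le> b * (b - 1) ^ 2 + 2 * k2"
      using less.hyps[of "induced G ?U" k2] lt(2) pg(2) k12(3) U(2) less.prems(2)
        dU[of int] dU[of "\<lambda>d. int d ^ 2"]
      by (auto simp: b_def deg_induced[OF G U(1)] cU_def)
    have sp: "(\<Sum>v\<in>pverts G. f v) = (\<Sum>v\<in>W. f v) + (\<Sum>v\<in>?U. f v)" for f :: "'a \<Rightarrow> int"
      using sum.subset_diff[OF W(4) fin, of f] by simp
    \<comment> \<open>Trading complete graphs of orders \<open>a\<close> and \<open>b\<close> for
      one of order \<open>a + b - 2\<close> and a K2 raises both sums by a polynomial in
      \<open>p\<close> and \<open>q\<close> with nonnegative coefficients.\<close>
    define p where "p = a - 2"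
    define q where "q = b - 2"
    have pq: "p \<ge> 0" "q \<ge> 0" "a = p + 2" "b = q + 2" using 1 2 by (auto simp: p_def q_def)
    have N: "int ?n - 2 * int k = p + q + 2"
      using card k12(1) Suc pq by (simp add: a_def b_def)
    have kk: "int k = int k1 + int k2 + 1" using k12(1) Suc by simp
    have i1: "a * (a - 1) + b * (b - 1) \<le> (p + q + 2) * (p + q + 2 - 1) + 2"
      using mult_nonneg_nonneg[OF pq(1,2)] unfolding pq(3,4) by (simp add: algebra_simps)
    have i2: "a * (a - 1) ^ 2 + b * (b - 1) ^ 2 \<le> (p + q + 2) * (p + q + 2 - 1) ^ 2 + 2"
      using mult_nonneg_nonneg[OF pq(1,2)] mult_nonneg_nonneg[OF mult_nonneg_nonneg[OF pq(1,2)] pq(1)]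
        mult_nonneg_nonneg[OF mult_nonneg_nonneg[OF pq(1,2)] pq(2)]
      unfolding pq(3,4) by (simp add: algebra_simps power2_eq_square)
    show ?thesis unfolding N sp using 1 2 i1 i2 kk pq(1,2) by auto
  qed
qed

text \<open>\<open>f\<close> is the eigenvector of the star formed by \<open>v\<close> and its
  neighbours for the eigenvalue \<open>deg G v + 1\<close>. The arcs at \<open>v\<close> alone
  already give this Rayleigh quotient.\<close>

lemma deg_lower_aux:
  fixes f :: "'a \<Rightarrow> real"
  assumes G: "pair_graph G" and v: "v \<in> pverts G"
    and f: "f v = real (deg G v)" "\<And>x. x \<in> nbr G v \<Longrightarrow> f x = - 1" "\<And>x. x \<noteq> v \<Longrightarrow> x \<notin> nbr G v \<Longrightarrow> f x = 0"
  shows "(\<Sum>x\<in>pverts G. (f x)\<^sup>2) = real (deg G v) * (real (deg G v) + 1)"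
    and "(\<Sum>(x, y)\<in>{(x, y). (x, y) \<in> parcs G \<and> (x = v \<or> y = v)}. (f x - f y)\<^sup>2) =
      2 * real (deg G v) * (real (deg G v) + 1)\<^sup>2"
proof -
  have irr: "v \<notin> nbr G v" using pair_graph_irrefl[OF G] by (simp add: nbr_def)
  have "(\<Sum>x\<in>pverts G. (f x)\<^sup>2) = (\<Sum>x\<in>insert v (nbr G v). (f x)\<^sup>2)"
    using nbr_subset[OF G, of v] v pair_graph_fin[OF G]
    by (intro sum.mono_neutral_right) (auto simp: f)
  also have "\<dots> = (real (deg G v))\<^sup>2 + (\<Sum>x\<in>nbr G v. 1)"
    using irr finite_nbr[OF G] by (subst sum.insert) (auto simp: f intro!: sum.cong)
  finally show "(\<Sum>x\<in>pverts G. (f x)\<^sup>2) = real (deg G v) * (real (deg G v) + 1)"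
    by (simp add: deg_nbr power2_eq_square algebra_simps)
  have eq: "{(x, y). (x, y) \<in> parcs G \<and> (x = v \<or> y = v)} = Pair v ` nbr G v \<union> (\<lambda>x. (x, v)) ` nbr G v"
    using pair_graph_symD[OF G] by (auto simp: nbr_def)
  have "(\<Sum>(x, y)\<in>{(x, y). (x, y) \<in> parcs G \<and> (x = v \<or> y = v)}. (f x - f y)\<^sup>2) =
      (\<Sum>(x, y)\<in>Pair v ` nbr G v. (f x - f y)\<^sup>2) + (\<Sum>(x, y)\<in>(\<lambda>x. (x, v)) ` nbr G v. (f x - f y)\<^sup>2)"
    unfolding eq using irr finite_nbr[OF G] by (intro sum.union_disjoint) auto
  also have "\<dots> = (\<Sum>x\<in>nbr G v. (real (deg G v) + 1)\<^sup>2) + (\<Sum>x\<in>nbr G v. (real (deg G v) + 1)\<^sup>2)"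
    using irr by (simp add: sum.reindex inj_on_def f power2_commute[of "- 1"] add.commute cong: sum.cong)
  finally show "(\<Sum>(x, y)\<in>{(x, y). (x, y) \<in> parcs G \<and> (x = v \<or> y = v)}. (f x - f y)\<^sup>2) =
      2 * real (deg G v) * (real (deg G v) + 1)\<^sup>2"
    by (simp add: deg_nbr)
qed

text \<open>Arcs away from \<open>v\<close> can only increase the quadratic form at the eigenvector
  of the star.\<close>

lemma ex_spec_ge_deg:
  assumes G: "pair_graph G" and v: "v \<in> pverts G" and d: "deg G v \<ge> 1"
  shows "\<exists>x\<in>#spec G. x \<ge> real (deg G v) + 1"
proof (rule ccontr)
  assume *: "\<not> ?thesis"
  define f where "f = (\<lambda>x. if x = v then real (deg G v) else if x \<in> nbr G v then - 1 else 0)"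
  have f: "f v = real (deg G v)" "x \<in> nbr G v \<Longrightarrow> f x = - 1" "x \<noteq> v \<Longrightarrow> x \<notin> nbr G v \<Longrightarrow> f x = 0" for x
    using pair_graph_irrefl[OF G] by (auto simp: f_def nbr_def)
  have aux: "(\<Sum>x\<in>pverts G. (f x)\<^sup>2) = real (deg G v) * (real (deg G v) + 1)"
    "(\<Sum>(x, y)\<in>{(x, y). (x, y) \<in> parcs G \<and> (x = v \<or> y = v)}. (f x - f y)\<^sup>2) =
      2 * real (deg G v) * (real (deg G v) + 1)\<^sup>2"
    by (rule deg_lower_aux[OF G v]; rule f; assumption)+
  have "pverts G \<noteq> {}" using v by blast
  then have ne: "spec G \<noteq> {#}" using zero_in_spec[OF G] by auto
  define r where "r = Max (set_mset (spec G))"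
  have r: "r < real (deg G v) + 1" using * ne unfolding r_def by (subst Max_less_iff) (auto simp: not_le)
  have "2 * real (deg G v) * (real (deg G v) + 1)\<^sup>2 \<le> (\<Sum>(x, y)\<in>parcs G. (f x - f y)\<^sup>2)"
    unfolding aux(2)[symmetric] by (rule sum_mono2) (use pair_graph_fin[OF G] in auto)
  also have "\<dots> \<le> 2 * r * (real (deg G v) * (real (deg G v) + 1))"
    unfolding aux(1)[symmetric] by (rule rayleigh_bound[OF G]) (simp add: r_def)
  also have "\<dots> < 2 * (real (deg G v) + 1) * (real (deg G v) * (real (deg G v) + 1))"
    using r d by (intro mult_strict_right_mono) auto
  finally show False by (simp add: power2_eq_square algebra_simps)
qed

text \<open>Strictness comes from an arc leaving the closed neighbourhood of \<open>v\<close>: it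
  exists because the graph is connected and has further vertices, and the test function changes
  along it from -1 to 0.\<close>

lemma ex_spec_gt_deg:
  assumes G: "pair_graph G" and conn: "conn G" and v: "v \<in> pverts G" and d: "deg G v + 2 \<le> card (pverts G)"
  shows "\<exists>x\<in>#spec G. x > real (deg G v) + 1"
proof (rule ccontr)
  assume *: "\<not> ?thesis"
  define f where "f = (\<lambda>x. if x = v then real (deg G v) else if x \<in> nbr G v then - 1 else 0)"
  have f: "f v = real (deg G v)" "x \<in> nbr G v \<Longrightarrow> f x = - 1" "x \<noteq> v \<Longrightarrow> x \<notin> nbr G v \<Longrightarrow> f x = 0" for x
    using pair_graph_irrefl[OF G] by (auto simp: f_def nbr_def)
  have aux: "(\<Sum>x\<in>pverts G. (f x)\<^sup>2) = real (deg G v) * (real (deg G v) + 1)"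
    "(\<Sum>(x, y)\<in>{(x, y). (x, y) \<in> parcs G \<and> (x = v \<or> y = v)}. (f x - f y)\<^sup>2) =
      2 * real (deg G v) * (real (deg G v) + 1)\<^sup>2"
    by (rule deg_lower_aux[OF G v]; rule f; assumption)+
  let ?S = "insert v (nbr G v)"
  have sub: "?S \<subseteq> pverts G" using nbr_subset[OF G] v by blast
  have "card ?S \<le> deg G v + 1" using card_insert_le_m1[of "deg G v + 1" "nbr G v" v] by (simp add: deg_nbr)
  then have "?S \<noteq> pverts G" using d by auto
  then obtain w z where wz: "(w, z) \<in> parcs G" "w \<in> ?S" "z \<notin> ?S"
    using conn sub unfolding conn_def by blast
  then have w: "w \<in> nbr G v" "w \<noteq> v" "z \<noteq> v" by (auto simp: nbr_def dest: pair_graph_wf[OF G])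
  let ?A = "{(x, y). (x, y) \<in> parcs G \<and> (x = v \<or> y = v)}"
  have finA: "finite ?A" by (rule finite_subset[OF _ pair_graph_fin(2)[OF G]]) auto
  have "2 * real (deg G v) * (real (deg G v) + 1)\<^sup>2 + 1 = (\<Sum>(x, y)\<in>insert (w, z) ?A. (f x - f y)\<^sup>2)"
    using finA wz w unfolding aux(2)[symmetric] by (subst sum.insert) (auto simp: f)
  also have "\<dots> \<le> (\<Sum>(x, y)\<in>parcs G. (f x - f y)\<^sup>2)"
    by (rule sum_mono2) (use pair_graph_fin[OF G] wz in auto)
  also have "\<dots> \<le> 2 * (real (deg G v) + 1) * (real (deg G v) * (real (deg G v) + 1))"
    unfolding aux(1)[symmetric] by (rule rayleigh_bound[OF G]) (use * in \<open>auto simp: not_less\<close>)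
  finally show False by (simp add: power2_eq_square algebra_simps)
qed

text \<open>Cauchy-Schwarz against the constant 1, from the nonnegativity of a variance.\<close>

lemma sum_power2_le_card:
  fixes a :: "'b \<Rightarrow> real"
  assumes "finite A"
  shows "(\<Sum>x\<in>A. a x)\<^sup>2 \<le> (\<Sum>x\<in>A. (a x)\<^sup>2) * card A"
proof (cases "A = {}")
  case False
  define N where "N = real (card A)"
  define S where "S = (\<Sum>x\<in>A. a x)"
  have N: "N > 0" using False assms by (simp add: N_def card_gt_0_iff)
  have "0 \<le> (\<Sum>x\<in>A. (N * a x - S)\<^sup>2)" by (intro sum_nonneg) auto
  also have "\<dots> = (\<Sum>x\<in>A. N\<^sup>2 * (a x)\<^sup>2 - 2 * N * S * a x + S\<^sup>2)"
    by (intro sum.cong refl) (simp add: power2_eq_square algebra_simps)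
  also have "\<dots> = N\<^sup>2 * (\<Sum>x\<in>A. (a x)\<^sup>2) - 2 * N * S * S + N * S\<^sup>2"
    by (simp add: sum.distrib sum_subtractf sum_distrib_left S_def N_def)
  also have "\<dots> = N * ((\<Sum>x\<in>A. (a x)\<^sup>2) * N - S\<^sup>2)"
    by (simp add: power2_eq_square algebra_simps)
  finally show ?thesis using N by (simp add: zero_le_mult_iff N_def S_def)
qed simp

text \<open>The test function is the degree with the sign given by the colour, so that differences
  along arcs become sums of degrees up to sign. Over all arcs these sums add up to twice the sum
  \<open>q\<close> of the squared degrees, and Cauchy-Schwarz over the arcs bounds the quadratic
  form from below.\<close>

lemma bipartite_spec_bound:
  assumes G: "pair_graph G" and col: "\<And>v w. (v, w) \<in> parcs G \<Longrightarrow> c v \<noteq> (c w :: bool)"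
    and r: "\<And>x. x \<in># spec G \<Longrightarrow> x \<le> r"
  shows "2 * (\<Sum>v\<in>pverts G. real (deg G v) ^ 2) \<le> r * (\<Sum>v\<in>pverts G. real (deg G v))"
proof -
  define q where "q = (\<Sum>v\<in>pverts G. real (deg G v) ^ 2)"
  define s where "s = (\<Sum>v\<in>pverts G. real (deg G v))"
  have s: "s = card (parcs G)" using sum_deg_eq_card[OF G] by (simp add: s_def flip: of_nat_sum)
  define f where "f v = (if c v then 1 else - 1) * real (deg G v)" for v
  have e: "(\<Sum>(v, w)\<in>parcs G. real (deg G v) + real (deg G w)) = 2 * q"
  proof -
    have "(\<Sum>(v, w)\<in>parcs G. real (deg G v) + real (deg G w)) =
        (\<Sum>v\<in>pverts G. \<Sum>w\<in>nbr G v. real (deg G v)) + (\<Sum>v\<in>pverts G. \<Sum>w\<in>nbr G v. real (deg G w))"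
      unfolding sum_arcs[OF G] by (simp add: sum.distrib)
    also have "(\<Sum>v\<in>pverts G. \<Sum>w\<in>nbr G v. real (deg G w)) = (\<Sum>v\<in>pverts G. \<Sum>w\<in>nbr G v. real (deg G v))"
      by (rule sum_arcs_swap[OF G])
    finally show ?thesis by (simp add: q_def deg_nbr power2_eq_square)
  qed
  have "(2 * q)\<^sup>2 \<le> (\<Sum>(v, w)\<in>parcs G. (real (deg G v) + real (deg G w))\<^sup>2) * (\<Sum>(v, w)\<in>parcs G. 1)"
    using sum_power2_le_card[OF pair_graph_fin(2)[OF G], of "\<lambda>(v, w). real (deg G v) + real (deg G w)"]
    unfolding e by (simp add: case_prod_unfold)
  also have "(\<Sum>(v, w)\<in>parcs G. (real (deg G v) + real (deg G w))\<^sup>2) = (\<Sum>(v, w)\<in>parcs G. (f v - f w)\<^sup>2)"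
  proof (intro sum.cong refl, clarify)
    fix v w assume "(v, w) \<in> parcs G"
    then show "(real (deg G v) + real (deg G w))\<^sup>2 = (f v - f w)\<^sup>2"
      using col[of v w] by (cases "c v"; cases "c w") (simp_all add: f_def power2_eq_square algebra_simps)
  qed
  also have "\<dots> * (\<Sum>(v, w)\<in>parcs G. 1) \<le> 2 * r * (\<Sum>v\<in>pverts G. (f v)\<^sup>2) * s"
    using rayleigh_bound[OF G r, of f] s by (simp add: case_prod_unfold mult_right_mono)
  also have "(\<Sum>v\<in>pverts G. (f v)\<^sup>2) = q"
    unfolding q_def by (intro sum.cong refl) (simp add: f_def power_mult_distrib)
  finally have "2 * q * (2 * q) \<le> 2 * q * (r * s)" by (simp add: power2_eq_square mult_ac)
  moreover have "q \<ge> 0" unfolding q_def by (intro sum_nonneg) auto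
  moreover have "s = 0" if "q = 0"
  proof -
    have "\<forall>v\<in>pverts G. real (deg G v) ^ 2 = 0"
      using that pair_graph_fin[OF G] unfolding q_def by (subst (asm) sum_nonneg_eq_0_iff) auto
    then show ?thesis unfolding s_def by simp
  qed
  ultimately have "2 * q \<le> r * s"
    by (cases "q = 0") (auto dest: mult_left_le_imp_le)
  then show ?thesis by (simp add: q_def s_def)
qed

subsection \<open>Graphs with three edges\<close>

lemma edge_set_iff:
  assumes "pair_graph G"
  shows "{v, w} \<in> edge_set G \<longleftrightarrow> (v, w) \<in> parcs G"
  using pair_graph_symD[OF assms] by (auto simp: edge_set_def doubleton_eq_iff)

lemma edge_set_card_2:
  assumes "pair_graph G" "e \<in> edge_set G"
  shows "card e = 2" "e \<subseteq> pverts G"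
proof -
  obtain u v where uv: "(u, v) \<in> parcs G" "e = {u, v}" using assms(2) by (auto simp: edge_set_def)
  then show "card e = 2" "e \<subseteq> pverts G" using pair_graph_wf[OF assms(1) uv(1)] by auto
qed

lemma finite_edge_set: "pair_graph G \<Longrightarrow> finite (edge_set G)"
  by (simp add: edge_set_def pair_graph_fin)

lemma card_parcs: 
  assumes G: "pair_graph G"
  shows "card (parcs G) = 2 * card (edge_set G)"
proof -
  let ?f = "\<lambda>(u, v). {u, v}"
  have fib: "card {a \<in> parcs G. ?f a = e} = 2" if "e \<in> edge_set G" for e
  proof -
    obtain u v where uv: "(u, v) \<in> parcs G" "e = {u, v}" using \<open>e \<in> edge_set G\<close> by (auto simp: edge_set_def)
    have "{a \<in> parcs G. ?f a = e} = {(u, v), (v, u)}"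
      using uv pair_graph_symD[OF G] by (auto simp: doubleton_eq_iff)
    moreover have "u \<noteq> v" using pair_graph_wf[OF G] uv by blast
    ultimately show ?thesis by simp
  qed
  have "card (parcs G) = (\<Sum>a\<in>parcs G. 1)" by simp
  also have "\<dots> = (\<Sum>e\<in>?f ` parcs G. \<Sum>a\<in>{a \<in> parcs G. ?f a = e}. 1)"
    by (rule sum.image_gen) (simp add: pair_graph_fin G)
  also have "\<dots> = (\<Sum>e\<in>edge_set G. 2)"
    unfolding edge_set_def[symmetric] using fib by (intro sum.cong) auto
  finally show ?thesis by simp
qed

lemma deg_eq_card_edges:
  assumes G: "pair_graph G"
  shows "deg G v = card {e \<in> edge_set G. v \<in> e}"
proof -
  have "{e \<in> edge_set G. v \<in> e} = (\<lambda>w. {v, w}) ` nbr G v"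
    using pair_graph_symD[OF G] by (auto simp: nbr_def edge_set_def insert_commute)
  moreover have "inj_on (\<lambda>w. {v, w}) (nbr G v)"
    by (auto simp: inj_on_def doubleton_eq_iff)
  ultimately show ?thesis by (simp add: card_image deg_nbr)
qed

lemma triangle_edges:
  assumes G: "pair_graph G" and E: "edge_set G = {e1, e2, e3}"
    and tr: "(v, w) \<in> parcs G" "(w, x) \<in> parcs G" "(x, v) \<in> parcs G"
  shows "edge_set G = {{v, w}, {w, x}, {v, x}}" "v \<noteq> w" "w \<noteq> x" "v \<noteq> x"
proof -
  show d: "v \<noteq> w" "w \<noteq> x" "v \<noteq> x" using pair_graph_wf[OF G] tr by blast+
  have sub: "{{v, w}, {w, x}, {v, x}} \<subseteq> edge_set G"
    using tr pair_graph_symD[OF G tr(3)] by (simp add: edge_set_iff[OF G])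
  have "card {{v, w}, {w, x}, {v, x}} = 3" using d by (auto simp: doubleton_eq_iff card_insert_if)
  moreover have "card (edge_set G) \<le> 3" unfolding E by (auto simp: card_insert_if)
  ultimately show "edge_set G = {{v, w}, {w, x}, {v, x}}"
    using card_seteq[OF finite_edge_set[OF G] sub] by simp
qed

lemma tri_triangle:
  assumes G: "pair_graph G" and E: "edge_set G = {{p, q}, {q, r}, {p, r}}" and d: "p \<noteq> q" "q \<noteq> r" "p \<noteq> r"
  shows "tri G = 6"
proof -
  have a: "(v, w) \<in> parcs G \<longleftrightarrow> v \<in> {p, q, r} \<and> w \<in> {p, q, r} \<and> v \<noteq> w" for v w
    using d unfolding edge_set_iff[OF G, symmetric] E insert_iff doubleton_eq_iff empty_iff by metis
  have "{(v, w, x). (v, w) \<in> parcs G \<and> (w, x) \<in> parcs G \<and> (x, v) \<in> parcs G} =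
      {(p, q, r), (p, r, q), (q, p, r), (q, r, p), (r, p, q), (r, q, p)}" (is "?A = ?B")
  proof (intro equalityI subsetI)
    fix t assume "t \<in> ?A"
    then obtain v w x where t: "t = (v, w, x)" "v \<in> {p, q, r}" "w \<in> {p, q, r}" "v \<noteq> w"
        "x \<in> {p, q, r}" "w \<noteq> x" "x \<noteq> v"
      unfolding a by auto
    then show "t \<in> ?B" by (elim insertE emptyE) simp_all
  next
    fix t assume "t \<in> ?B"
    then show "t \<in> ?A" unfolding a using d by (elim insertE emptyE) auto
  qed
  then show ?thesis using d by (simp add: tri_def)
qed

text \<open>\<open>k\<close> counts the pairs of edges with a common vertex. \<open>e\<close> is 1
  for the star and -1 for the triangle, which share \<open>k = 3\<close>, and 0 for the other three
  shapes. Inclusion-exclusion over the edges replaces a classification up to isomorphism.\<close>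

lemma three_edge_degrees:
  assumes F: "pair_graph F" and c: "card (parcs F) = 6"
  shows "\<exists>k e :: int. (k, e) \<in> {(0, 0), (1, 0), (2, 0), (3, 1), (3, - 1)} \<and>
    (\<Sum>v\<in>pverts F. int (deg F v) ^ 2) = 6 + 2 * k \<and>
    (\<Sum>v\<in>pverts F. int (deg F v) ^ 3) - tri F = 6 + 6 * k + 6 * e"
proof -
  have "card (edge_set F) = 3" using c card_parcs[OF F] by simp
  then obtain e1 e2 e3 where E: "edge_set F = {e1, e2, e3}" and dist: "e1 \<noteq> e2" "e1 \<noteq> e3" "e2 \<noteq> e3"
    by (auto simp: card_3_iff)
  have e: "card e1 = 2" "card e2 = 2" "card e3 = 2" "e1 \<subseteq> pverts F" "e2 \<subseteq> pverts F" "e3 \<subseteq> pverts F"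
    using edge_set_card_2[OF F] E by auto
  have fin: "finite (pverts F)" using pair_graph_fin F by blast
  have fe: "finite e1" "finite e2" "finite e3" using e finite_subset[OF _ fin] by auto
  have int1: "card (a \<inter> b) \<le> 1" if "card a = 2" "card b = 2" "a \<noteq> b" "finite a" "finite b" for a b :: "'a set"
  proof (rule ccontr)
    assume "\<not> ?thesis"
    then have "card (a \<inter> b) \<ge> 2" by simp
    then have "a \<inter> b = a" "a \<inter> b = b"
      using that(1,2) by (auto intro!: card_seteq[OF that(4)] card_seteq[OF that(5)])
    then show False by (metis that(3))
  qed
  define c12 where "c12 = card (e1 \<inter> e2)"
  define c13 where "c13 = card (e1 \<inter> e3)"
  define c23 where "c23 = card (e2 \<inter> e3)"
  define h where "h = card (e1 \<inter> e2 \<inter> e3)"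
  have cle: "c12 \<le> 1" "c13 \<le> 1" "c23 \<le> 1"
    unfolding c12_def c13_def c23_def using int1 e fe dist by auto
  have hle: "h \<le> c12" "h \<le> c13" "h \<le> c23"
    unfolding h_def c12_def c13_def c23_def using fe by (auto intro!: card_mono)
  \<comment> \<open>A degree is a sum of three indicator functions, whose products are indicators of
    intersections; this yields the coefficients 2 and 6 in its square and cube.\<close>
  define x where "x i v = (if v \<in> (i :: 'a set) then 1 else 0 :: int)" for i v
  have deg: "int (deg F v) = x e1 v + x e2 v + x e3 v" for v
  proof -
    have "{e \<in> edge_set F. v \<in> e} = (if v \<in> e1 then {e1} else {}) \<union> (if v \<in> e2 then {e2} else {}) \<union>
        (if v \<in> e3 then {e3} else {})"
      unfolding E by auto
    then show ?thesis using dist by (simp add: deg_eq_card_edges[OF F] x_def)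
  qed
  have xx: "x i v * x j v = x (i \<inter> j) v" for i j v by (simp add: x_def)
  have sx: "(\<Sum>v\<in>pverts F. x i v) = int (card i)" if "i \<subseteq> pverts F" for i
    using that fin by (simp add: x_def sum.If_cases Int_absorb1)
  have sq: "int (deg F v) ^ 2 = x e1 v + x e2 v + x e3 v + 2 * (x (e1 \<inter> e2) v + x (e1 \<inter> e3) v + x (e2 \<inter> e3) v)" for v
    unfolding deg by (simp add: x_def)
  have cu: "int (deg F v) ^ 3 = x e1 v + x e2 v + x e3 v + 6 * (x (e1 \<inter> e2) v + x (e1 \<inter> e3) v + x (e2 \<inter> e3) v)
      + 6 * x (e1 \<inter> e2 \<inter> e3) v" for v
    unfolding deg by (simp add: x_def)
  have sub: "e1 \<inter> e2 \<subseteq> pverts F" "e1 \<inter> e3 \<subseteq> pverts F" "e2 \<inter> e3 \<subseteq> pverts F" "e1 \<inter> e2 \<inter> e3 \<subseteq> pverts F"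
    using e by auto
  have S2: "(\<Sum>v\<in>pverts F. int (deg F v) ^ 2) = 6 + 2 * (int c12 + int c13 + int c23)"
    unfolding sq by (simp add: sum.distrib sx e sub c12_def c13_def c23_def flip: sum_distrib_left)
  have S3: "(\<Sum>v\<in>pverts F. int (deg F v) ^ 3) = 6 + 6 * (int c12 + int c13 + int c23) + 6 * int h"
    unfolding cu by (simp add: sum.distrib sx e sub c12_def c13_def c23_def h_def flip: sum_distrib_left)
  have tri0: "tri F = 0" if nt: "\<nexists>v w x. (v, w) \<in> parcs F \<and> (w, x) \<in> parcs F \<and> (x, v) \<in> parcs F"
  proof -
    have "{(v, w, x). (v, w) \<in> parcs F \<and> (w, x) \<in> parcs F \<and> (x, v) \<in> parcs F} = {}"
      using nt by blast
    then show ?thesis unfolding tri_def by (simp only: card.empty)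
  qed
  have tri6: "tri F = 6 \<and> c12 = 1 \<and> c13 = 1 \<and> c23 = 1 \<and> h = 0"
    if t: "(v, w) \<in> parcs F" "(w, y) \<in> parcs F" "(y, v) \<in> parcs F" for v w y
  proof -
    note te = triangle_edges[OF F E t]
    have tri: "tri F = 6" by (rule tri_triangle[OF F te])
    have mem: "e1 \<in> {{v, w}, {w, y}, {v, y}}" "e2 \<in> {{v, w}, {w, y}, {v, y}}" "e3 \<in> {{v, w}, {w, y}, {v, y}}"
      unfolding te(1)[symmetric] E by simp_all
    have pair: "i \<inter> j \<noteq> {}" if "i \<in> {{v, w}, {w, y}, {v, y}}" "j \<in> {{v, w}, {w, y}, {v, y}}" for i j
      using that by auto
    note ne = pair[OF mem(1,2)] pair[OF mem(1,3)] pair[OF mem(2,3)]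
    have "e1 \<inter> e2 \<inter> e3 = \<Inter> (edge_set F)" unfolding E by auto
    also have "\<dots> = {}" unfolding te(1) using te(2-4) by auto
    finally have "e1 \<inter> e2 \<inter> e3 = {}" .
    then have "h = 0" by (simp add: h_def)
    moreover have "c12 > 0" "c13 > 0" "c23 > 0"
      using ne fe by (auto simp: c12_def c13_def c23_def card_gt_0_iff)
    ultimately show ?thesis using tri cle by auto
  qed
  \<comment> \<open>Three edges that meet pairwise, but not in one point, form a triangle.\<close>
  have ex: "\<exists>v w y. (v, w) \<in> parcs F \<and> (w, y) \<in> parcs F \<and> (y, v) \<in> parcs F"
    if "c12 = 1" "c13 = 1" "c23 = 1" "h = 0"
  proof -
    obtain p where p: "p \<in> e1" "p \<in> e2" using \<open>c12 = 1\<close> by (auto simp: c12_def card_1_singleton_iff)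
    obtain q where q: "q \<in> e2" "q \<in> e3" using \<open>c23 = 1\<close> by (auto simp: c23_def card_1_singleton_iff)
    obtain r where r: "r \<in> e1" "r \<in> e3" using \<open>c13 = 1\<close> by (auto simp: c13_def card_1_singleton_iff)
    have no: "e1 \<inter> e2 \<inter> e3 = {}" using \<open>h = 0\<close> fe by (simp add: h_def)
    then have pq: "p \<noteq> q" "q \<noteq> r" "p \<noteq> r" using p q r by auto
    have two: "i = {a, b}" if "card i = 2" "a \<in> i" "b \<in> i" "a \<noteq> b" for i :: "'a set" and a b
      using that by (auto simp: card_2_iff)
    have "e1 = {p, r}" "e2 = {p, q}" "e3 = {q, r}"
      using two[OF e(1) p(1) r(1) pq(3)] two[OF e(2) p(2) q(1) pq(1)] two[OF e(3) q(2) r(2) pq(2)]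
      by simp_all
    then have "{p, q} \<in> edge_set F" "{q, r} \<in> edge_set F" "{r, p} \<in> edge_set F" unfolding E by auto
    then show ?thesis unfolding edge_set_iff[OF F] by blast
  qed
  have tri: "tri F = 0 \<or> tri F = 6 \<and> c12 = 1 \<and> c13 = 1 \<and> c23 = 1 \<and> h = 0"
  proof (cases "\<exists>v w y. (v, w) \<in> parcs F \<and> (w, y) \<in> parcs F \<and> (y, v) \<in> parcs F")
    case True
    then obtain v w y where "(v, w) \<in> parcs F" "(w, y) \<in> parcs F" "(y, v) \<in> parcs F" by (elim exE conjE)
    then show ?thesis by (intro disjI2 tri6)
  next
    case False
    then show ?thesis by (intro disjI1 tri0)
  qed
  have "h = 0 \<or> h = 1" using hle cle by linarith
  then consider "h = 1" | "h = 0" "c12 = 1 \<and> c13 = 1 \<and> c23 = 1" | "h = 0" "\<not> (c12 = 1 \<and> c13 = 1 \<and> c23 = 1)"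
    by blast
  then show ?thesis
  proof cases
    case 1
    then have "c12 = 1" "c13 = 1" "c23 = 1" using hle cle by auto
    moreover have "tri F = 0" using tri 1 by simp
    ultimately show ?thesis using S2 S3 1 by (intro exI[of _ 3] exI[of _ 1]) simp
  next
    case 2
    then obtain v w y where "(v, w) \<in> parcs F" "(w, y) \<in> parcs F" "(y, v) \<in> parcs F"
      using ex by (elim conjE exE) blast
    then have "tri F = 6" using tri6[of v w y] by simp
    then show ?thesis using S2 S3 2 by (intro exI[of _ 3] exI[of _ "-1"]) simp
  next
    case 3
    then have "tri F = 0" using tri by auto
    moreover have "int c12 + int c13 + int c23 \<in> {0, 1, 2}" using 3 cle by auto
    ultimately show ?thesis using S2 S3 3
      by (intro exI[of _ "int c12 + int c13 + int c23"] exI[of _ 0]) auto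
  qed
qed

text \<open>By the rank bound there are at most three nonzero eigenvalues; \<open>a\<close>,
  \<open>b\<close>, \<open>d\<close> are these, filled up with zeros. The equations express the
  spectral moments by the degrees.\<close>

lemma three_edge_spec:
  assumes F: "pair_graph F" and c: "card (parcs F) = 6" and N: "card (pverts F) \<ge> 3"
  shows "\<exists>(k :: int) (e :: int) a b d. (k, e) \<in> {(0, 0), (1, 0), (2, 0), (3, 1), (3, - 1)} \<and>
    spec F = {#a, b, d#} + replicate_mset (card (pverts F) - 3) 0 \<and>
    a + b + d = 6 \<and> a ^ 2 + b ^ 2 + d ^ 2 = 12 + 2 * real_of_int k \<and>
    a ^ 3 + b ^ 3 + d ^ 3 = 24 + 12 * real_of_int k + 6 * real_of_int e"
proof -
  obtain k e :: int where ke: "(k, e) \<in> {(0, 0), (1, 0), (2, 0), (3, 1), (3, - 1)}"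
    and S2: "(\<Sum>v\<in>pverts F. int (deg F v) ^ 2) = 6 + 2 * k"
    and S3: "(\<Sum>v\<in>pverts F. int (deg F v) ^ 3) - tri F = 6 + 6 * k + 6 * e"
    using three_edge_degrees[OF F c] by blast
  have S1: "(\<Sum>v\<in>pverts F. real (deg F v)) = 6"
    using sum_deg_eq_card[OF F] c by (simp flip: of_nat_sum)
  have S2': "(\<Sum>v\<in>pverts F. real (deg F v) ^ 2) = 6 + 2 * real_of_int k"
    using arg_cong[OF S2, of real_of_int] by simp
  have S3': "(\<Sum>v\<in>pverts F. real (deg F v) ^ 3) - real (tri F) = 6 + 6 * real_of_int k + 6 * real_of_int e"
    using arg_cong[OF S3, of real_of_int] by simp
  \<comment> \<open>One arc for each edge, so that \<open>D\<close> has at most three elements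
    rather than six.\<close>
  define D where "D = (\<lambda>e. SOME a. a \<in> parcs F \<and> (\<lambda>(u, v). {u, v}) a = e) ` edge_set F"
  have D: "finite D" "card D \<le> 3"
    using finite_edge_set[OF F] card_image_le[OF finite_edge_set[OF F]] card_parcs[OF F] c
    unfolding D_def by (auto intro: order_trans)
  have Dm: "(v, w) \<in> D \<or> (w, v) \<in> D" if vw: "(v, w) \<in> parcs F" for v w
  proof -
    let ?P = "\<lambda>a. a \<in> parcs F \<and> (\<lambda>(u, v). {u, v}) a = {v, w}"
    have "?P (v, w)" using vw by simp
    then have "?P (SOME a. ?P a)" by (rule someI)
    moreover have "(SOME a. ?P a) \<in> D" unfolding D_def using vw edge_set_iff[OF F] by blast
    ultimately show ?thesis by (cases "SOME a. ?P a") (auto simp: doubleton_eq_iff)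
  qed
  have nz: "size (filter_mset (\<lambda>x. x \<noteq> 0) (spec F)) \<le> 3"
    by (rule order_trans[OF card_nonzero_spec_le[OF F D(1) Dm] D(2)])
  define M where "M = filter_mset (\<lambda>x. x \<noteq> 0) (spec F)"
  have s0: "spec F = M + replicate_mset (count (spec F) 0) 0"
    unfolding M_def by (rule multiset_eqI) simp
  have sz: "size M + count (spec F) 0 = card (pverts F)"
    using arg_cong[OF s0, of size] laplacian_spectrum_eq_spec(2)[OF F] by simp
  define L where "L = M + replicate_mset (3 - size M) 0"
  have L: "size L = 3" using nz by (simp add: L_def M_def)
  have "spec F = L + replicate_mset (card (pverts F) - 3) 0"
  proof -
    have "count (spec F) 0 = (3 - size M) + (card (pverts F) - 3)"
      using sz nz N by (simp add: M_def)
    then have eq: "replicate_mset (count (spec F) 0) (0::real) =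
        replicate_mset (3 - size M) 0 + replicate_mset (card (pverts F) - 3) 0"
      by (intro multiset_eqI) auto
    show ?thesis unfolding L_def add.assoc eq[symmetric] by (rule s0)
  qed
  moreover obtain a b d where abd: "L = {#a, b, d#}"
  proof -
    obtain a L1 where 1: "L = add_mset a L1" using L by (metis size_eq_Suc_imp_eq_union numeral_3_eq_3)
    then have "size L1 = Suc (Suc 0)" using L by simp
    then obtain b L2 where 2: "L1 = add_mset b L2" using size_eq_Suc_imp_eq_union by metis
    then have "size L2 = Suc 0" using \<open>size L1 = _\<close> by simp
    then obtain d L3 where 3: "L2 = add_mset d L3" using size_eq_Suc_imp_eq_union by metis
    then have "L3 = {#}" using \<open>size L2 = _\<close> by simp
    then show thesis using that 1 2 3 by simp
  qed
  ultimately have sp: "spec F = {#a, b, d#} + replicate_mset (card (pverts F) - 3) 0" by simp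
  have "a + b + d = 6" using spec_sum[OF F] S1 by (simp add: sp)
  moreover have "a ^ 2 + b ^ 2 + d ^ 2 = 12 + 2 * real_of_int k"
    using spec_sum_sq[OF F] S1 S2' by (simp add: sp)
  moreover have "a ^ 3 + b ^ 3 + d ^ 3 = 24 + 12 * real_of_int k + 6 * real_of_int e"
    using spec_sum_cube[OF F] S3' S2' by (simp add: sp)
  ultimately show ?thesis using ke sp
    by (intro exI[of _ k] exI[of _ e] exI[of _ a] exI[of _ b] exI[of _ d]) simp
qed

subsection \<open>Triangle-free graphs with pendant vertices\<close>

text \<open>Summed over the arcs, the degree sums give twice the sum of the squared degrees, to
  which Cauchy-Schwarz applies. For a triangle-free graph the number of vertices is an admissible
  \<open>c\<close>, and the result is Mantel's theorem.\<close>

lemma arc_degree_sum_bound: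
  assumes G: "pair_graph G" and c: "\<And>v w. (v, w) \<in> parcs G \<Longrightarrow> real (deg G v) + real (deg G w) \<le> c"
    and "c \<ge> 0"
  shows "2 * (\<Sum>v\<in>pverts G. real (deg G v)) \<le> c * card (pverts G)"
proof -
  define s where "s = (\<Sum>v\<in>pverts G. real (deg G v))"
  define q where "q = (\<Sum>v\<in>pverts G. (real (deg G v))\<^sup>2)"
  have s0: "s \<ge> 0" unfolding s_def by (intro sum_nonneg) auto
  have "(\<Sum>v\<in>pverts G. \<Sum>w\<in>nbr G v. real (deg G v) + real (deg G w)) =
      (\<Sum>v\<in>pverts G. \<Sum>w\<in>nbr G v. real (deg G v)) + (\<Sum>v\<in>pverts G. \<Sum>w\<in>nbr G v. real (deg G w))"
    by (simp add: sum.distrib)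
  also have "(\<Sum>v\<in>pverts G. \<Sum>w\<in>nbr G v. real (deg G w)) = (\<Sum>v\<in>pverts G. \<Sum>w\<in>nbr G v. real (deg G v))"
    by (rule sum_arcs_swap[OF G])
  finally have "2 * q = (\<Sum>v\<in>pverts G. \<Sum>w\<in>nbr G v. real (deg G v) + real (deg G w))"
    by (simp add: q_def deg_nbr power2_eq_square)
  also have "\<dots> \<le> (\<Sum>v\<in>pverts G. \<Sum>w\<in>nbr G v. c)"
    by (intro sum_mono c) (simp add: nbr_def)
  also have "\<dots> = c * s" by (simp add: s_def deg_nbr sum_distrib_left mult.commute)
  finally have 1: "2 * q \<le> c * s" .
  have 2: "s\<^sup>2 \<le> q * card (pverts G)"
    using sum_power2_le_card[OF pair_graph_fin(1)[OF G], of "\<lambda>v. real (deg G v)"] by (simp add: s_def q_def)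
  have "2 * s * s \<le> 2 * (q * card (pverts G))" using 2 by (simp add: power2_eq_square)
  also have "\<dots> = 2 * q * card (pverts G)" by simp
  also have "\<dots> \<le> c * s * card (pverts G)" using 1 by (intro mult_right_mono) auto
  finally have 3: "(2 * s) * s \<le> (c * card (pverts G)) * s" by (simp add: mult_ac)
  show ?thesis
  proof (cases "s = 0")
    case True
    then show ?thesis using \<open>c \<ge> 0\<close> unfolding s_def by simp
  next
    case False
    then show ?thesis using 3 s0 unfolding s_def[symmetric] by (simp add: mult_le_cancel_right)
  qed
qed

section \<open>Deleting the pendant vertices\<close>

definition leaves :: "'a pair_pre_digraph \<Rightarrow> 'a set" where
  "leaves G = {v \<in> pverts G. deg G v = 1}"

text \<open>Pendant vertices are deleted once, so new ones may appear; the result need not be the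
  2-core.\<close>

definition core :: "'a pair_pre_digraph \<Rightarrow> 'a pair_pre_digraph" where
  "core G = induced G (pverts G - leaves G)"

lemma conn_deg_pos:
  assumes G: "pair_graph G" and conn: "conn G" and n: "card (pverts G) \<ge> 2" and v: "v \<in> pverts G"
  shows "deg G v \<ge> 1"
proof (rule ccontr)
  assume "\<not> ?thesis"
  then have "nbr G v = {}" using finite_nbr[OF G, of v] by (simp add: deg_nbr not_le)
  then have "\<forall>(x, y)\<in>parcs G. x \<in> {v} \<longrightarrow> y \<in> {v}" by (auto simp: nbr_def)
  then have "{v} = pverts G" using conn v unfolding conn_def by blast
  then have "card (pverts G) = 1" by (metis card_1_singleton_iff One_nat_def)
  then show False using n by simp
qed

lemma leaf_nbr:
  assumes "v \<in> leaves G"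
  obtains w where "nbr G v = {w}"
  using assms by (auto simp: leaves_def deg_nbr card_1_singleton_iff)

text \<open>Two adjacent pendant vertices would form a component of their own.\<close>

lemma leaves_not_adjacent:
  assumes G: "pair_graph G" and conn: "conn G" and n: "card (pverts G) \<ge> 3"
    and v: "v \<in> leaves G" "w \<in> leaves G"
  shows "(v, w) \<notin> parcs G"
proof
  assume vw: "(v, w) \<in> parcs G"
  then have "w \<in> nbr G v" "v \<in> nbr G w" using pair_graph_symD[OF G] by (auto simp: nbr_def)
  then have "nbr G v = {w}" "nbr G w = {v}" using leaf_nbr[OF v(1)] leaf_nbr[OF v(2)] by (metis singletonD)+
  then have "\<forall>(x, y)\<in>parcs G. x \<in> {v, w} \<longrightarrow> y \<in> {v, w}" by (auto simp: nbr_def)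
  moreover have "{v, w} \<subseteq> pverts G" using v by (auto simp: leaves_def)
  ultimately have "{v, w} = pverts G" using conn unfolding conn_def by blast
  then have "card (pverts G) \<le> 2" by (metis card_2_iff' card_insert_le_m1 card.empty card_insert_if finite.emptyI
     finite_insert insert_absorb le_SucI numeral_2_eq_2 order_refl One_nat_def)
  then show False using n by simp
qed

text \<open>A pendant vertex has its only neighbour in the core, so its deletion costs exactly two
  arcs.\<close>

lemma core_props:
  assumes G: "pair_graph G" and conn: "conn G" and n: "card (pverts G) \<ge> 3"
  shows "pair_graph (core G)" "pverts (core G) = pverts G - leaves G"
    "\<And>v. v \<in> pverts (core G) \<Longrightarrow> nbr (core G) v = nbr G v - leaves G"
    "(\<Sum>v\<in>pverts (core G). real (deg (core G) v)) =
      (\<Sum>v\<in>pverts G. real (deg G v)) - 2 * real (card (leaves G))"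
proof -
  show pg: "pair_graph (core G)" unfolding core_def by (rule pair_graph_induced[OF G]) auto
  show pv: "pverts (core G) = pverts G - leaves G" by (simp add: core_def)
  show nb: "nbr (core G) v = nbr G v - leaves G" if "v \<in> pverts (core G)" for v
    using that nbr_subset[OF G, of v] unfolding pv by (auto simp: core_def induced_def nbr_def)
  have fin: "finite (pverts G)" "finite (leaves G)" "leaves G \<subseteq> pverts G"
    using pair_graph_fin[OF G] by (auto simp: leaves_def)
  \<comment> \<open>Arcs between the core and the pendant vertices, counted from both sides.\<close>
  have "(\<Sum>v\<in>pverts G - leaves G. card (nbr G v \<inter> leaves G)) = (\<Sum>w\<in>leaves G. card (nbr G w \<inter> (pverts G - leaves G)))"
  proof -
    have "(\<Sum>v\<in>pverts G - leaves G. card (nbr G v \<inter> leaves G)) =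
        card (SIGMA v:pverts G - leaves G. nbr G v \<inter> leaves G)"
      using fin finite_nbr[OF G] by (simp add: card_SigmaI)
    also have "\<dots> = card (SIGMA w:leaves G. nbr G w \<inter> (pverts G - leaves G))"
      by (rule bij_betw_same_card[of prod.swap], rule bij_betwI'[of _ prod.swap])
        (auto simp: nbr_def dest: pair_graph_symD[OF G])
    also have "\<dots> = (\<Sum>w\<in>leaves G. card (nbr G w \<inter> (pverts G - leaves G)))"
      using fin finite_nbr[OF G] by (simp add: card_SigmaI)
    finally show ?thesis .
  qed
  also have "\<dots> = (\<Sum>w\<in>leaves G. 1)"
  proof (intro sum.cong refl)
    fix w assume w: "w \<in> leaves G"
    then obtain x where x: "nbr G w = {x}" by (rule leaf_nbr)
    then have "(w, x) \<in> parcs G" by (auto simp: nbr_def)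
    then have "x \<notin> leaves G" "x \<in> pverts G"
      using leaves_not_adjacent[OF G conn n w] pair_graph_wf[OF G] by blast+
    then show "card (nbr G w \<inter> (pverts G - leaves G)) = 1" using x by simp
  qed
  finally have 1: "(\<Sum>v\<in>pverts G - leaves G. real (card (nbr G v \<inter> leaves G))) = real (card (leaves G))"
    by (simp flip: of_nat_sum)
  have "(\<Sum>v\<in>pverts (core G). real (deg (core G) v)) =
      (\<Sum>v\<in>pverts G - leaves G. real (deg G v) - real (card (nbr G v \<inter> leaves G)))"
    unfolding pv
  proof (intro sum.cong refl)
    fix v assume "v \<in> pverts G - leaves G"
    then have "deg (core G) v = card (nbr G v - nbr G v \<inter> leaves G)"
      using nb[of v] by (simp add: deg_nbr pv Diff_Int)
    then show "real (deg (core G) v) = real (deg G v) - real (card (nbr G v \<inter> leaves G))"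
      using finite_nbr[OF G, of v] card_mono[OF finite_nbr[OF G], of "nbr G v \<inter> leaves G" v]
      by (simp add: card_Diff_subset deg_nbr)
  qed
  also have "\<dots> = (\<Sum>v\<in>pverts G - leaves G. real (deg G v)) - real (card (leaves G))"
    by (simp add: sum_subtractf 1)
  also have "(\<Sum>v\<in>pverts G - leaves G. real (deg G v)) = (\<Sum>v\<in>pverts G. real (deg G v)) - (\<Sum>v\<in>leaves G. real (deg G v))"
    using fin by (simp add: sum_diff)
  also have "(\<Sum>v\<in>leaves G. real (deg G v)) = real (card (leaves G))"
    by (simp add: leaves_def)
  finally show "(\<Sum>v\<in>pverts (core G). real (deg (core G) v)) =
      (\<Sum>v\<in>pverts G. real (deg G v)) - 2 * real (card (leaves G))" by simp
qed

lemma tri_0_iff: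
  assumes G: "pair_graph G"
  shows "tri G = 0 \<longleftrightarrow> (\<forall>v w x. (v, w) \<in> parcs G \<longrightarrow> (w, x) \<in> parcs G \<longrightarrow> (x, v) \<notin> parcs G)"
proof -
  let ?S = "{(v, w, x). (v, w) \<in> parcs G \<and> (w, x) \<in> parcs G \<and> (x, v) \<in> parcs G}"
  have "?S \<subseteq> pverts G \<times> pverts G \<times> pverts G" using pair_graph_wf[OF G] by auto
  then have "finite ?S" using pair_graph_fin[OF G] by (simp add: finite_subset)
  then have "tri G = 0 \<longleftrightarrow> ?S = {}" unfolding tri_def by (rule card_0_eq)
  then show ?thesis by blast
qed

text \<open>A common neighbour of the two ends would close a triangle, so both degrees together
  count distinct vertices.\<close>

lemma triangle_free_arc_sum:
  assumes G: "pair_graph G" and t: "tri G = 0" and n: "card (pverts G) \<ge> 3" and conn: "conn G" 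
    and uv: "(u, v) \<in> parcs (core G)"
  shows "deg (core G) u + deg (core G) v \<le> card (pverts (core G))" 
    "nbr (core G) u \<inter> nbr (core G) v = {}"
proof -
  note cp = core_props[OF G conn n]
  have uvc: "u \<in> pverts (core G)" "v \<in> pverts (core G)" using pair_graph_wf[OF cp(1)] uv by blast+
  have uvG: "(u, v) \<in> parcs G" using uv by (simp add: core_def induced_def)
  show dis: "nbr (core G) u \<inter> nbr (core G) v = {}"
    unfolding cp(3)[OF uvc(1)] cp(3)[OF uvc(2)]
    using t uvG pair_graph_symD[OF G] unfolding tri_0_iff[OF G] nbr_def by blast
  have "deg (core G) u + deg (core G) v = card (nbr (core G) u \<union> nbr (core G) v)"
    unfolding deg_nbr using finite_nbr[OF cp(1)] dis by (simp add: card_Un_disjoint)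
  also have "\<dots> \<le> card (pverts (core G))"
    using nbr_subset[OF cp(1)] pair_graph_fin[OF cp(1)] by (intro card_mono) auto
  finally show "deg (core G) u + deg (core G) v \<le> card (pverts (core G))" .
qed

text \<open>Mantel's bound for the core, whose degree sum is known once the pendant vertices are
  counted.\<close>

lemma triangle_free_core_bound:
  assumes G: "pair_graph G" and t: "tri G = 0" and n: "card (pverts G) \<ge> 3" and conn: "conn G" 
  shows "2 * ((\<Sum>v\<in>pverts G. real (deg G v)) - 2 * real (card (leaves G))) \<le>
    real (card (pverts G) - card (leaves G)) ^ 2"
proof -
  note cp = core_props[OF G conn n]
  have "card (pverts (core G)) = card (pverts G) - card (leaves G)"
    unfolding cp(2) using pair_graph_fin[OF G] by (intro card_Diff_subset) (auto simp: leaves_def)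
  then show ?thesis
    using arc_degree_sum_bound[OF cp(1), of "real (card (pverts (core G)))"]
      triangle_free_arc_sum(1)[OF assms] cp(4) by (simp add: power2_eq_square flip: of_nat_add)
qed

text \<open>A triangle-free graph on five vertices with six edges is \<open>K\<^sub>2\<^sub>,\<^sub>3\<close>: by averaging, some edge has
  degree sum five, and the neighbourhoods of its ends form the bipartition.\<close>

lemma triangle_free_core_bipartite:
  assumes G: "pair_graph G" and t: "tri G = 0" and n: "card (pverts G) \<ge> 3" and conn: "conn G" 
    and five: "card (pverts G) = card (leaves G) + 5"
    and six: "(\<Sum>v\<in>pverts G. real (deg G v)) = 2 * real (card (leaves G)) + 12"
  obtains c where "\<And>v w. (v, w) \<in> parcs G \<Longrightarrow> c v \<noteq> (c w :: bool)"
proof -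
  note cp = core_props[OF G conn n]
  have c5: "card (pverts (core G)) = 5"
    unfolding cp(2) using five pair_graph_fin[OF G]
    by (subst card_Diff_subset) (auto simp: leaves_def)
  have "\<exists>u v. (u, v) \<in> parcs (core G) \<and> deg (core G) u + deg (core G) v \<ge> 5"
  proof (rule ccontr)
    assume *: "\<not> ?thesis"
    \<comment> \<open>If all degree sums were at most 4, the averaging bound would give 2 * 12 \<le>
      4 * 5.\<close>
    have "real (deg (core G) u) + real (deg (core G) v) \<le> 4" if "(u, v) \<in> parcs (core G)" for u v
    proof -
      have "deg (core G) u + deg (core G) v \<le> 4" using * that by force
      then show ?thesis by linarith
    qed
    from arc_degree_sum_bound[OF cp(1) this] show False unfolding cp(4) c5 six by simp
  qed
  then obtain u v where uv: "(u, v) \<in> parcs (core G)" "deg (core G) u + deg (core G) v \<ge> 5" by blast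
  have dis: "nbr (core G) u \<inter> nbr (core G) v = {}" by (rule triangle_free_arc_sum(2)[OF G t n conn uv(1)])
  have un: "nbr (core G) u \<union> nbr (core G) v = pverts (core G)"
  proof (rule card_seteq)
    show "finite (pverts (core G))" using pair_graph_fin[OF cp(1)] by simp
    show "nbr (core G) u \<union> nbr (core G) v \<subseteq> pverts (core G)" using nbr_subset[OF cp(1)] by blast
    show "card (pverts (core G)) \<le> card (nbr (core G) u \<union> nbr (core G) v)"
      using uv(2) finite_nbr[OF cp(1)] dis by (simp add: c5 card_Un_disjoint deg_nbr)
  qed
  have uvc: "u \<in> pverts (core G)" "v \<in> pverts (core G)" using pair_graph_wf[OF cp(1)] uv by blast+
  have sub: "nbr (core G) x \<subseteq> nbr G x" if "x \<in> pverts (core G)" for x using cp(3)[OF that] by blast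
  have indep: "(x, y) \<notin> parcs G" if "x \<in> nbr G z" "y \<in> nbr G z" for x y z
    using t that pair_graph_symD[OF G] unfolding tri_0_iff[OF G] nbr_def by blast
  \<comment> \<open>Core vertices are coloured by membership in the neighbourhood of
    \<open>u\<close>; a pendant vertex gets the colour opposite to that of its only
    neighbour.\<close>
  define c where "c x = (if x \<in> leaves G then \<forall>w\<in>nbr G x. w \<notin> nbr G u else x \<in> nbr G u)" for x
  have main: "c x \<noteq> c y" if xy: "(x, y) \<in> parcs G" "y \<notin> leaves G" for x y
  proof (cases "x \<in> leaves G")
    case True
    then obtain w where "nbr G x = {w}" by (rule leaf_nbr)
    then have "nbr G x = {y}" using xy(1) by (auto simp: nbr_def)
    then show ?thesis using True xy(2) by (simp add: c_def)
  next
    case False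
    then have xyc: "x \<in> pverts (core G)" "y \<in> pverts (core G)"
      unfolding cp(2) using pair_graph_wf[OF G xy(1)] xy(2) by auto
    have "\<not> (x \<in> nbr G u \<and> y \<in> nbr G u)" "\<not> (x \<in> nbr G v \<and> y \<in> nbr G v)"
      using indep xy(1) by blast+
    then have "x \<in> nbr G u \<longleftrightarrow> y \<notin> nbr G u"
      using xyc un sub[OF uvc(1)] sub[OF uvc(2)] by blast
    then show ?thesis using False xy(2) by (simp add: c_def)
  qed
  show thesis
  proof (rule that)
    fix x y assume xy: "(x, y) \<in> parcs G"
    show "c x \<noteq> c y"
    proof (cases "y \<in> leaves G")
      case True
      then have "x \<notin> leaves G" using leaves_not_adjacent[OF G conn n] xy by blast
      then show ?thesis using main[OF pair_graph_symD[OF G xy]] by simp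
    qed (rule main[OF xy])
  qed
qed

subsection \<open>Recognizing the theta graph\<close>

text \<open>The triangle is \<open>p\<close>, \<open>q\<close>, \<open>r\<close> and the five-cycle
  is \<open>p\<close>, \<open>q\<close>, \<open>q'\<close>, \<open>z\<close>, \<open>p'\<close>; the
  common edge joins \<open>p\<close> and \<open>q\<close>.\<close>

lemma theta_iso_aux:
  fixes B :: "'a pair_pre_digraph"
  assumes B: "pair_graph B" and V: "pverts B = {p, q, r, q', z, p'}"
    and dist: "distinct [p, q, r, q', z, p']"
    and nb: "nbr B p = {q, r, p'}" "nbr B q = {p, r, q'}" "nbr B r = {p, q}"
      "nbr B p' = {p, z}" "nbr B q' = {q, z}" "nbr B z = {p', q'}"
  shows "graph_iso B Theta_3_2_5"
proof -
  have T: "pair_graph Theta_3_2_5" using Theta_3_2_5_bicyclic by (simp add: bicyclic_def)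
  define f :: "'a \<Rightarrow> nat" where "f x = (if x = p then 0 else if x = q then 1 else if x = r then 2
    else if x = q' then 3 else if x = z then 4 else 5)" for x
  have f: "f p = 0" "f q = 1" "f r = 2" "f q' = 3" "f z = 4" "f p' = 5"
    using dist by (auto simp: f_def)
  have A: "parcs Theta_3_2_5 =
      {(0,1), (1,2), (2,0), (1,0), (2,1), (0,2), (1,3), (3,4), (4,5), (5,0), (3,1), (4,3), (5,4), (0,5)}"
    by (auto simp: Theta_3_2_5_def cycle_arcs_def)
  have arc: "(x, y) \<in> parcs B \<longleftrightarrow> y \<in> nbr B x" for x y by (simp add: nbr_def)
  have inj: "inj_on f (pverts B)" unfolding V using dist by (simp add: f)
  have "bij_betw f (pverts B) (pverts Theta_3_2_5)"
    unfolding bij_betw_def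
  proof
    show "inj_on f (pverts B)" by (rule inj)
    show "f ` pverts B = pverts Theta_3_2_5" unfolding V by (simp add: f Theta_3_2_5_def) 
  qed
  moreover have "(x, y) \<in> parcs B \<longleftrightarrow> (f x, f y) \<in> parcs Theta_3_2_5"
    if xy: "x \<in> pverts B" "y \<in> pverts B" for x y
  proof
    assume "(x, y) \<in> parcs B"
    then have y: "y \<in> nbr B x" by (simp add: nbr_def)
    have "x \<in> {p, q, r, q', z, p'}" using xy(1) unfolding V .
    then consider "x = p" | "x = q" | "x = r" | "x = q'" | "x = z" | "x = p'" by blast
    then show "(f x, f y) \<in> parcs Theta_3_2_5"
      using y by cases (simp_all add: nb, auto simp: A f)
  next
    assume "(f x, f y) \<in> parcs Theta_3_2_5"
    moreover have "parcs Theta_3_2_5 \<subseteq> (\<lambda>(x, y). (f x, f y)) ` parcs B"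
    proof -
      have "{(p, q), (q, r), (r, p), (q, p), (r, q), (p, r), (q, q'), (q', z), (z, p'), (p', p), (q', q),
          (z, q'), (p', z), (p, p')} \<subseteq> parcs B"
        by (simp add: arc nb)
      from image_mono[OF this, of "\<lambda>(x, y). (f x, f y)"] show ?thesis
        by (simp add: A f)
    qed
    ultimately obtain x' y' where x'y': "(x', y') \<in> parcs B" "f x' = f x" "f y' = f y" by auto
    then have "x' \<in> pverts B" "y' \<in> pverts B" using pair_graph_wf[OF B] by blast+
    then have "x' = x" "y' = y" using inj_onD[OF inj] x'y'(2,3) xy by blast+
    then show "(x, y) \<in> parcs B" using x'y' by simp
  qed
  ultimately show ?thesis unfolding graph_iso_iff[OF B T] by blast
qed

text \<open>Two vertices have degree 3, and the triangle is unique. If both lie on the triangle, the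
  other three vertices are forced to form a path joining them. If only one does, a bridge cuts off
  three vertices that would carry a second triangle.\<close>

lemma theta_iso:
  fixes B :: "'a pair_pre_digraph"
  assumes B: "pair_graph B" and conn: "conn B" and n: "card (pverts B) = 6"
    and deg: "\<And>v. v \<in> pverts B \<Longrightarrow> deg B v \<in> {2, 3}"
    and sum: "(\<Sum>v\<in>pverts B. deg B v) = 14" and tri: "tri B = 6"
  shows "graph_iso B Theta_3_2_5"
proof -
  let ?V = "pverts B"
  note sym = pair_graph_symD[OF B] and wf = pair_graph_wf[OF B]
  have fin: "finite ?V" using pair_graph_fin[OF B] by simp
  have adj: "(x, y) \<in> parcs B \<longleftrightarrow> y \<in> nbr B x" for x y by (simp add: nbr_def)
  define S where "S = {(v, w, x). (v, w) \<in> parcs B \<and> (w, x) \<in> parcs B \<and> (x, v) \<in> parcs B}"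
  have S6: "card S = 6" using tri by (simp add: tri_def S_def)
  then have "S \<noteq> {}" by auto
  then obtain p0 q0 r0 where t0: "(p0, q0) \<in> parcs B" "(q0, r0) \<in> parcs B" "(r0, p0) \<in> parcs B"
    by (auto simp: S_def)
  define T where "T = {p0, q0, r0}"
  have d0: "p0 \<noteq> q0" "q0 \<noteq> r0" "p0 \<noteq> r0" using t0 wf(3) by blast+
  have TV: "T \<subseteq> ?V" using t0 wf by (auto simp: T_def)
  have cT: "card T = 3" using d0 by (simp add: T_def)
  \<comment> \<open>The six orderings of one triangle exhaust \<open>S\<close>, so there is no other
    triangle.\<close>
  let ?P = "{(p0, q0, r0), (p0, r0, q0), (q0, p0, r0), (q0, r0, p0), (r0, p0, q0), (r0, q0, p0)}"
  have "?P \<subseteq> S" using t0 t0[THEN sym] by (simp add: S_def)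
  moreover have "card ?P = 6" using d0 by simp
  moreover have finS: "finite S" by (rule card_ge_0_finite) (simp add: S6)
  ultimately have SP: "S = ?P" using S6 card_subset_eq[OF finS, of ?P] by presburger
  have uniq: "v \<in> T" if t: "(v, w) \<in> parcs B" "(w, x) \<in> parcs B" "(x, v) \<in> parcs B" for v w x
  proof -
    have "(v, w, x) \<in> ?P" unfolding SP[symmetric] S_def using t by simp
    then show ?thesis unfolding T_def by (elim insertE emptyE) simp_all
  qed
  have TT: "(x, y) \<in> parcs B" if "x \<in> T" "y \<in> T" "x \<noteq> y" for x y
  proof -
    note a = t0 t0[THEN sym]
    show ?thesis using that unfolding T_def by (elim insertE emptyE) (simp_all add: a)
  qed
  have three: "card {v \<in> ?V. deg B v = 3} = 2"
  proof -
    have "(\<Sum>v\<in>?V. deg B v) = (\<Sum>v\<in>?V. 2 + (if deg B v = 3 then 1 else 0))"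
      using deg by (intro sum.cong) force+
    also have "\<dots> = 12 + card {v \<in> ?V. deg B v = 3}"
      using fin n by (simp only: sum.distrib) (simp add: sum.If_cases Int_def conj_commute)
    finally show ?thesis using sum by simp
  qed
  have ext: "nbr B x = (T - {x}) \<union> (nbr B x - T)" "card (nbr B x - T) + 2 = deg B x" if x: "x \<in> T" for x
  proof -
    have TX: "y \<in> nbr B x \<longleftrightarrow> y \<noteq> x" if "y \<in> T" for y
      using TT[OF x that] pair_graph_irrefl[OF B] by (auto simp: nbr_def)
    show eq: "nbr B x = (T - {x}) \<union> (nbr B x - T)" by (rule Set.set_eqI) (use TX in auto)
    have "card (nbr B x) = card (T - {x}) + card (nbr B x - T)"
      by (subst eq, rule card_Un_disjoint) (simp_all add: T_def finite_nbr[OF B] disjoint_iff)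
    moreover have "card (T - {x}) = 2" using x cT by simp
    ultimately show "card (nbr B x - T) + 2 = deg B x" by (simp add: deg_nbr)
  qed
  have main: "graph_iso B Theta_3_2_5"
    if T3: "T = {p, q, r}" "p \<noteq> q" "q \<noteq> r" "p \<noteq> r" and pq: "deg B p = 3" "deg B q = 3" for p q r
  proof -
    have pqrV: "p \<in> ?V" "q \<in> ?V" "r \<in> ?V" using TV T3 by auto
    have pqrT: "p \<in> T" "q \<in> T" "r \<in> T" using T3 by auto
    have "{p, q} \<subseteq> {v \<in> ?V. deg B v = 3}" using pq pqrV by auto
    then have D3: "{v \<in> ?V. deg B v = 3} = {p, q}"
      using three T3(2) fin by (intro card_subset_eq[symmetric]) auto
    have two: "deg B v = 2" if "v \<in> ?V" "v \<noteq> p" "v \<noteq> q" for v using deg[of v] D3 that by blast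
    have "card (nbr B p - T) = 1" "card (nbr B q - T) = 1" "card (nbr B r - T) = 0"
      using ext(2)[OF pqrT(1)] ext(2)[OF pqrT(2)] ext(2)[OF pqrT(3)] pq two[OF pqrV(3)] T3(3,4) by simp_all
    then obtain p' q' where p': "nbr B p - T = {p'}" and q': "nbr B q - T = {q'}" and r': "nbr B r - T = {}"
      using finite_nbr[OF B, of r] by (auto simp: card_1_singleton_iff)
    have np: "nbr B p = {q, r, p'}"
      using ext(1)[OF pqrT(1), unfolded p'] unfolding T3(1) using T3(2-4) by auto
    have nq: "nbr B q = {p, r, q'}"
      using ext(1)[OF pqrT(2), unfolded q'] unfolding T3(1) using T3(2-4) by auto
    have nr: "nbr B r = {p, q}"
      using ext(1)[OF pqrT(3), unfolded r'] unfolding T3(1) using T3(2-4) by auto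
    have p'T: "p' \<notin> T" "p' \<in> ?V" and q'T: "q' \<notin> T" "q' \<in> ?V"
      using p' q' nbr_subset[OF B] by blast+
    have p'p: "p \<in> nbr B p'" and q'q: "q \<in> nbr B q'"
      using np nq sym[of p p'] sym[of q q'] by (auto simp: nbr_def)
    have Tout: "x = p \<and> y = p' \<or> x = q \<and> y = q'" if "x \<in> T" "y \<in> nbr B x" "y \<notin> T" for x y
      using that np nq nr T3 by auto
    have out: "x = p \<and> y = p' \<or> x = q \<and> y = q'" if "x \<in> T" "x \<in> nbr B y" "y \<notin> T" for x y
    proof -
      have "y \<in> nbr B x" using that(2) sym by (auto simp: nbr_def)
      then show ?thesis using Tout that by blast
    qed
    \<comment> \<open>With a common outer neighbour, the triangle and that vertex would be closed
      under arcs: four vertices instead of six.\<close>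
    have pq': "p' \<noteq> q'"
    proof
      assume eq: "p' = q'"
      have "{p, q} \<subseteq> nbr B p'" using p'p q'q eq by auto
      moreover have "card (nbr B p') = 2" using two[OF p'T(2)] p'T(1) T3 by (auto simp: deg_nbr)
      ultimately have "nbr B p' = {p, q}"
        using T3(2) finite_nbr[OF B, of p'] by (intro card_subset_eq[symmetric]) auto
      then have np': "nbr B p' = {p, q}" .
      have "y \<in> {p, q, r, p'}" if xy: "(x, y) \<in> parcs B" "x \<in> {p, q, r, p'}" for x y
      proof -
        have y: "y \<in> nbr B x" using xy(1) by (simp add: nbr_def)
        consider "x = p" | "x = q" | "x = r" | "x = p'" using xy(2) by blast
        then show ?thesis using y by cases (simp_all add: np nq nr np', simp_all add: eq, auto)
      qed
      then have "\<forall>(x, y)\<in>parcs B. x \<in> {p, q, r, p'} \<longrightarrow> y \<in> {p, q, r, p'}" by fast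
      moreover have "{p, q, r, p'} \<subseteq> ?V" using pqrV p'T by auto
      ultimately have "{p, q, r, p'} = ?V" using conn unfolding conn_def by blast
      moreover have "card {p, q, r, p'} \<le> 4" by (simp add: card_insert_if)
      ultimately show False using n by simp
    qed
    have "card (?V - {p, q, r, p', q'}) = 1"
      using pqrV p'T q'T pq' T3 fin n by (subst card_Diff_subset) auto
    then obtain z where z: "?V - {p, q, r, p', q'} = {z}" by (auto simp: card_1_singleton_iff)
    then have V: "?V = {p, q, r, q', z, p'}" using pqrV p'T q'T by auto
    have zn: "z \<notin> {p, q, r, p', q'}" "z \<in> ?V" using z by auto
    have dist: "distinct [p, q, r, q', z, p']" using T3 p'T q'T pq' zn by auto
    have c2: "card (nbr B p') = 2" "card (nbr B q') = 2" "card (nbr B z) = 2"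
      using two[OF p'T(2)] two[OF q'T(2)] two[OF zn(2)] dist by (auto simp: deg_nbr)
    have zT: "z \<notin> T" using zn T3 by auto
    have nzsub: "nbr B z \<subseteq> {p', q'}"
    proof
      fix y assume y: "y \<in> nbr B z"
      have "y \<notin> T" using out[of y z] y zT zn by blast
      moreover have "y \<noteq> z" using y wf(3) by (auto simp: nbr_def)
      moreover have "y \<in> ?V" using y nbr_subset[OF B] by blast
      ultimately show "y \<in> {p', q'}" unfolding V T3 by auto
    qed
    then have nz: "nbr B z = {p', q'}" using c2 pq' by (intro card_subset_eq) auto
    then have zz: "z \<in> nbr B p'" "z \<in> nbr B q'" using sym[of z p'] sym[of z q'] by (auto simp: nbr_def)
    have pz: "{p, z} \<subseteq> nbr B p'" and qz: "{q, z} \<subseteq> nbr B q'" using zz p'p q'q by auto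
    have "nbr B p' = {p, z}" "nbr B q' = {q, z}"
      using card_subset_eq[OF finite_nbr[OF B] pz] card_subset_eq[OF finite_nbr[OF B] qz] c2 dist by simp_all
    then show ?thesis by (intro theta_iso_aux[OF B V dist np nq nr _ _ nz])
  qed
  have "\<exists>x\<in>T. \<exists>y. y \<in> nbr B x \<and> y \<notin> T"
  proof (rule ccontr)
    assume "\<not> ?thesis"
    then have "\<forall>(x, y)\<in>parcs B. x \<in> T \<longrightarrow> y \<in> T" by (auto simp: nbr_def)
    then have "T = ?V" using conn TV cT unfolding conn_def by (metis card.empty zero_neq_numeral)
    then show False using cT n by simp
  qed
  then obtain p y where p: "p \<in> T" "y \<in> nbr B p" "y \<notin> T" by blast
  have card0: "card (nbr B p - T) \<noteq> 0" using p finite_nbr[OF B, of p] by auto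
  then have dp: "deg B p = 3" using ext(2)[OF p(1)] deg[of p] p(1) TV by auto
  obtain q r where T3: "T = {p, q, r}" "p \<noteq> q" "q \<noteq> r" "p \<noteq> r"
  proof -
    consider "p = p0" | "p = q0" | "p = r0" using p(1) by (auto simp: T_def)
    then show thesis
      by cases (use that[of q0 r0] that[of p0 r0] that[of p0 q0] d0 in \<open>auto simp: T_def\<close>)
  qed
  show ?thesis
  proof (cases "deg B q = 3 \<or> deg B r = 3")
    case True
    then show ?thesis
    proof
      assume "deg B q = 3" then show ?thesis using main[OF T3] dp by blast
    next
      assume "deg B r = 3"
      moreover have "T = {p, r, q}" using T3 by auto
      ultimately show ?thesis using main[of p r q] T3 dp by blast
    qed
  next
    case False
    \<comment> \<open>Now \<open>y\<close> is the only exit from the triangle. The two vertices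
      \<open>a\<close> and \<open>b\<close> beyond it have degree at least 2, so \<open>y\<close>,
      \<open>a\<close>, \<open>b\<close> form a triangle, against uniqueness.\<close>
    have pqrV: "q \<in> ?V" "r \<in> ?V" and qrT: "q \<in> T" "r \<in> T" using TV T3 by auto
    have "deg B q = 2" "deg B r = 2" using False deg pqrV by auto
    then have "card (nbr B q - T) = 0" "card (nbr B r - T) = 0" using ext(2)[OF qrT(1)] ext(2)[OF qrT(2)] by auto
    then have q0: "nbr B q - T = {}" and r0: "nbr B r - T = {}"
      using finite_nbr[OF B, of q] finite_nbr[OF B, of r] by simp_all
    have "card (nbr B p - T) = 1" using ext(2)[OF p(1)] dp by simp
    then obtain y1 where y1: "nbr B p - T = {y1}" unfolding card_1_singleton_iff One_nat_def by (elim exE)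
    moreover have "y \<in> nbr B p - T" using p by simp
    ultimately have py: "nbr B p - T = {y}" by simp
    have Uout: "y' = y" if "x \<in> T" "(x, y') \<in> parcs B" "y' \<notin> T" for x y'
    proof -
      have "y' \<in> nbr B x - T" using that by (simp add: nbr_def)
      moreover have "x = p \<or> x = q \<or> x = r" using that(1) unfolding T3(1) by simp
      ultimately show ?thesis using py q0 r0 by (elim disjE) simp_all
    qed
    have yV: "y \<in> ?V" using p nbr_subset[OF B] by blast
    have "card (?V - insert y T) = 2"
      using TV yV p(3) fin n cT by (subst card_Diff_subset) (auto simp: T_def)
    then obtain a b where ab0: "?V - insert y T = {a, b}" and "a \<noteq> b" unfolding card_2_iff by (elim exE conjE)
    have "a \<in> ?V - insert y T" "b \<in> ?V - insert y T" unfolding ab0 by simp_all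
    then have ab: "a \<in> ?V" "a \<noteq> y" "a \<notin> T" "b \<in> ?V" "b \<noteq> y" "b \<notin> T" by simp_all
    have ex: "w \<in> {y, a, b}" if "w \<in> ?V" "w \<notin> T" for w
    proof (cases "w = y")
      case False
      then have "w \<in> ?V - insert y T" using that by simp
      then show ?thesis unfolding ab0 by simp
    qed simp
    have sub: "nbr B c \<subseteq> {y, a, b} - {c}" if c: "c \<in> {a, b}" for c
    proof
      fix w assume w: "w \<in> nbr B c"
      have "c \<notin> T" "c \<noteq> y" using ab c by auto
      then have "w \<notin> T" using Uout[of w c] w sym by (auto simp: nbr_def)
      moreover have "w \<in> ?V" using w nbr_subset[OF B] by blast
      moreover have "w \<noteq> c" using w wf(3) by (auto simp: nbr_def)
      ultimately show "w \<in> {y, a, b} - {c}" using ex by simp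
    qed
    have c2: "card (nbr B c) \<ge> 2" if "c \<in> {a, b}" for c
    proof -
      have "c \<in> ?V" using that ab by auto
      then show ?thesis using deg[of c] by (auto simp: deg_nbr)
    qed
    have "nbr B a = {y, b}" "nbr B b = {y, a}"
    proof -
      have yab: "y \<noteq> a" "y \<noteq> b" using ab by auto
      have "nbr B a \<subseteq> {y, b}" "nbr B b \<subseteq> {y, a}" using sub[of a] sub[of b] by auto
      then show "nbr B a = {y, b}" "nbr B b = {y, a}"
        using c2[of a] c2[of b] yab card_seteq[of "{y, b}" "nbr B a"] card_seteq[of "{y, a}" "nbr B b"]
        by simp_all
    qed
    then have "b \<in> nbr B a" "y \<in> nbr B b" "y \<in> nbr B a" by simp_all
    then have "(a, b) \<in> parcs B" "(b, y) \<in> parcs B" "(y, a) \<in> parcs B"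
      using sym[of a y] by (simp_all add: nbr_def)
    then have "a \<in> T" by (rule uniq)
    then show ?thesis using ab(3) by simp
  qed
qed

subsection \<open>Bicyclic graphs with the spectrum of a join\<close>

text \<open>Newton's identities give the elementary symmetric functions 6, 12 - k and 8 - 2k + 2e;
  shifted by 2, the three numbers are the roots of y^3 = k y + 2e. The product serves the
  divisibility argument. The last bound holds because the shifted numbers have sum 0 and their
  squares have sum 2k.\<close>

lemma three_roots:
  fixes a b d k e :: real
  assumes 1: "a + b + d = 6" and 2: "a ^ 2 + b ^ 2 + d ^ 2 = 12 + 2 * k"
    and 3: "a ^ 3 + b ^ 3 + d ^ 3 = 24 + 12 * k + 6 * e"
  shows "(1 + a) * ((1 + b) * (1 + d)) = 27 - 3 * k + 2 * e"
    and "(a - 2) ^ 3 = k * (a - 2) + 2 * e"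
    and "3 * (a - 2) ^ 2 \<le> 4 * k"
proof -
  note ex = power2_eq_square power3_eq_cube algebra_simps
  have abd: "a * b * d = 8 - 2 * k + 2 * e"
  proof -
    have "6 * (a * b * d) = (a + b + d) ^ 3 - 3 * (a + b + d) * (a ^ 2 + b ^ 2 + d ^ 2) + 2 * (a ^ 3 + b ^ 3 + d ^ 3)"
      by (simp add: ex)
    then show ?thesis unfolding 1 2 3 by simp
  qed
  have s2: "a * b + b * d + a * d = 12 - k"
  proof -
    have "2 * (a * b + b * d + a * d) = (a + b + d) ^ 2 - (a ^ 2 + b ^ 2 + d ^ 2)" by (simp add: ex)
    then show ?thesis unfolding 1 2 by simp
  qed
  have "(1 + a) * ((1 + b) * (1 + d)) = 1 + (a + b + d) + (a * b + b * d + a * d) + a * b * d"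
    by (simp add: ex)
  then show "(1 + a) * ((1 + b) * (1 + d)) = 27 - 3 * k + 2 * e" unfolding 1 s2 abd by simp
  have "a ^ 3 = (a + b + d) * a ^ 2 - (a * b + b * d + a * d) * a + a * b * d" by (simp add: ex)
  then have a3: "a ^ 3 = 6 * a ^ 2 - (12 - k) * a + (8 - 2 * k + 2 * e)" unfolding 1 s2 abd .
  have "(a - 2) ^ 3 = a ^ 3 - 6 * a ^ 2 + 12 * a - 8" by (simp add: ex)
  then show "(a - 2) ^ 3 = k * (a - 2) + 2 * e" unfolding a3 by (simp add: algebra_simps)
  define y z w where "y = a - 2" and "z = b - 2" and "w = d - 2"
  have s: "y = - (z + w)" using 1 by (simp add: y_def z_def w_def)
  have "y\<^sup>2 + (z\<^sup>2 + w\<^sup>2) = (a ^ 2 + b ^ 2 + d ^ 2) - 4 * (a + b + d) + 12"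
    unfolding y_def z_def w_def by (simp add: ex)
  then have t: "y\<^sup>2 + (z\<^sup>2 + w\<^sup>2) = 2 * k" unfolding 1 2 by simp
  have "0 \<le> (z - w)\<^sup>2" by simp
  also have "\<dots> = 2 * (z\<^sup>2 + w\<^sup>2) - y\<^sup>2" unfolding s by (simp add: ex)
  finally have "0 \<le> 2 * (z\<^sup>2 + w\<^sup>2) - y\<^sup>2" .
  moreover have "4 * k = 2 * (y\<^sup>2 + (z\<^sup>2 + w\<^sup>2))" unfolding t by simp
  ultimately have "3 * y\<^sup>2 \<le> 4 * k" by (simp add: algebra_simps)
  then show "3 * (a - 2) ^ 2 \<le> 4 * k" by (simp only: y_def)
qed

text \<open>The later estimates choose coefficients for which the cubic has one sign, or few nonzero
  values, at the possible degrees; the moments then evaluate its sum.\<close>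

lemma sum_cubic_deg:
  fixes G :: "'a pair_pre_digraph"
  assumes "finite (pverts G)"
  shows "(\<Sum>v\<in>pverts G. \<alpha> * int (deg G v) ^ 3 + \<beta> * int (deg G v) ^ 2 + \<gamma> * int (deg G v) + \<delta>) =
    \<alpha> * (\<Sum>v\<in>pverts G. int (deg G v) ^ 3) + \<beta> * (\<Sum>v\<in>pverts G. int (deg G v) ^ 2) +
    \<gamma> * (\<Sum>v\<in>pverts G. int (deg G v)) + \<delta> * int (card (pverts G))"
  using assms by (simp add: sum.distrib sum_distrib_left)

text \<open>The strict eigenvalue bound is available unless \<open>v\<close> is adjacent to all
  other vertices, and then the weak bound already reaches the number of vertices.\<close>

lemma max_degree_bound:
  assumes G: "pair_graph G" and conn: "conn G" and n: "card (pverts G) \<ge> 2"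
    and R: "\<And>x. x \<in># spec G \<Longrightarrow> x \<le> R" and v: "v \<in> pverts G"
  shows "real (deg G v) + 1 < R \<or> deg G v + 1 = card (pverts G) \<and> real (card (pverts G)) \<le> R"
proof (cases "deg G v + 2 \<le> card (pverts G)")
  case True
  then show ?thesis using ex_spec_gt_deg[OF G conn v] R by force
next
  case False
  then have *: "deg G v + 1 = card (pverts G)" using deg_complement(2)[OF G v] n by linarith
  obtain x where "x \<in># spec G" "x \<ge> real (deg G v) + 1"
    using ex_spec_ge_deg[OF G v conn_deg_pos[OF G conn n v]] by blast
  then have "real (deg G v + 1) \<le> R" using R[of x] by simp
  then show ?thesis using * by metis
qed

text \<open>The spectrum fixes the first two degree moments and the third up to the number of
  triangles. For \<open>n\<close> at most 6 the quadratic \<open>(d - 2) * (d - 3)\<close> restricts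
  \<open>k\<close>; for larger \<open>n\<close> a cubic exploits the degree bound
  \<open>n - 4\<close>.\<close>

theorem theta_of_spec:
  fixes B :: "'a pair_pre_digraph" and k e :: int
  defines "n \<equiv> card (pverts B)"
  assumes B: "pair_graph B" and conn: "conn B" and n5: "n \<ge> 5"
    and S1: "(\<Sum>v\<in>pverts B. int (deg B v)) = 2 * int n + 2"
    and ke: "(k, e) \<in> {(0, 0), (1, 0), (2, 0), (3, 1), (3, - 1)}"
    and abd: "a + b + d = 6" "a ^ 2 + b ^ 2 + d ^ 2 = 12 + 2 * real_of_int k"
      "a ^ 3 + b ^ 3 + d ^ 3 = 24 + 12 * real_of_int k + 6 * real_of_int e"
    and sp: "spec B = {#0, real n - 2, 1 + a, 1 + b, 1 + d#} + replicate_mset (n - 5) 1"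
    and nn: "real n \<notin># spec B"
  shows "graph_iso B Theta_3_2_5"
proof -
  let ?V = "pverts B"
  have fin: "finite ?V" using pair_graph_fin[OF B] by simp
  define s2 where "s2 = (\<Sum>v\<in>?V. int (deg B v) ^ 2)"
  define s3 where "s3 = (\<Sum>v\<in>?V. int (deg B v) ^ 3)"
  define N where "N = int n"
  have S1r: "(\<Sum>v\<in>?V. real (deg B v)) = 2 * real n + 2"
    using arg_cong[OF S1, of real_of_int] by simp
  have S2: "s2 = N\<^sup>2 - 5 * N + 24 + 2 * k"
  proof -
    have "real_of_int s2 = real_of_int (N\<^sup>2 - 5 * N + 24 + 2 * k)"
    proof -
      have "(real n - 2) ^ 2 + ((1 + a) ^ 2 + (1 + b) ^ 2 + (1 + d) ^ 2) + (real n - 5) = real_of_int s2 + (2 * real n + 2)"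
        using spec_sum_sq[OF B] n5 unfolding sp S1r by (simp add: s2_def algebra_simps)
      moreover have "(1 + a) ^ 2 + (1 + b) ^ 2 + (1 + d) ^ 2 = 3 + 2 * (a + b + d) + (a ^ 2 + b ^ 2 + d ^ 2)"
        by (simp add: power2_eq_square algebra_simps)
      ultimately show ?thesis unfolding abd by (simp add: N_def power2_eq_square algebra_simps)
    qed
    then show ?thesis unfolding of_int_eq_iff .
  qed
  have S3: "s3 - int (tri B) = N ^ 3 - 9 * N\<^sup>2 + 28 * N - 4 + 12 * k + 6 * e"
  proof -
    have "real_of_int (s3 - int (tri B)) = real_of_int (N ^ 3 - 9 * N\<^sup>2 + 28 * N - 4 + 12 * k + 6 * e)"
    proof -
      have "(real n - 2) ^ 3 + ((1 + a) ^ 3 + (1 + b) ^ 3 + (1 + d) ^ 3) + (real n - 5) =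
          real_of_int s3 + 3 * real_of_int s2 - real (tri B)"
        using spec_sum_cube[OF B] n5 unfolding sp by (simp add: s2_def s3_def algebra_simps)
      moreover have "(1 + a) ^ 3 + (1 + b) ^ 3 + (1 + d) ^ 3 =
          3 + 3 * (a + b + d) + 3 * (a ^ 2 + b ^ 2 + d ^ 2) + (a ^ 3 + b ^ 3 + d ^ 3)"
        by (simp add: power2_eq_square power3_eq_cube algebra_simps)
      ultimately show ?thesis unfolding abd S2
        by (simp add: N_def power2_eq_square power3_eq_cube algebra_simps)
    qed
    then show ?thesis unfolding of_int_eq_iff .
  qed
  \<comment> \<open>The product of the nonzero eigenvalues is an integer multiple of
    \<open>n\<close>. This removes several cases that the degree estimates leave open.\<close>
  have dvd: "N dvd (N - 2) * (27 - 3 * k + 2 * e)"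
  proof -
    have ne: "?V \<noteq> {}" using n5 by (auto simp: n_def)
    obtain c :: int where c: "prod_mset (spec B - {#0#}) = real n * of_int c"
      using conn_prod_spec_dvd[OF B conn ne] unfolding n_def by blast
    have "prod_mset (spec B - {#0#}) = (real n - 2) * ((1 + a) * ((1 + b) * (1 + d)))"
      unfolding sp by simp
    then have "real_of_int ((N - 2) * (27 - 3 * k + 2 * e)) = real_of_int (N * c)"
      using c unfolding three_roots(1)[OF abd] by (simp add: N_def)
    then have "(N - 2) * (27 - 3 * k + 2 * e) = N * c" unfolding of_int_eq_iff .
    then show ?thesis by simp
  qed
  have perm: "b + a + d = 6" "b ^ 2 + a ^ 2 + d ^ 2 = 12 + 2 * real_of_int k"
      "b ^ 3 + a ^ 3 + d ^ 3 = 24 + 12 * real_of_int k + 6 * real_of_int e"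
      "d + a + b = 6" "d ^ 2 + a ^ 2 + b ^ 2 = 12 + 2 * real_of_int k"
      "d ^ 3 + a ^ 3 + b ^ 3 = 24 + 12 * real_of_int k + 6 * real_of_int e"
    using abd by simp_all
  have root: "(x - 2) ^ 3 = k * (x - 2) + 2 * e" "3 * (x - 2)\<^sup>2 \<le> 4 * k" if "x \<in> {a, b, d}" for x :: real
    using three_roots(2,3)[OF abd] three_roots(2,3)[OF perm(1-3)] three_roots(2,3)[OF perm(4-6)] that by auto
  have le4: "x \<le> 4" if x: "x \<in> {a, b, d}" for x
  proof -
    have "real_of_int k \<le> 3" using ke by auto
    then have "(x - 2)\<^sup>2 \<le> 2\<^sup>2" using root(2)[OF x] by simp
    then show ?thesis using abs_le_square_iff[of "x - 2" 2] by simp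
  qed
  have specle: "x \<le> R" if "real n - 2 \<le> R" "0 \<le> R" "1 \<le> R" "\<And>y. y \<in> {a, b, d} \<Longrightarrow> y + 1 \<le> R" "x \<in># spec B" for x R
    using that(1-3,5) that(4)[of a] that(4)[of b] that(4)[of d] unfolding sp by (auto split: if_splits)
  have dpos: "deg B v \<ge> 1" if "v \<in> ?V" for v
    by (rule conn_deg_pos[OF B conn _ that]) (use n5 in \<open>simp add: n_def\<close>)
  have n2: "card ?V \<ge> 2" "card ?V \<ge> 3" using n5 by (auto simp: n_def)
  note cub = sum_cubic_deg[OF fin, folded s2_def s3_def, unfolded S1, folded n_def, folded N_def]
  \<comment> \<open>A product of two consecutive integers is nonnegative. The sum equals
    \<open>(N - 2) * (N - 7) + 2 * k\<close>, which forces \<open>k \<ge> 3\<close> for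
    \<open>N = 5\<close> and \<open>k \<ge> 2\<close> for \<open>N = 6\<close>.\<close>
  have low: "0 \<le> s2 - 5 * (2 * N + 2) + 6 * N"
  proof -
    have "0 \<le> (int (deg B v) - 2) * (int (deg B v) - 3)" for v
    proof (cases "deg B v \<le> 2")
      case True then show ?thesis by (intro mult_nonpos_nonpos) auto
    qed (intro mult_nonneg_nonneg, auto)
    then have "0 \<le> (\<Sum>v\<in>?V. 0 * int (deg B v) ^ 3 + 1 * int (deg B v) ^ 2 + (- 5) * int (deg B v) + 6)"
      by (intro sum_nonneg) (simp add: power2_eq_square algebra_simps)
    then show ?thesis unfolding cub by simp
  qed
  have small: False if R: "\<And>v. v \<in> ?V \<Longrightarrow> deg B v \<le> 2"
  proof -
    have "(\<Sum>v\<in>?V. int (deg B v)) \<le> (\<Sum>v\<in>?V. 2)" using R by (intro sum_mono) force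
    then show False unfolding S1 by (simp add: n_def)
  qed
  \<comment> \<open>If \<open>F\<close> is a triangle, the shifted cubic is
    \<open>(y - 1)^2 * (y + 2)\<close>, with largest root 1.\<close>
  have neg: "x + 1 \<le> 4" if "k = 3" "e = - 1" "x \<in> {a, b, d}" for x
  proof (rule ccontr)
    assume "\<not> ?thesis"
    then have y: "x - 2 > 1" by simp
    have "(x - 2) ^ 3 = 3 * (x - 2) - 2" using root(1)[OF that(3)] that by simp
    then have "(x - 2 - 1)\<^sup>2 * (x - 2 + 2) = 0" by (simp add: power2_eq_square power3_eq_cube algebra_simps)
    then show False using y by simp
  qed
  have deg_le: "real (deg B v) + 1 < R" if "v \<in> ?V" "R < real n" "\<And>x. x \<in># spec B \<Longrightarrow> x \<le> R" for v R
    using max_degree_bound[OF B conn n2(1) that(3,1)] that(2) by (auto simp: n_def)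
  \<comment> \<open>The polynomial \<open>(d - 2) * (d - 3)\<close> is 2 at 1 and 0 at 2 and 3, so
    its sum counts the pendant vertices.\<close>
  have leaves_count: "2 * int (card (leaves B)) = s2 - 5 * (2 * N + 2) + 6 * N"
    if "\<And>v. v \<in> ?V \<Longrightarrow> deg B v \<le> 3"
  proof -
    have "(\<Sum>v\<in>?V. 0 * int (deg B v) ^ 3 + 1 * int (deg B v) ^ 2 + (- 5) * int (deg B v) + 6) =
        (\<Sum>v\<in>?V. if deg B v = 1 then 2 else 0)"
    proof (intro sum.cong refl)
      fix v assume v: "v \<in> ?V"
      have "deg B v = 1 \<or> deg B v = 2 \<or> deg B v = 3" using dpos[OF v] that[OF v] by linarith
      then show "0 * int (deg B v) ^ 3 + 1 * int (deg B v) ^ 2 + (- 5) * int (deg B v) + 6 =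
          (if deg B v = 1 then 2 else 0)" by auto
    qed
    also have "\<dots> = 2 * int (card (leaves B))"
      using fin by (simp add: sum.If_cases leaves_def Int_def)
    finally show ?thesis unfolding cub by simp
  qed
  \<comment> \<open>\<open>(d - 1) * (d - 2) * (d - 3)\<close> vanishes at all possible degrees;
    this gives the third moment and thereby the number of triangles.\<close>
  have s3_small: "s3 = 6 * s2 - 11 * (2 * N + 2) + 6 * N" if "\<And>v. v \<in> ?V \<Longrightarrow> deg B v \<le> 3"
  proof -
    have "(\<Sum>v\<in>?V. 1 * int (deg B v) ^ 3 + (- 6) * int (deg B v) ^ 2 + 11 * int (deg B v) + (- 6)) = 0"
    proof (intro sum.neutral ballI)
      fix v assume v: "v \<in> ?V"
      have "deg B v = 1 \<or> deg B v = 2 \<or> deg B v = 3" using dpos[OF v] that[OF v] by linarith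
      then show "1 * int (deg B v) ^ 3 + (- 6) * int (deg B v) ^ 2 + 11 * int (deg B v) + (- 6) = 0" by auto
    qed
    then show ?thesis unfolding cub by simp
  qed
  \<comment> \<open>The core has five vertices and six edges, so \<open>B\<close> is bipartite, and
    its second degree moment is too large for a spectrum bounded by 5.\<close>
  have bip: False
    if t0: "tri B = 0" and five: "card ?V = card (leaves B) + 5" and six: "2 * N + 2 = 2 * int (card (leaves B)) + 12"
      and le5: "\<And>x. x \<in># spec B \<Longrightarrow> x \<le> 5" and big: "2 * s2 > 5 * (2 * N + 2)"
  proof -
    have "(\<Sum>v\<in>?V. real (deg B v)) = 2 * real (card (leaves B)) + 12"
      using arg_cong[OF six, of real_of_int] unfolding S1r by (simp add: N_def)
    then obtain c where c: "\<And>v w. (v, w) \<in> parcs B \<Longrightarrow> c v \<noteq> (c w :: bool)"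
      using triangle_free_core_bipartite[OF B t0 n2(2) conn five] by metis
    have "2 * real_of_int s2 \<le> 5 * (2 * real n + 2)"
      using bipartite_spec_bound[OF B c le5] unfolding S1r by (simp add: s2_def)
    then have "real_of_int (2 * s2) \<le> real_of_int (5 * (2 * N + 2))" by (simp add: N_def)
    then show False using big by linarith
  qed
  consider "n = 5" | "n = 6" | "n \<ge> 7" using n5 by linarith
  then show ?thesis
  proof cases
    case 1
    then have N5: "N = 5" by (simp add: N_def)
    have "k \<ge> 3" using low unfolding S2 N5 by simp
    then have k3: "k = 3" and "e = 1 \<or> e = - 1" using ke by auto
    then show ?thesis
    proof (elim disjE)
      \<comment> \<open>For the star the shifted roots are 2, -1, -1, so \<open>1 + 4 = n\<close>
        would be an eigenvalue.\<close>
      assume e: "e = 1"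
      have "x - 2 = 2 \<or> x - 2 = - 1" if "x \<in> {a, b, d}" for x
      proof -
        have "(x - 2) ^ 3 = 3 * (x - 2) + 2" using root(1)[OF that] k3 e by simp
        then have "(x - 2 - 2) * (x - 2 + 1)\<^sup>2 = 0" by (simp add: power2_eq_square power3_eq_cube algebra_simps)
        then show ?thesis by auto
      qed
      from this[of a] this[of b] this[of d] have "a = 4 \<or> b = 4 \<or> d = 4" using abd(1) by auto
      then have "real n \<in># spec B" unfolding sp using 1 by auto
      then show ?thesis using nn by simp
    next
      assume e: "e = - 1"
      have "x \<le> 4" if "x \<in># spec B" for x
        using specle[of 4 x] that neg k3 e 1 by auto
      then have "real (deg B v) + 1 < 4" if "v \<in> ?V" for v using deg_le[OF that, of 4] 1 by simp
      then have "deg B v \<le> 2" if "v \<in> ?V" for v using that by force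
      then show ?thesis using small by blast
    qed
  next
    case 2
    then have N6: "N = 6" by (simp add: N_def)
    have "k \<ge> 2" using low unfolding S2 N6 by simp
    then consider "k = 2" "e = 0" | "k = 3" "e = 1" | "k = 3" "e = - 1" using ke by auto
    then show ?thesis
    proof cases
      case 1
      \<comment> \<open>The quadratic estimate is an equality here, so all degrees are 2 or 3; this
        case yields the theta graph.\<close>
      have s2: "s2 = 34" unfolding S2 N6 1 by simp
      have nonneg: "0 \<le> (int (deg B v) - 2) * (int (deg B v) - 3)" for v
      proof (cases "deg B v \<le> 2")
        case True then show ?thesis by (intro mult_nonpos_nonpos) auto
      qed (intro mult_nonneg_nonneg, auto)
      have "(\<Sum>v\<in>?V. (int (deg B v) - 2) * (int (deg B v) - 3)) =
          (\<Sum>v\<in>?V. 0 * int (deg B v) ^ 3 + 1 * int (deg B v) ^ 2 + (- 5) * int (deg B v) + 6)"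
        by (intro sum.cong refl) (simp add: power2_eq_square algebra_simps)
      also have "\<dots> = 0" unfolding cub s2 N6 by simp
      finally have "\<forall>v\<in>?V. (int (deg B v) - 2) * (int (deg B v) - 3) = 0"
        using sum_nonneg_eq_0_iff[OF fin, of "\<lambda>v. (int (deg B v) - 2) * (int (deg B v) - 3)"] nonneg by simp
      then have d23: "deg B v \<in> {2, 3}" if "v \<in> ?V" for v using that by force
      then have "deg B v \<le> 3" if "v \<in> ?V" for v using that by force
      then have "s3 = 86" using s3_small unfolding s2 N6 by simp
      then have "tri B = 6" using S3 unfolding N6 1 by simp
      moreover have "int (\<Sum>v\<in>?V. deg B v) = int 14" using S1 2 by simp
      then have "(\<Sum>v\<in>?V. deg B v) = 14" by (simp only: of_nat_eq_iff)
      ultimately show ?thesis using theta_iso[OF B conn _ d23] 2 by (simp add: n_def)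
    next
      case k: 2
      have le5: "x \<le> 5" if "x \<in># spec B" for x
        using specle[of 5 x] that le4 2 by auto
      then have "real (deg B v) + 1 < 5" if "v \<in> ?V" for v using deg_le[OF that, of 5] 2 by simp
      then have d3: "deg B v \<le> 3" if "v \<in> ?V" for v using that by force
      have s2: "s2 = 36" unfolding S2 N6 k by simp
      have l: "card (leaves B) = 1" using leaves_count[OF d3] unfolding s2 N6 by simp
      have "s3 = 98" using s3_small[OF d3] unfolding s2 N6 by simp
      then have "tri B = 0" using S3 unfolding N6 k by simp
      then show ?thesis using bip[OF _ _ _ le5] l 2 s2 N6 by (simp add: n_def)
    next
      case k: 3
      have "x \<le> 4" if "x \<in># spec B" for x
        using specle[of 4 x] that neg k 2 by auto
      then have "real (deg B v) + 1 < 4" if "v \<in> ?V" for v using deg_le[OF that, of 4] 2 by simp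
      then have "deg B v \<le> 2" if "v \<in> ?V" for v using that by force
      then show ?thesis using small by blast
    qed
  next
    case 3
    have le: "x \<le> real n - 2" if "x \<in># spec B" for x
      using specle[of "real n - 2" x] that le4 3 by force
    have "real (deg B v) + 1 < real n - 2" if "v \<in> ?V" for v using deg_le[OF that _ le] by simp
    then have dn: "int (deg B v) \<le> N - 4" if "v \<in> ?V" for v using that by (force simp: N_def)
    \<comment> \<open>The cubic is \<open>(d - 1) * (d - 2) * (N - 4 - d)\<close>, nonnegative at
      all integers from 1 to \<open>N - 4\<close>.\<close>
    have "0 \<le> (\<Sum>v\<in>?V. (- 1) * int (deg B v) ^ 3 + (N - 1) * int (deg B v) ^ 2 + (10 - 3 * N) * int (deg B v) + 2 * (N - 4))"
    proof (rule sum_nonneg)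
      fix v assume v: "v \<in> ?V"
      have "0 \<le> ((int (deg B v) - 1) * (int (deg B v) - 2)) * (N - 4 - int (deg B v))"
      proof (cases "deg B v = 1")
        case False
        then show ?thesis using dn[OF v] dpos[OF v] by (intro mult_nonneg_nonneg) auto
      qed simp
      then show "0 \<le> (- 1) * int (deg B v) ^ 3 + (N - 1) * int (deg B v) ^ 2 + (10 - 3 * N) * int (deg B v) + 2 * (N - 4)"
        by (simp add: power2_eq_square power3_eq_cube algebra_simps)
    qed
    then have ineq0: "0 \<le> - s3 + (N - 1) * s2 + (10 - 3 * N) * (2 * N + 2) + 2 * (N - 4) * N"
      unfolding cub by simp
    have s3: "s3 = N ^ 3 - 9 * N\<^sup>2 + 28 * N - 4 + 12 * k + 6 * e + int (tri B)" using S3 by simp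
    define M where "M = N - 4"
    have NM: "N = M + 4" by (simp add: M_def)
    have ineq: "M * M - (2 * k - 1) * M + 6 * k + 6 * e - 12 + int (tri B) \<le> 0"
      using ineq0 unfolding s3 S2 NM by (simp add: power2_eq_square power3_eq_cube algebra_simps)
    have M3: "M \<ge> 3" using 3 by (simp add: M_def N_def)
    have trpos: "int (tri B) \<ge> 0" by simp
    have cases: "(k = 0 \<and> e = 0) \<or> (k = 1 \<and> e = 0) \<or> (k = 2 \<and> e = 0) \<or> (k = 3 \<and> e = 1) \<or> (k = 3 \<and> e = - 1)"
      using ke by auto
    have M5: "M \<le> 5"
    proof (rule ccontr)
      assume "\<not> ?thesis"
      then have M6: "M \<ge> 6" by simp
      have "M * (M - (2 * k - 1)) \<ge> 6 * (M - (2 * k - 1))" using M6 cases by (intro mult_right_mono) auto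
      then show False using ineq trpos M6 cases by (auto simp: algebra_simps)
    qed
    have "M = 3 \<or> M = 4 \<or> M = 5" using M3 M5 by auto
    \<comment> \<open>Only \<open>n = 7\<close> with \<open>F\<close> containing a path of three
      edges and \<open>n = 8\<close> with \<open>F\<close> containing a triangle pass both the
      inequality and the divisibility by \<open>n\<close>.\<close>
    then have "(k = 2 \<and> M = 3) \<or> (k = 3 \<and> e = - 1 \<and> M = 4)"
      using cases ineq trpos dvd unfolding NM by (elim disjE conjE) simp_all
    then show ?thesis
    proof (elim disjE conjE)
      assume k: "k = 2" and M: "M = 3"
      then have e: "e = 0" using cases by auto
      have N7: "N = 7" using M by (simp add: M_def)
      have d3: "deg B v \<le> 3" if "v \<in> ?V" for v using dn[OF that] N7 by simp
      have s2: "s2 = 42" unfolding S2 N7 k by simp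
      have l: "card (leaves B) = 2" using leaves_count[OF d3] unfolding s2 N7 by simp
      have "s3 = 118" using s3_small[OF d3] unfolding s2 N7 by simp
      then have "tri B = 0" using S3 unfolding N7 k e by simp
      moreover have "x \<le> 5" if "x \<in># spec B" for x using le[OF that] N7 by (simp add: N_def)
      ultimately show ?thesis using bip l N7 s2 by (simp add: n_def N_def)
    next
      assume k: "k = 3" and e: "e = - 1" and M: "M = 4"
      have N8: "N = 8" using M by (simp add: M_def)
      have d4: "deg B v = 1 \<or> deg B v = 2 \<or> deg B v = 3 \<or> deg B v = 4" if "v \<in> ?V" for v
        using dn[OF that] dpos[OF that] N8 by linarith
      have s2: "s2 = 54" unfolding S2 N8 k by simp
      have s3: "s3 = 186 + int (tri B)" using S3 unfolding N8 k e by simp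
      \<comment> \<open>The cubic \<open>(d - 2) * (d - 3) * (d - 4)\<close> isolates the degree 1,
        and \<open>(d - 1) * (d - 2) * (d - 4)\<close> below isolates the degree 3. Together they
        leave no triangle and four pendant vertices; then Mantel's bound fails for the four vertices
        of the core.\<close>
      have c1: "(\<Sum>v\<in>?V. 1 * int (deg B v) ^ 3 + (- 9) * int (deg B v) ^ 2 + 26 * int (deg B v) + (- 24)) =
          (\<Sum>v\<in>?V. if deg B v = 1 then - 6 else 0)"
        by (intro sum.cong refl) (use d4 in force)
      have c3: "(\<Sum>v\<in>?V. 1 * int (deg B v) ^ 3 + (- 7) * int (deg B v) ^ 2 + 14 * int (deg B v) + (- 8)) =
          (\<Sum>v\<in>?V. if deg B v = 3 then - 2 else 0)"
        by (intro sum.cong refl) (use d4 in force)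
      have "(\<Sum>v\<in>?V. if deg B v = 1 then - 6 else 0 :: int) = - 6 * int (card (leaves B))"
        using fin by (simp add: sum.If_cases leaves_def Int_def)
      then have l: "int (tri B) - 24 = - 6 * int (card (leaves B))"
        using c1 unfolding cub s2 s3 N8 by simp
      have "(\<Sum>v\<in>?V. if deg B v = 3 then - 2 else 0 :: int) \<le> 0" by (intro sum_nonpos) auto
      then have "int (tri B) \<le> 4" using c3 unfolding cub s2 s3 N8 by simp
      then have "tri B = 0" "card (leaves B) = 4" using l by presburger+
      moreover have "card ?V = 8" using N8 by (simp add: N_def n_def)
      ultimately show ?thesis
        using triangle_free_core_bound[OF B _ n2(2) conn] S1r by (simp add: n_def)
    qed
  qed
qed

subsection \<open>Joins with complete graphs\<close>

lemma bicyclic_conn: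
  assumes "bicyclic B"
  shows "pair_graph B" "conn B" "(\<Sum>v\<in>pverts B. deg B v) = 2 * card (pverts B) + 2"
proof -
  show B: "pair_graph B" using assms by (simp add: bicyclic_def)
  interpret pair_graph B by (rule B)
  show "(\<Sum>v\<in>pverts B. deg B v) = 2 * card (pverts B) + 2"
    using assms card_parcs[OF B] by (simp add: sum_deg_eq_card[OF B] bicyclic_def)
  show "conn B"
    unfolding conn_def
  proof (intro allI impI)
    fix S assume S: "S \<subseteq> pverts B" "S \<noteq> {}" "\<forall>(v, w)\<in>parcs B. v \<in> S \<longrightarrow> w \<in> S"
    obtain u where u: "u \<in> S" using S by blast
    have sc: "strongly_connected (with_proj (mk_symmetric (with_proj B)))"
      using assms by (simp add: bicyclic_def Digraph_Component.connected_def)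
    have "v \<in> S" if v: "v \<in> pverts B" for v
    proof -
      have "u \<rightarrow>\<^sup>*\<^bsub>with_proj (mk_symmetric (with_proj B))\<^esub> v"
        using sc u v S(1) unfolding strongly_connected_def by auto
      then have "u \<rightarrow>\<^sup>*\<^bsub>with_proj B\<^esub> v"
        using reachable_mk_symmetric_eq by blast
      then show "v \<in> S"
      proof (induction rule: reachable_induct)
        case base
        then show ?case using u by simp
      next
        case (step x y)
        then have "(x, y) \<in> parcs B" by auto
        then show ?case using step S(3) by blast
      qed
    qed
    then show "S = pverts B" using S(1) by blast
  qed
qed

lemma spec_no_arcs:
  assumes G: "pair_graph G" and "parcs G = {}"
  shows "spec G = replicate_mset (card (pverts G)) 0"
proof -
  have "size (filter_mset (\<lambda>x. x \<noteq> 0) (spec G)) \<le> card ({} :: ('a \<times> 'a) set)"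
    by (rule card_nonzero_spec_le[OF G]) (use assms in auto)
  then have 1: "filter_mset (\<lambda>x. x \<noteq> 0) (spec G) = {#}" by simp
  have "spec G = filter_mset (\<lambda>x. x \<noteq> 0) (spec G) + replicate_mset (count (spec G) 0) 0"
    by (rule multiset_eqI) simp
  then have 2: "spec G = replicate_mset (count (spec G) 0) 0" unfolding 1 by simp
  have "size (spec G) = count (spec G) 0" by (subst 2) simp
  then show ?thesis using 2 laplacian_spectrum_eq_spec(2)[OF G] by simp
qed

lemma sum_squares_le_square_sum:
  fixes f :: "'b \<Rightarrow> int"
  assumes "finite A" "\<And>x. x \<in> A \<Longrightarrow> f x \<ge> 0"
  shows "(\<Sum>x\<in>A. (f x)\<^sup>2) \<le> (\<Sum>x\<in>A. f x)\<^sup>2"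
  using assms
proof (induction A rule: finite_induct)
  case (insert x A)
  then have "(\<Sum>x\<in>A. f x) \<ge> 0" "f x \<ge> 0" by (auto intro: sum_nonneg)
  then have "f x * (\<Sum>x\<in>A. f x) \<ge> 0" by simp
  then show ?case using insert by (simp add: power2_eq_square algebra_simps)
qed simp

text \<open>Within \<open>W\<close> all degrees lie between 1 and \<open>card W - 1\<close>; the
  last bound sums the inequality \<open>(d - 1) * (card W - 1 - d) \<ge> 0\<close>.\<close>

lemma separated_sizes:
  assumes Q: "pair_graph Q" and W: "separated Q W" "W \<noteq> {}" and iso: "\<And>v. v \<in> pverts Q \<Longrightarrow> deg Q v \<ge> 1"
  shows "card W \<ge> 2"
    and "(\<Sum>v\<in>W. int (deg Q v)) \<le> int (card W) * (int (card W) - 1)"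
    and "(\<Sum>v\<in>W. int (deg Q v) ^ 2) \<le> int (card W) * (\<Sum>v\<in>W. int (deg Q v)) - int (card W) * (int (card W) - 1)"
proof -
  have WV: "W \<subseteq> pverts Q" using W by (simp add: separated_def)
  have finW: "finite W" using WV pair_graph_fin[OF Q] finite_subset by blast
  have pg: "pair_graph (induced Q W)" by (rule pair_graph_induced[OF Q WV])
  have d: "1 \<le> int (deg Q v)" "int (deg Q v) \<le> int (card W) - 1" if v: "v \<in> W" for v
  proof -
    show 1: "1 \<le> int (deg Q v)" using iso[of v] v WV by auto
    have "deg Q v \<le> card W - 1"
      using deg_complement(2)[OF pg, of v] v deg_induced[OF Q W(1) v] by simp
    then show "int (deg Q v) \<le> int (card W) - 1" using 1 by linarith
  qed
  obtain v where "v \<in> W" using W(2) by blast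
  then show "card W \<ge> 2" using d[of v] by linarith
  have "(\<Sum>v\<in>W. int (deg Q v)) \<le> (\<Sum>v\<in>W. int (card W) - 1)" by (intro sum_mono d)
  then show "(\<Sum>v\<in>W. int (deg Q v)) \<le> int (card W) * (int (card W) - 1)" by simp
  have "(\<Sum>v\<in>W. int (deg Q v) ^ 2) \<le> (\<Sum>v\<in>W. int (card W) * int (deg Q v) - (int (card W) - 1))"
  proof (intro sum_mono)
    fix v assume "v \<in> W"
    then have "0 \<le> (int (deg Q v) - 1) * (int (card W) - 1 - int (deg Q v))"
      using d[of v] by (intro mult_nonneg_nonneg) auto
    then show "int (deg Q v) ^ 2 \<le> int (card W) * int (deg Q v) - (int (card W) - 1)"
      by (simp add: power2_eq_square algebra_simps)
  qed
  then show "(\<Sum>v\<in>W. int (deg Q v) ^ 2) \<le> int (card W) * (\<Sum>v\<in>W. int (deg Q v)) - int (card W) * (int (card W) - 1)"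
    by (simp add: sum_subtractf sum_distrib_left)
qed

lemma spec_edge:
  assumes G: "pair_graph G" and c: "card (pverts G) = 2" and d: "\<And>v. v \<in> pverts G \<Longrightarrow> deg G v = 1"
  shows "spec G = {#0, 2#}"
proof -
  have ne: "pverts G \<noteq> {}" using c by auto
  obtain R where R: "spec G = add_mset 0 R" using zero_in_spec[OF G ne] by (metis insert_DiffM)
  have "size R = 1" using laplacian_spectrum_eq_spec(2)[OF G] c by (simp add: R)
  then obtain x where x: "R = {#x#}" by (metis size_1_singleton_mset)
  have "x = 2" using spec_sum[OF G] c d by (simp add: R x)
  then show ?thesis by (simp add: R x)
qed

text \<open>The degrees of \<open>B\<close> average slightly above 2, so the integral convexity
  estimate \<open>(d - 2) * (d - 3) \<ge> 0\<close> suits their squares; the lower bound is its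
  transfer to the complement.\<close>

lemma complement_bicyclic_sums:
  assumes B: "pair_graph B" and S: "(\<Sum>v\<in>pverts B. deg B v) = 2 * card (pverts B) + 2"
    and Q: "pair_graph Q" and sp: "spec Q = spec (complement B) + replicate_mset m 0"
  defines "n \<equiv> int (card (pverts B))"
  shows "int (card (pverts Q)) = n + m"
    and "(\<Sum>v\<in>pverts Q. int (deg Q v)) = n\<^sup>2 - 3 * n - 2"
    and "(\<Sum>v\<in>pverts Q. int (deg Q v) ^ 2) \<ge> n * (n - 1)\<^sup>2 - 4 * (n\<^sup>2 - 1) + 4 * n + 10"
proof -
  let ?C = "complement B"
  have C: "pair_graph ?C" by (rule pair_graph_complement[OF B])
  have fin: "finite (pverts B)" using pair_graph_fin[OF B] by simp
  show "int (card (pverts Q)) = n + m"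
    using arg_cong[OF sp, of size] laplacian_spectrum_eq_spec(2)[OF Q] laplacian_spectrum_eq_spec(2)[OF C]
    by (simp add: n_def)
  have Si: "(\<Sum>v\<in>pverts B. int (deg B v)) = 2 * n + 2"
    using arg_cong[OF S, of int] by (simp add: n_def)
  have dC: "int (deg ?C v) = n - 1 - int (deg B v)" if "v \<in> pverts B" for v
  proof -
    have "card (pverts B) \<ge> 1" using that fin by (metis One_nat_def Suc_leI card_gt_0_iff empty_iff)
    then show ?thesis using deg_complement[OF B that] by (simp add: n_def of_nat_diff)
  qed
  have r1: "(\<Sum>v\<in>pverts Q. real (deg Q v)) = (\<Sum>v\<in>pverts B. real (deg ?C v))"
    using spec_sum[OF Q] spec_sum[OF C] unfolding sp by simp
  have "(\<Sum>v\<in>pverts Q. real (deg Q v) ^ 2) = (\<Sum>v\<in>pverts B. real (deg ?C v) ^ 2)"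
    using spec_sum_sq[OF Q] spec_sum_sq[OF C] r1 unfolding sp by simp
  then have "real_of_int (\<Sum>v\<in>pverts Q. int (deg Q v) ^ 2) = real_of_int (\<Sum>v\<in>pverts B. int (deg ?C v) ^ 2)"
    by simp
  then have 2: "(\<Sum>v\<in>pverts Q. int (deg Q v) ^ 2) = (\<Sum>v\<in>pverts B. int (deg ?C v) ^ 2)"
    unfolding of_int_eq_iff .
  have "real_of_int (\<Sum>v\<in>pverts Q. int (deg Q v)) = real_of_int (\<Sum>v\<in>pverts B. int (deg ?C v))"
    using r1 by simp
  then have "(\<Sum>v\<in>pverts Q. int (deg Q v)) = (\<Sum>v\<in>pverts B. int (deg ?C v))"
    unfolding of_int_eq_iff .
  also have "\<dots> = (\<Sum>v\<in>pverts B. n - 1 - int (deg B v))" by (intro sum.cong refl dC)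
  also have "\<dots> = n * (n - 1) - (2 * n + 2)" by (simp add: sum_subtractf Si n_def)
  finally show "(\<Sum>v\<in>pverts Q. int (deg Q v)) = n\<^sup>2 - 3 * n - 2"
    by (simp add: power2_eq_square algebra_simps)
  have "(\<Sum>v\<in>pverts B. int (deg ?C v) ^ 2) = (\<Sum>v\<in>pverts B. (n - 1 - int (deg B v))\<^sup>2)"
    by (intro sum.cong refl) (simp add: dC)
  also have "\<dots> \<ge> (\<Sum>v\<in>pverts B. (n - 1)\<^sup>2 - 2 * (n - 1) * int (deg B v) + 5 * int (deg B v) - 6)"
  proof (intro sum_mono)
    fix v
    have "0 \<le> (int (deg B v) - 2) * (int (deg B v) - 3)"
    proof (cases "deg B v \<le> 2")
      case True then show ?thesis by (intro mult_nonpos_nonpos) auto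
    qed (intro mult_nonneg_nonneg, auto)
    then show "(n - 1)\<^sup>2 - 2 * (n - 1) * int (deg B v) + 5 * int (deg B v) - 6 \<le> (n - 1 - int (deg B v))\<^sup>2"
      by (simp add: power2_eq_square algebra_simps)
  qed
  also have "(\<Sum>v\<in>pverts B. (n - 1)\<^sup>2 - 2 * (n - 1) * int (deg B v) + 5 * int (deg B v) - 6) =
      n * (n - 1)\<^sup>2 - 2 * (n - 1) * (2 * n + 2) + 5 * (2 * n + 2) - 6 * n"
    by (simp add: sum.distrib sum_subtractf Si n_def[symmetric] flip: sum_distrib_left)
  finally show "(\<Sum>v\<in>pverts Q. int (deg Q v) ^ 2) \<ge> n * (n - 1)\<^sup>2 - 4 * (n\<^sup>2 - 1) + 4 * n + 10"
    unfolding 2 by (simp add: power2_eq_square algebra_simps)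
qed


lemma image_diff_diff: "image_mset (\<lambda>x. c - x) (image_mset (\<lambda>x. c - x) M) = (M :: real multiset)"
  by (simp add: image_mset.compositionality comp_def)

lemma ex_isolated_vertex:
  fixes Q :: "'b pair_pre_digraph" and B :: "'a pair_pre_digraph"
  assumes B: "pair_graph B" and conn: "conn B" and S: "(\<Sum>v\<in>pverts B. deg B v) = 2 * card (pverts B) + 2"
    and nt: "\<not> graph_iso B Theta_3_2_5"
    and Q: "pair_graph Q" and sp: "spec Q = spec (complement B) + replicate_mset m 0" and m: "m \<ge> 1"
  shows "\<exists>v\<in>pverts Q. deg Q v = 0"
proof (rule ccontr)
  assume "\<not> ?thesis"
  then have iso: "deg Q v \<ge> 1" if "v \<in> pverts Q" for v using that by force
  define n where "n = int (card (pverts B))"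
  define N where "N = int (card (pverts Q))"
  define T1 where "T1 = (\<Sum>v\<in>pverts Q. int (deg Q v))"
  define T2 where "T2 = (\<Sum>v\<in>pverts Q. int (deg Q v) ^ 2)"
  note cs = complement_bicyclic_sums[OF B S Q sp, folded n_def N_def T1_def T2_def]
  have fin: "finite (pverts Q)" using pair_graph_fin[OF Q] by simp
  have N: "N = n + m" by (rule cs(1))
  have T1: "T1 = n\<^sup>2 - 3 * n - 2" by (rule cs(2))
  have T2: "T2 \<ge> n * (n - 1)\<^sup>2 - 4 * (n\<^sup>2 - 1) + 4 * n + 10" by (rule cs(3))
  have neB: "pverts B \<noteq> {}"
  proof
    assume "pverts B = {}" then show False using S by simp
  qed
  have n1: "n \<ge> 1" using neB pair_graph_fin[OF B] by (simp add: n_def Suc_leI card_gt_0_iff flip: int_one_le_iff_zero_less)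
  have C: "pair_graph (complement B)" by (rule pair_graph_complement[OF B])
  have "card (pverts Q) \<noteq> 0" using N n1 by (simp add: N_def)
  then have neQ: "pverts Q \<noteq> {}" by auto
  have cB: "count (spec (complement B)) 0 \<ge> 1" using zero_in_spec[OF C] neB by (simp add: Suc_le_eq)
  then have m0: "m < count (spec Q) 0" unfolding sp by simp
  have T1N: "T1 \<ge> N"
  proof -
    have "(\<Sum>v\<in>pverts Q. 1) \<le> T1" unfolding T1_def using iso by (intro sum_mono) force
    then show ?thesis by (simp add: N_def)
  qed
  note bound = no_isolated_bounds[OF Q iso neQ, folded N_def T1_def T2_def]
  have b: "N - 2 * int m \<ge> 2" "T1 \<le> (N - 2 * int m) * (N - 2 * int m - 1) + 2 * int m"
      "T2 \<le> (N - 2 * int m) * (N - 2 * int m - 1)\<^sup>2 + 2 * int m"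
    using bound[OF _ m0] by auto
  have n5: "n \<ge> 5"
  proof (rule ccontr)
    assume "\<not> n \<ge> 5"
    then have "n = 1 \<or> n = 2 \<or> n = 3 \<or> n = 4" using n1 by auto
    then show False using T1N m unfolding T1 N by auto
  qed
  \<comment> \<open>The degrees minus 1 are nonnegative with known sum, so their squares add up to
    at most the square of that sum. This is strong when the degree sum barely exceeds the number of
    vertices.\<close>
  have T2x: "T2 \<le> (T1 - N)\<^sup>2 + 2 * T1 - N"
  proof -
    have "(\<Sum>v\<in>pverts Q. (int (deg Q v) - 1)\<^sup>2) \<le> (\<Sum>v\<in>pverts Q. int (deg Q v) - 1)\<^sup>2"
      by (rule sum_squares_le_square_sum[OF fin]) (use iso in force)
    also have "(\<Sum>v\<in>pverts Q. int (deg Q v) - 1) = T1 - N" by (simp add: sum_subtractf T1_def N_def)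
    also have "(\<Sum>v\<in>pverts Q. (int (deg Q v) - 1)\<^sup>2) = (\<Sum>v\<in>pverts Q. int (deg Q v) ^ 2 - 2 * int (deg Q v) + 1)"
      by (intro sum.cong refl) (simp add: power2_eq_square algebra_simps)
    also have "\<dots> = T2 - 2 * T1 + N" by (simp add: sum.distrib sum_subtractf T1_def T2_def N_def sum_distrib_left)
    finally show ?thesis by simp
  qed
  \<comment> \<open>The degree sum gives the inequality \<open>A\<close>, which together with
    \<open>n \<ge> j + 2\<close> leaves three pairs \<open>(j, n)\<close>; the sums of squares
    exclude these.\<close>
  have m1: "m = 1"
  proof (rule ccontr)
    assume "m \<noteq> 1"
    then have m2: "int m \<ge> 2" using m by simp
    define j where "j = int m"
    have j2: "j \<ge> 2" using m2 by (simp add: j_def)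
    have A: "2 * n * (j - 1) \<le> (j + 1) * (j + 2)"
      using b(2) unfolding T1 N j_def[symmetric] by (simp add: power2_eq_square algebra_simps)
    have nj: "n \<ge> j + 2" using b(1) unfolding N j_def[symmetric] by simp
    have "2 * (j + 2) * (j - 1) \<le> 2 * n * (j - 1)" using nj j2 by (intro mult_right_mono) auto
    then have "(j + 2) * (2 * (j - 1)) \<le> (j + 2) * (j + 1)" using A by (simp add: algebra_simps)
    then have "2 * (j - 1) \<le> j + 1" using j2 by (simp add: mult_le_cancel_left)
    then have "j = 2 \<or> j = 3" using j2 by auto
    moreover have "n = 5 \<or> n = 6" if "j = 2" using A n5 unfolding that by auto
    moreover have "n = 5" if "j = 3" using A n5 unfolding that by auto
    ultimately consider "j = 2" "n = 5" | "j = 2" "n = 6" | "j = 3" "n = 5" by blast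
    then show False
      using T2 T2x b(3) unfolding T1 N j_def[symmetric] by cases simp_all
  qed
  have Nn: "N = n + 1" using N m1 by simp
  \<comment> \<open>With three zeros, the degree bound for two split-off K2's lies below the actual
    degree sum as soon as \<open>n \<ge> 5\<close>.\<close>
  have c2: "count (spec Q) 0 \<le> 2"
  proof (rule ccontr)
    assume "\<not> ?thesis"
    then have "2 < count (spec Q) 0" by simp
    from bound[OF _ this] have "T1 \<le> (N - 4) * (N - 4 - 1) + 4" by auto
    then show False using n5 unfolding T1 Nn by (simp add: power2_eq_square algebra_simps)
  qed
  \<comment> \<open>An eigenvalue \<open>n\<close> of \<open>B\<close> is an additional zero of its
    complement, hence a third zero of \<open>Q\<close>.\<close>
  have nB: "real_of_int n \<notin># spec B"
  proof
    assume "real_of_int n \<in># spec B"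
    then have "real (card (pverts B)) \<in># spec B - {#0#}" using n1 by (simp add: n_def in_diff_count)
    then have "0 \<in># image_mset (\<lambda>x. real (card (pverts B)) - x) (spec B - {#0#})" by force
    then have "count (spec (complement B)) 0 \<ge> 2"
      unfolding spec_complement[OF B neB] by (simp add: Suc_le_eq)
    then show False using c2 unfolding sp m1 by simp
  qed
  have "\<not> conn Q"
  proof
    assume "conn Q"
    then show False using conn_count_zero[OF Q] m0 m1 by simp
  qed
  then obtain W0 where W0: "separated Q W0" "W0 \<noteq> {}" "W0 \<noteq> pverts Q" "W0 \<subseteq> pverts Q"
    using not_conn_separated[OF Q] by metis
  obtain W where W: "separated Q W" "W \<noteq> {}" "pverts Q - W \<noteq> {}" "W \<subseteq> pverts Q"
    and le: "card (pverts Q - W) \<le> card W"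
  proof (cases "card (pverts Q - W0) \<le> card W0")
    case True
    then show thesis using that[of W0] W0 by blast
  next
    case False
    have "pverts Q - (pverts Q - W0) = W0" using W0(4) by blast
    then show thesis using that[of "pverts Q - W0"] separated_Diff[OF Q W0(1)] W0 False by auto
  qed
  let ?U = "pverts Q - W"
  have U: "separated Q ?U" by (rule separated_Diff[OF Q W(1)])
  define p where "p = int (card W)"
  define q where "q = int (card ?U)"
  define sW where "sW = (\<Sum>v\<in>W. int (deg Q v))"
  define sU where "sU = (\<Sum>v\<in>?U. int (deg Q v))"
  have split: "(\<Sum>v\<in>pverts Q. f v) = (\<Sum>v\<in>W. f v) + (\<Sum>v\<in>?U. f v)" for f :: "'b \<Rightarrow> int"
    using sum.subset_diff[OF W(4) fin, of f] by simp
  have pq: "p + q = N"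
    using split[of "\<lambda>_. 1"] by (simp add: p_def q_def N_def)
  note zW = separated_sizes[OF Q W(1,2) iso, folded p_def sW_def]
  note zU = separated_sizes[OF Q U W(3) iso, folded q_def sU_def]
  have pq2: "p \<ge> 2" "q \<ge> 2" "q \<le> p" using zW(1) zU(1) le by (auto simp: p_def q_def)
  have T1s: "T1 = sW + sU" unfolding T1_def sW_def sU_def by (rule split)
  have T2s: "T2 \<le> p * sW - p * (p - 1) + (q * sU - q * (q - 1))"
    unfolding T2_def split using zW(3) zU(3) by linarith
  have nn: "n = p + q - 1" using pq Nn by simp
  \<comment> \<open>Two complete parts have the largest possible degree sum; comparing it with the
    actual one gives exactly this inequality.\<close>
  have "(p - 2) * (q - 2) \<le> 3"
    using zW(2) zU(2) T1s unfolding T1 nn by (simp add: power2_eq_square algebra_simps)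
  then have "q = 2 \<or> q = 3 \<and> (p = 3 \<or> p = 4 \<or> p = 5)"
  proof -
    assume h: "(p - 2) * (q - 2) \<le> 3"
    have "q \<le> 3"
    proof (rule ccontr)
      assume "\<not> q \<le> 3"
      then have "2 * 2 \<le> (p - 2) * (q - 2)" using pq2 by (intro mult_mono) auto
      then show False using h by simp
    qed
    then have "q = 2 \<or> q = 3" using pq2 by auto
    then show ?thesis using h pq2 by auto
  qed
  \<comment> \<open>The three cases with \<open>q = 3\<close> survive the degree sum and are
    excluded by the sum of squares.\<close>
  then have q2: "q = 2"
  proof (elim disjE conjE)
    assume "q = 3" "p = 3"
    then show ?thesis using T2 T2s T1s zW(2) zU(2) unfolding T1 nn by simp
  next
    assume "q = 3" "p = 4"
    then show ?thesis using T2 T2s T1s zW(2) zU(2) unfolding T1 nn by simp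
  next
    assume "q = 3" "p = 5"
    then show ?thesis using T2 T2s T1s zW(2) zU(2) unfolding T1 nn by simp
  qed simp
  have pn: "p = n - 1" using nn q2 by simp
  have gW: "pair_graph (induced Q W)" and gU: "pair_graph (induced Q ?U)"
    using pair_graph_induced[OF Q] W(4) by auto
  have spU: "spec (induced Q ?U) = {#0, 2#}"
  proof (rule spec_edge[OF gU])
    show cU: "card (pverts (induced Q ?U)) = 2" using q2 by (simp add: q_def)
    fix v assume v: "v \<in> pverts (induced Q ?U)"
    have "deg (induced Q ?U) v \<le> 1" using deg_complement(2)[OF gU v] cU by simp
    moreover have "deg (induced Q ?U) v \<ge> 1" using iso[of v] v deg_induced[OF Q U, of v] by simp
    ultimately show "deg (induced Q ?U) v = 1" by simp
  qed
  define F where "F = complement (induced Q W)"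
  have F: "pair_graph F" unfolding F_def by (rule pair_graph_complement[OF gW])
  have FV: "pverts F = W" by (simp add: F_def)
  define R where "R = spec F - {#0#}"
  have spF: "spec F = add_mset 0 R" using zero_in_spec[OF F] W(2) by (simp add: R_def FV)
  have spW: "spec (induced Q W) = add_mset 0 (image_mset (\<lambda>x. real_of_int p - x) R)"
    using spec_complement[OF F] W(2) complement_complement[OF gW] by (simp add: FV R_def F_def p_def)
  define L where "L = spec B - {#0#}"
  have spB: "spec B = add_mset 0 L" using zero_in_spec[OF B neB] by (simp add: L_def)
  have spC: "spec (complement B) = add_mset 0 (image_mset (\<lambda>x. real_of_int n - x) L)"
    using spec_complement[OF B neB] by (simp add: L_def n_def)
  have "spec (complement B) + {#0#} = spec (induced Q W) + {#0, 2#}"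
    using spec_separated[OF Q W(1)] unfolding spU sp m1 by simp
  then have "image_mset (\<lambda>x. real_of_int n - x) L = add_mset 2 (image_mset (\<lambda>x. real_of_int p - x) R)"
    unfolding spC spW by simp
  then have "image_mset (\<lambda>x. real_of_int n - x) (image_mset (\<lambda>x. real_of_int n - x) L) =
      image_mset (\<lambda>x. real_of_int n - x) (add_mset 2 (image_mset (\<lambda>x. real_of_int p - x) R))"
    by (rule arg_cong)
  \<comment> \<open>Subtraction from \<open>n\<close> sends the eigenvalue 2 of the small part to
    \<open>n - 2\<close>, and \<open>p - x\<close> to \<open>1 + x\<close> because
    \<open>p = n - 1\<close>.\<close>
  then have L: "L = add_mset (real_of_int n - 2) (image_mset (\<lambda>x. 1 + x) R)"
    unfolding image_diff_diff by (simp add: image_mset.compositionality comp_def pn)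
  have szR: "real (size R) = real_of_int p - 1"
    using laplacian_spectrum_eq_spec(2)[OF F] by (simp add: spF FV p_def)
  have "(\<Sum>x\<in>#spec B. x) = 2 * real_of_int n + 2"
    using spec_sum[OF B] S by (simp add: n_def flip: of_nat_sum)
  then have "(\<Sum>x\<in>#image_mset (\<lambda>x. 1 + x) R. x) = real_of_int n + 4"
    unfolding spB L by simp
  moreover have "(\<Sum>x\<in>#image_mset (\<lambda>x. 1 + x) R. x) = real (size R) + (\<Sum>x\<in>#R. x)"
    by (induction R) auto
  \<comment> \<open>From the total \<open>2 * n + 2\<close>, the eigenvalue \<open>n - 2\<close> and
    the \<open>n - 2\<close> summands 1 are removed; the rest is 6, so \<open>F\<close> has six
    arcs.\<close>
  ultimately have "(\<Sum>x\<in>#R. x) = 6" using szR pn by simp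
  then have "(\<Sum>v\<in>pverts F. real (deg F v)) = 6" using spec_sum[OF F] by (simp add: spF)
  then have "real (card (parcs F)) = 6" using sum_deg_eq_card[OF F] by (simp flip: of_nat_sum)
  then have cF: "card (parcs F) = 6" by simp
  have p4: "card W \<ge> 4" using pn n5 by (simp add: p_def)
  have F3: "card (pverts F) \<ge> 3" using p4 by (simp add: FV)
  obtain k e :: int and a b d where ke: "(k, e) \<in> {(0, 0), (1, 0), (2, 0), (3, 1), (3, - 1)}"
    and spF': "spec F = {#a, b, d#} + replicate_mset (card (pverts F) - 3) 0"
    and abd: "a + b + d = 6" "a ^ 2 + b ^ 2 + d ^ 2 = 12 + 2 * real_of_int k"
      "a ^ 3 + b ^ 3 + d ^ 3 = 24 + 12 * real_of_int k + 6 * real_of_int e"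
    using three_edge_spec[OF F cF F3] by (elim exE conjE)
  have cWn: "card W = card (pverts B) - 1" "card (pverts B) \<ge> 5"
    using pn n5 by (auto simp: p_def n_def)
  \<comment> \<open>One zero of \<open>F\<close> is split off because \<open>R\<close> omits
    it.\<close>
  have "replicate_mset (card (pverts F) - 3) (0::real) = add_mset 0 (replicate_mset (card (pverts B) - 5) 0)"
  proof -
    have "card (pverts F) - 3 = Suc (card (pverts B) - 5)" using cWn by (simp add: FV)
    then show ?thesis by simp
  qed
  then have R: "R = {#a, b, d#} + replicate_mset (card (pverts B) - 5) 0"
    using spF spF' by simp
  have "spec B = {#0, real (card (pverts B)) - 2, 1 + a, 1 + b, 1 + d#} + replicate_mset (card (pverts B) - 5) 1"
    unfolding spB L R by (simp add: n_def)
  moreover have "real (card (pverts B)) \<notin># spec B" using nB by (simp add: n_def)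
  moreover have "(\<Sum>v\<in>pverts B. int (deg B v)) = 2 * int (card (pverts B)) + 2"
    using arg_cong[OF S, of int] by simp
  ultimately have "graph_iso B Theta_3_2_5"
    by (intro theta_of_spec[OF B conn cWn(2) _ ke abd])
  then show False using nt by simp
qed


lemma graph_iso_spec:
  assumes "pair_graph G" "pair_graph H" "graph_iso G H"
  shows "spec G = spec H"
  using graph_iso_laplacian_spectrum[OF assms] by (simp add: spec_def)

section \<open>Splitting off universal vertices\<close>

lemma spec_complement_cong:
  assumes G: "pair_graph G" and H: "pair_graph H" and s: "spec G = spec H"
  shows "spec (complement G) = spec (complement H)"
proof -
  have c: "card (pverts G) = card (pverts H)"
    using laplacian_spectrum_eq_spec(2)[OF G] laplacian_spectrum_eq_spec(2)[OF H] s by simp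
  show ?thesis
  proof (cases "pverts G = {}")
    case True
    then have "pverts H = {}" using c pair_graph_fin[OF H] by simp
    then show ?thesis
      using True spec_no_arcs[OF pair_graph_complement[OF G]] spec_no_arcs[OF pair_graph_complement[OF H]]
      by (simp add: complement_def)
  next
    case False
    then have "pverts H \<noteq> {}" using c pair_graph_fin[OF G] by auto
    then show ?thesis using spec_complement[OF G False] spec_complement[OF H] c s by simp
  qed
qed

lemma complement_induced: "W \<subseteq> pverts G \<Longrightarrow> induced (complement G) W = complement (induced G W)"
  by (rule pair_pre_digraph.equality) (auto simp: complement_def induced_def)

text \<open>An isolated vertex of the complement is adjacent to all others in \<open>H\<close>.
  Removing it takes one zero from the spectrum of the complement; after \<open>m\<close> removals a
  graph cospectral with \<open>B\<close> is left, and \<open>L_DS B\<close> identifies it.\<close>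

lemma universal_vertices_split:
  fixes H :: "nat pair_pre_digraph" and B :: "'a pair_pre_digraph"
  assumes B: "pair_graph B" "conn B" "(\<Sum>v\<in>pverts B. deg B v) = 2 * card (pverts B) + 2"
    and nt: "\<not> graph_iso B Theta_3_2_5" and ds: "L_DS B"
  shows "pair_graph H \<Longrightarrow> spec (complement H) = spec (complement B) + replicate_mset m 0 \<Longrightarrow>
    \<exists>U \<subseteq> pverts H. card U = m \<and> (\<forall>u\<in>U. \<forall>v\<in>pverts H - {u}. (u, v) \<in> parcs H) \<and>
      graph_iso B (induced H (pverts H - U))"
proof (induction m arbitrary: H)
  case 0
  note H = 0(1)
  have "spec (complement (complement B)) = spec (complement (complement H))"
    by (rule spec_complement_cong) (use 0 B pair_graph_complement in auto)
  then have "L_cospectral B H"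
    using L_cospectral_iff_spec[OF B(1) H] by (simp add: complement_complement[OF B(1)] complement_complement[OF H])
  then have "graph_iso B H" using ds H by (simp add: L_DS_def)
  moreover have "induced H (pverts H - {}) = H"
    by (rule pair_pre_digraph.equality) (use pair_graph_wf[OF H] in \<open>auto simp: induced_def\<close>)
  ultimately show ?case by (intro exI[of _ "{}"]) simp
next
  case (Suc m)
  note H = Suc.prems(1)
  let ?Q = "complement H"
  have Q: "pair_graph ?Q" by (rule pair_graph_complement[OF H])
  obtain v where v: "v \<in> pverts H" and d0: "deg ?Q v = 0"
    using ex_isolated_vertex[OF B nt Q Suc.prems(2)] by auto
  have nb: "nbr ?Q v = {}" using d0 finite_nbr[OF Q] by (simp add: deg_nbr)
  then have univ: "(v, w) \<in> parcs H" if "w \<in> pverts H - {v}" for w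
    using that v by (auto simp: nbr_def complement_def)
  have sep: "separated ?Q {v}"
    using nb v pair_graph_symD[OF Q] by (auto simp: separated_def nbr_def)
  define V' where "V' = pverts H - {v}"
  define H' where "H' = induced H V'"
  have H': "pair_graph H'" unfolding H'_def V'_def by (rule pair_graph_induced[OF H]) auto
  have VH': "pverts H' = V'" by (simp add: H'_def)
  have "spec (induced ?Q {v}) = {#0#}"
    using spec_no_arcs[OF pair_graph_induced[OF Q], of "{v}"] v pair_graph_irrefl[OF Q, of v]
    by (simp add: induced_def)
  moreover have "induced ?Q (pverts ?Q - {v}) = complement H'"
    unfolding H'_def V'_def by (simp add: complement_induced)
  ultimately have "spec (complement H') = spec (complement B) + replicate_mset m 0"
    using spec_separated[OF Q sep] Suc.prems(2) by simp
  then obtain U where U: "U \<subseteq> V'" "card U = m" "\<And>u w. u \<in> U \<Longrightarrow> w \<in> V' - {u} \<Longrightarrow> (u, w) \<in> parcs H'"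
      "graph_iso B (induced H' (V' - U))"
    using Suc.IH[OF H'] unfolding VH' by blast
  have finU: "finite U" using U(1) pair_graph_fin[OF H] by (auto simp: V'_def intro: finite_subset)
  have vU: "v \<notin> U" using U(1) by (auto simp: V'_def)
  show ?case
  proof (intro exI[of _ "insert v U"] conjI ballI)
    show "insert v U \<subseteq> pverts H" using v U(1) by (auto simp: V'_def)
    show "card (insert v U) = Suc m" using U(2) finU vU by simp
    show "graph_iso B (induced H (pverts H - insert v U))"
    proof -
      have "induced H' (V' - U) = induced H (pverts H - insert v U)"
        by (rule pair_pre_digraph.equality) (auto simp: H'_def V'_def induced_def)
      then show ?thesis using U(4) by simp
    qed
    fix u w assume u: "u \<in> insert v U" and w: "w \<in> pverts H - {u}"
    show "(u, w) \<in> parcs H"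
    proof (cases "u = v \<or> w = v")
      case True
      moreover have "(v, u) \<in> parcs H" if "u \<noteq> v" using univ[of u] that u U(1) by (auto simp: V'_def)
      ultimately show ?thesis using univ[of w] w pair_graph_symD[OF H] by auto
    next
      case False
      then have "(u, w) \<in> parcs H'" using U(3)[of u w] u w by (auto simp: V'_def)
      then show ?thesis by (simp add: H'_def induced_def)
    qed
  qed
qed

section \<open>The complement of a join with a complete graph\<close>

lemma join_arcs:
  "(Inl x, Inl x') \<in> parcs (graph_join G H) \<longleftrightarrow> (x, x') \<in> parcs G"
  "(Inr y, Inr y') \<in> parcs (graph_join G H) \<longleftrightarrow> (y, y') \<in> parcs H"
  "(Inl x, Inr y) \<in> parcs (graph_join G H) \<longleftrightarrow> x \<in> pverts G \<and> y \<in> pverts H"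
  "(Inr y, Inl x) \<in> parcs (graph_join G H) \<longleftrightarrow> x \<in> pverts G \<and> y \<in> pverts H"
  by (auto simp: graph_join_def)

lemma pverts_join: "pverts (graph_join G H) = Inl ` pverts G \<union> Inr ` pverts H"
  by (auto simp: graph_join_def)

text \<open>In the complement no arc joins the two sides, and the side of \<open>K\<close> has no
  arcs at all, so it contributes only zeros.\<close>

lemma spec_complement_join:
  assumes B: "pair_graph B" and K: "complete_digraph m (with_proj K)"
  shows "spec (complement (graph_join B K)) = spec (complement B) + replicate_mset m 0"
proof -
  have KG: "pair_graph K" by (rule pair_graphI_complete[OF K])
  have Kp: "card (pverts K) = m" "parcs K = {(u, v). u \<in> pverts K \<and> v \<in> pverts K \<and> u \<noteq> v}"
    using K by (auto simp: complete_digraph_pair_def)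
  let ?J = "graph_join B K"
  let ?C = "complement ?J"
  have J: "pair_graph ?J" by (rule pair_graph_join[OF B KG])
  have C: "pair_graph ?C" by (rule pair_graph_complement[OF J])
  let ?L = "Inl ` pverts B"
  have sep: "separated ?C ?L"
    unfolding separated_def by (auto simp: complement_def pverts_join join_arcs)
  have U: "pverts ?C - ?L = Inr ` pverts K" by (auto simp: pverts_join)
  have gL: "pair_graph (induced ?C ?L)" and gR: "pair_graph (induced ?C (Inr ` pverts K))"
    by (rule pair_graph_induced[OF C], simp add: pverts_join)+
  have "parcs (induced ?C (Inr ` pverts K)) = {}"
    by (auto simp: induced_def complement_def join_arcs Kp(2))
  then have "spec (induced ?C (Inr ` pverts K)) = replicate_mset m 0"
    using spec_no_arcs[OF gR] Kp(1) by (simp add: card_image)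
  moreover have "graph_iso (complement B) (induced ?C ?L)"
    unfolding graph_iso_iff[OF pair_graph_complement[OF B] gL]
    by (intro exI[of _ Inl]) (auto simp: bij_betw_def induced_def complement_def join_arcs pverts_join)
  then have "spec (complement B) = spec (induced ?C ?L)"
    by (rule graph_iso_spec[OF pair_graph_complement[OF B] gL])
  ultimately show ?thesis using spec_separated[OF C sep] unfolding U by simp
qed

theorem mainTheorem3:
  fixes B :: "'a pair_pre_digraph" and K :: "'b pair_pre_digraph" and m :: nat
  assumes "bicyclic B"
    and "L_DS B"
    and "\<not> graph_iso B Theta_3_2_5"
    and "m \<ge> 1"
    and "complete_digraph m (with_proj K)"
  shows "L_DS (graph_join B K)"
  unfolding L_DS_def
proof (intro allI impI)
  fix H :: "nat pair_pre_digraph"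
  assume H: "pair_graph H" and co: "L_cospectral (graph_join B K) H"
  note B = bicyclic_conn[OF assms(1)]
  have K: "pair_graph K" by (rule pair_graphI_complete[OF assms(5)])
  have Kp: "finite (pverts K)" "card (pverts K) = m" "parcs K = {(u, v). u \<in> pverts K \<and> v \<in> pverts K \<and> u \<noteq> v}"
    using assms(5) by (auto simp: complete_digraph_pair_def)
  let ?J = "graph_join B K"
  have J: "pair_graph ?J" by (rule pair_graph_join[OF B(1) K])
  have "spec ?J = spec H" using co L_cospectral_iff_spec[OF J H] by simp
  then have "spec (complement H) = spec (complement B) + replicate_mset m 0"
    using spec_complement_cong[OF J H] spec_complement_join[OF B(1) assms(5)] by simp
  from universal_vertices_split[OF B assms(3,2) H this]
  obtain U where U: "U \<subseteq> pverts H" "card U = m" "\<forall>u\<in>U. \<forall>v\<in>pverts H - {u}. (u, v) \<in> parcs H"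
      "graph_iso B (induced H (pverts H - U))"
    by (elim exE conjE)
  have univ: "(u, v) \<in> parcs H" if "u \<in> U" "v \<in> pverts H" "u \<noteq> v" for u v using U(3) that by simp
  let ?W = "pverts H - U"
  have gW: "pair_graph (induced H ?W)" by (rule pair_graph_induced[OF H]) auto
  obtain f where f0: "bij_betw f (pverts B) (pverts (induced H ?W))"
    and fa: "\<forall>u\<in>pverts B. \<forall>v\<in>pverts B. (u, v) \<in> parcs B \<longleftrightarrow> (f u, f v) \<in> parcs (induced H ?W)"
    using U(4) unfolding graph_iso_iff[OF B(1) gW] by (elim exE conjE)
  have f: "bij_betw f (pverts B) ?W" using f0 by simp
  have finU: "finite U" using U(1) pair_graph_fin[OF H] finite_subset by blast
  obtain g where g: "bij_betw g (pverts K) U"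
    using finite_same_card_bij[OF Kp(1) finU] Kp(2) U(2) by auto
  \<comment> \<open>Any bijection from \<open>K\<close> to \<open>U\<close> will do, since both are
    complete and completely joined to the other vertices; on the side of \<open>B\<close> the
    isomorphism \<open>f\<close> is used.\<close>
  define h where "h z = (case z of Inl x \<Rightarrow> f x | Inr y \<Rightarrow> g y)" for z
  have fW: "f x \<in> pverts H" "f x \<notin> U" if "x \<in> pverts B" for x
    using bij_betwE[OF f] that by auto
  have gU: "g y \<in> U" "g y \<in> pverts H" if "y \<in> pverts K" for y
    using bij_betwE[OF g] that U(1) by auto
  have finj: "f x = f y \<longleftrightarrow> x = y" if "x \<in> pverts B" "y \<in> pverts B" for x y
    using inj_on_eq_iff[OF bij_betw_imp_inj_on[OF f] that] .
  have ginj: "g x = g y \<longleftrightarrow> x = y" if "x \<in> pverts K" "y \<in> pverts K" for x y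
    using inj_on_eq_iff[OF bij_betw_imp_inj_on[OF g] that] .
  have "bij_betw h (pverts ?J) (pverts H)"
    unfolding bij_betw_def
  proof
    have fg: "f x \<noteq> g y" if "x \<in> pverts B" "y \<in> pverts K" for x y
      using fW(2)[OF that(1)] gU(1)[OF that(2)] by metis
    show "inj_on h (pverts ?J)"
      unfolding pverts_join by (intro inj_onI) (auto simp: h_def finj ginj fg fg[symmetric])
    have "h ` pverts ?J = f ` pverts B \<union> g ` pverts K"
      unfolding pverts_join image_Un image_image by (simp add: h_def)
    also have "\<dots> = ?W \<union> U" using f g by (simp only: bij_betw_def)
    also have "\<dots> = pverts H" using U(1) by blast
    finally show "h ` pverts ?J = pverts H" .
  qed
  moreover have "(x, y) \<in> parcs ?J \<longleftrightarrow> (h x, h y) \<in> parcs H" if xy: "x \<in> pverts ?J" "y \<in> pverts ?J" for x y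
  proof -
    from xy consider
        u v where "x = Inl u" "y = Inl v" "u \<in> pverts B" "v \<in> pverts B"
      | u v where "x = Inr u" "y = Inr v" "u \<in> pverts K" "v \<in> pverts K"
      | u v where "x = Inl u" "y = Inr v" "u \<in> pverts B" "v \<in> pverts K"
      | u v where "x = Inr u" "y = Inl v" "u \<in> pverts K" "v \<in> pverts B"
      unfolding pverts_join by blast
    then show ?thesis
    proof cases
      case 1
      have "(x, y) \<in> parcs ?J \<longleftrightarrow> (u, v) \<in> parcs B" using 1 by (simp add: join_arcs)
      also have "\<dots> \<longleftrightarrow> (f u, f v) \<in> parcs H" using fa[rule_format, OF 1(3,4)] fW[OF 1(3)] fW[OF 1(4)] by (simp add: induced_def)
      finally show ?thesis using 1 by (simp add: h_def)
    next
      case 2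
      have "(x, y) \<in> parcs ?J \<longleftrightarrow> u \<noteq> v" using 2 by (simp add: join_arcs Kp(3))
      also have "\<dots> \<longleftrightarrow> (g u, g v) \<in> parcs H"
        using univ[OF gU(1)[OF 2(3)] gU(2)[OF 2(4)]] ginj[OF 2(3,4)] pair_graph_irrefl[OF H] by auto
      finally show ?thesis using 2 by (simp add: h_def)
    next
      case 3
      have "g v \<noteq> f u" using gU(1)[OF 3(4)] fW(2)[OF 3(3)] by metis
      then have "(g v, f u) \<in> parcs H" using univ[OF gU(1)[OF 3(4)] fW(1)[OF 3(3)]] by simp
      then have "(f u, g v) \<in> parcs H" by (rule pair_graph_symD[OF H])
      moreover have "(x, y) \<in> parcs ?J" using 3 by (simp add: join_arcs)
      ultimately show ?thesis using 3 by (simp add: h_def)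
    next
      case 4
      have "g u \<noteq> f v" using gU(1)[OF 4(3)] fW(2)[OF 4(4)] by metis
      then have "(g u, f v) \<in> parcs H" using univ[OF gU(1)[OF 4(3)] fW(1)[OF 4(4)]] by simp
      moreover have "(x, y) \<in> parcs ?J" using 4 by (simp add: join_arcs)
      ultimately show ?thesis using 4 by (simp add: h_def)
    qed
  qed
  ultimately show "graph_iso ?J H" unfolding graph_iso_iff[OF J H] by (intro exI[of _ h]) simp
qed

end
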